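(* Let $\Omega$ be an open subset of $\mathbf{C}$ and let $E$ be a closed polar subset of $\Omega$. Let $u$ be a continuous map from $\Omega$ into an almost complex manifold $(M,J)$ with $J$ of class $C^1$. If $u$ is $J$-holomorphic on $\Omega\setminus E$, then $u$ is $J$-holomorphic on $\Omega$.
   Context: A subset $E\subset\Omega$ is polar if for every $z\in\Omega$ there is a subharmonic function $\lambda$ defined on a neighborhood $V$ of $z$, not identically $-\infty$ near $z$, such that $E\cap V\subset\lambda^{-1}(-\infty)$. A map $w$ from an open subset of $\mathbf{C}$ (coordinate $z=x+iy$) into $(M,J)$ is $J$-holomorphic if it is of class $C^1$ and $\frac{\partial w}{\partial y}=J(w)\frac{\partial w}{\partial x}$. "Closed" means relatively closed in $\Omega$. *)

theory Defs
  imports "HOL-Analysis.Analysis"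
begin

section \<open>Subharmonic functions and polar sets\<close>

text \<open>The mean of \<open>f\<close> over the circle of centre \<open>z\<close> and radius \<open>r\<close>, as the difference of the
  means of the positive and negative parts (\<^const>\<open>e2ennreal\<close> truncates negative values to 0).
  It is only used for functions that are bounded above on the circle, so that the first integral is
  finite and the difference is never of the form \<open>\<infinity> - \<infinity>\<close>.\<close>

definition circle_mean :: "(complex \<Rightarrow> ereal) \<Rightarrow> complex \<Rightarrow> real \<Rightarrow> ereal" where
  "circle_mean f z r =
     (enn2ereal (\<integral>\<^sup>+t\<in>{0..2*pi}. e2ennreal (f (z + of_real r * cis t)) \<partial>lborel)
      - enn2ereal (\<integral>\<^sup>+t\<in>{0..2*pi}. e2ennreal (- f (z + of_real r * cis t)) \<partial>lborel)) / ereal (2*pi)"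

text \<open>The function that is identically \<open>-\<infinity>\<close> counts as subharmonic.\<close>

definition subharmonic_on :: "complex set \<Rightarrow> (complex \<Rightarrow> ereal) \<Rightarrow> bool" where
  "subharmonic_on V f \<longleftrightarrow>
     open V \<and>
     (\<forall>z\<in>V. f z \<noteq> \<infinity>) \<and>
     (\<forall>a. open {z\<in>V. f z < a}) \<and>
     (\<forall>z r. 0 < r \<longrightarrow> cball z r \<subseteq> V \<longrightarrow> f z \<le> circle_mean f z r)"

definition polar_in :: "complex set \<Rightarrow> complex set \<Rightarrow> bool" where
  "polar_in \<Omega> E \<longleftrightarrow>
     E \<subseteq> \<Omega> \<and>
     (\<forall>z\<in>\<Omega>. \<exists>V lam. z \<in> V \<and> subharmonic_on V lam \<and>
        \<not> (\<forall>\<^sub>F w in nhds z. lam w = -\<infinity>) \<and>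
        E \<inter> V \<subseteq> lam -` {-\<infinity>})"


section \<open>Maps of class \<open>C\<^sup>k\<close> on open subsets of Euclidean spaces\<close>

primrec Ck_on :: "nat \<Rightarrow> 'a::euclidean_space set \<Rightarrow> ('a \<Rightarrow> 'b::euclidean_space) \<Rightarrow> bool" where
  "Ck_on 0 S f \<longleftrightarrow> continuous_on S f"
| "Ck_on (Suc k) S f \<longleftrightarrow>
     (\<exists>f'. (\<forall>x\<in>S. (f has_derivative f' x) (at x)) \<and> (\<forall>h. Ck_on k S (\<lambda>x. f' x h)))"

definition smooth_on :: "'a::euclidean_space set \<Rightarrow> ('a \<Rightarrow> 'b::euclidean_space) \<Rightarrow> bool" where
  "smooth_on S f \<longleftrightarrow> (\<forall>k. Ck_on k S f)"


section \<open>Smooth manifolds and their tangent spaces\<close>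

text \<open>A chart is a pair of a domain and a coordinate map; the values of the coordinate map outside
  the domain are irrelevant. The manifold is the topological space \<open>X\<close> with a smooth atlas \<open>A\<close>,
  which need not be maximal.\<close>

type_synonym ('m, 'e) chart = "'m set \<times> ('m \<Rightarrow> 'e)"

definition chart_inv :: "('m, 'e) chart \<Rightarrow> 'e \<Rightarrow> 'm" where
  "chart_inv c = inv_into (fst c) (snd c)"

definition transition :: "('m, 'e) chart \<Rightarrow> ('m, 'e) chart \<Rightarrow> 'e \<Rightarrow> 'e" where
  "transition c d = snd d \<circ> chart_inv c"

definition is_chart :: "'m topology \<Rightarrow> ('m, 'e::euclidean_space) chart \<Rightarrow> bool" where
  "is_chart X c \<longleftrightarrow>
     openin X (fst c) \<and> open (snd c ` fst c) \<and>
     homeomorphic_map (subtopology X (fst c)) (top_of_set (snd c ` fst c)) (snd c)"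

definition smooth_manifold :: "'m topology \<Rightarrow> ('m, 'e::euclidean_space) chart set \<Rightarrow> bool" where
  "smooth_manifold X A \<longleftrightarrow>
     Hausdorff_space X \<and> second_countable X \<and>
     (\<forall>c\<in>A. is_chart X c) \<and>
     (\<Union>c\<in>A. fst c) = topspace X \<and>
     (\<forall>c\<in>A. \<forall>d\<in>A. smooth_on (snd c ` (fst c \<inter> fst d)) (transition c d))"

definition charts_at :: "('m, 'e) chart set \<Rightarrow> 'm \<Rightarrow> ('m, 'e) chart set" where
  "charts_at A p = {c\<in>A. p \<in> fst c}"

text \<open>A tangent vector at \<open>p\<close> assigns to every chart at \<open>p\<close> a coordinate vector, subject to the
  transformation law under changes of charts. It is normalised to be 0 at all other charts, so that
  tangent vectors are equal iff they have the same coordinates. The vector space operations are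
  those of the coordinates.\<close>

type_synonym ('m, 'e) tangent_vec = "('m, 'e) chart \<Rightarrow> 'e"

definition tangent_space ::
    "('m, 'e::euclidean_space) chart set \<Rightarrow> 'm \<Rightarrow> ('m, 'e) tangent_vec set" where
  "tangent_space A p =
     {v. (\<forall>c. c \<notin> charts_at A p \<longrightarrow> v c = 0) \<and>
         (\<forall>c\<in>charts_at A p. \<forall>d\<in>charts_at A p.
            v d = frechet_derivative (transition c d) (at (snd c p)) (v c))}"

text \<open>The tangent vector at \<open>p\<close> with coordinate vector \<open>h\<close> in the chart \<open>c\<close>.\<close>

definition tangent_of_coord ::
    "('m, 'e::euclidean_space) chart set \<Rightarrow> ('m, 'e) chart \<Rightarrow> 'm \<Rightarrow> 'e \<Rightarrow> ('m, 'e) tangent_vec" where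
  "tangent_of_coord A c p h =
     (\<lambda>d. if d \<in> charts_at A p
          then frechet_derivative (transition c d) (at (snd c p)) h else 0)"


section \<open>Almost complex structures and \<open>J\<close>-holomorphic maps\<close>

definition almost_complex_structure ::
    "'m topology \<Rightarrow> ('m, 'e::euclidean_space) chart set \<Rightarrow>
     ('m \<Rightarrow> ('m, 'e) tangent_vec \<Rightarrow> ('m, 'e) tangent_vec) \<Rightarrow> bool" where
  "almost_complex_structure X A J \<longleftrightarrow>
     (\<forall>p\<in>topspace X.
        (\<forall>v\<in>tangent_space A p. J p v \<in> tangent_space A p) \<and>
        (\<forall>v\<in>tangent_space A p. \<forall>w\<in>tangent_space A p. \<forall>a b.
           J p (\<lambda>c. a *\<^sub>R v c + b *\<^sub>R w c) = (\<lambda>c. a *\<^sub>R J p v c + b *\<^sub>R J p w c)) \<and>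
        (\<forall>v\<in>tangent_space A p. J p (J p v) = (\<lambda>c. - v c)))"

text \<open>The columns of the matrix of \<open>J\<close> in every chart are functions of class \<open>C\<^sup>1\<close> of the
  coordinates.\<close>

definition C1_structure ::
    "('m, 'e::euclidean_space) chart set \<Rightarrow>
     ('m \<Rightarrow> ('m, 'e) tangent_vec \<Rightarrow> ('m, 'e) tangent_vec) \<Rightarrow> bool" where
  "C1_structure A J \<longleftrightarrow>
     (\<forall>c\<in>A. \<forall>h. Ck_on 1 (snd c ` fst c)
        (\<lambda>x. J (chart_inv c x) (tangent_of_coord A c (chart_inv c x) h) c))"

definition C1_map_on ::
    "'m topology \<Rightarrow> ('m, 'e::euclidean_space) chart set \<Rightarrow> complex set \<Rightarrow> (complex \<Rightarrow> 'm) \<Rightarrow> bool" where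
  "C1_map_on X A W w \<longleftrightarrow>
     continuous_map (top_of_set W) X w \<and>
     (\<forall>c\<in>A. Ck_on 1 {z\<in>W. w z \<in> fst c} (\<lambda>z. snd c (w z)))"

text \<open>The partial derivative of \<open>w\<close> at \<open>z\<close> in the real direction \<open>h\<close>, as a tangent vector at
  \<open>w z\<close>; thus \<open>\<partial>w/\<partial>x\<close> for \<open>h = 1\<close> and \<open>\<partial>w/\<partial>y\<close> for \<open>h = \<i>\<close>.\<close>

definition partial_deriv ::
    "('m, 'e::euclidean_space) chart set \<Rightarrow> (complex \<Rightarrow> 'm) \<Rightarrow> complex \<Rightarrow> complex \<Rightarrow>
     ('m, 'e) tangent_vec" where
  "partial_deriv A w h z =
     (\<lambda>c. if c \<in> charts_at A (w z)
          then vector_derivative (\<lambda>t. snd c (w (z + t *\<^sub>R h))) (at 0) else 0)"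

definition J_holomorphic_on ::
    "'m topology \<Rightarrow> ('m, 'e::euclidean_space) chart set \<Rightarrow>
     ('m \<Rightarrow> ('m, 'e) tangent_vec \<Rightarrow> ('m, 'e) tangent_vec) \<Rightarrow>
     complex set \<Rightarrow> (complex \<Rightarrow> 'm) \<Rightarrow> bool" where
  "J_holomorphic_on X A J W w \<longleftrightarrow>
     open W \<and> C1_map_on X A W w \<and>
     (\<forall>z\<in>W. partial_deriv A w \<i> z = J (w z) (partial_deriv A w 1 z))"

end

theory Submission
  imports Defs
begin

text \<open>
  The question is local, so \<open>u\<close> may be read in a chart, as a continuous map into a ball of a
  Euclidean space that carries a Lipschitz field \<open>J\<close> of complex structures. Off \<open>E\<close> it is of class
  \<open>C\<^sup>1\<close> with \<open>\<partial>u/\<partial>y = J(u) \<partial>u/\<partial>x\<close>. Let \<open>lam\<close> be subharmonic and \<open>-\<infinity>\<close> on \<open>E\<close>. The points where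
  \<open>lam\<close> is finite are dense (\<open>subharmonic_finite_dense\<close>), and a circle around such a point meets \<open>E\<close>
  only in a null set of angles (\<open>subharmonic_circle_negligible\<close>).

  First, \<open>u\<close> is Lipschitz. For \<open>z0\<close> outside \<open>E\<close> put \<open>w = u - u z0\<close> and measure it in a norm that is
  Hermitian for \<open>J (u z0)\<close>. As Chirka observed, \<open>ln |w| + A |w|\<close> is plurisubharmonic near 0 for large
  \<open>A\<close>: for the constant structure the logarithm has nonnegative Levi form, and the Levi form of
  \<open>A |w|\<close>, of size \<open>A / |w|\<close>, dominates the errors from the variation of \<open>J\<close>
  (\<open>log_grad_levi_form_bound\<close>). Hence \<open>ln (|w| / |z - z0|) + A |w|\<close> is subharmonic off \<open>E\<close> and \<open>z0\<close>.
  It is bounded above near \<open>z0\<close>, since \<open>u\<close> is differentiable there, and \<open>E\<close> does not affect the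
  maximum principle (\<open>subharmonic_exception_maximum_principle\<close>). Comparison with a circle around
  \<open>z0\<close> gives \<open>|u z - u z0| \<le> C |z - z0|\<close> with \<open>C\<close> independent of \<open>z0\<close> (\<open>schwarz_lemma\<close>), first where
  \<open>lam\<close> is finite and then, by density, everywhere.

  Second, a Lipschitz map of this kind is of class \<open>C\<^sup>1\<close>. Consider the Cauchy integral for the
  complex derivative of \<open>u\<close> at \<open>z\<close> over the circle of radius \<open>r\<close>, formed with the constant structure
  \<open>J (u z)\<close>. Its derivative in \<open>r\<close> would vanish if the structure were constant; as it is, it is
  bounded uniformly in \<open>z\<close> and \<open>r\<close>, because \<open>J (u)\<close> varies by \<open>O(r)\<close> and \<open>u\<close> has bounded derivatives
  (\<open>mean_slope_has_derivative\<close>). So these integrals converge uniformly as \<open>r\<close> tends to 0. The limit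
  is continuous and extends \<open>\<partial>u/\<partial>x\<close> from the complement of \<open>E\<close>, and integrating along half circles
  that meet \<open>E\<close> in null sets shows that \<open>u\<close> is differentiable with the expected derivative
  (\<open>lipschitz_imp_continuously_differentiable\<close>). All integrals are over circles, so only
  one-dimensional measure theory occurs.
\<close>

section \<open>Subharmonic functions and the maximum principle\<close>

text \<open>This form of the mean value inequality involves a real integral only. It follows from the
  monotonicity of the two upper integrals in \<open>circle_mean\<close>.\<close>

lemma subharmonic_le_mean:
  assumes lam: "subharmonic_on V lam" and r: "0 < r" "cball z r \<subseteq> V"
    and c: "continuous_on {0..2*pi} c"
    and le: "\<And>t. t \<in> {0..2*pi} \<Longrightarrow> lam (z + of_real r * cis t) \<le> ereal (c t)"
  shows "lam z \<le> ereal (integral {0..2*pi} c / (2*pi))"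
proof -
  define P where "P = integral {0..2*pi} (\<lambda>t. max (c t) 0)"
  define N where "N = integral {0..2*pi} (\<lambda>t. max (- c t) 0)"
  have cont: "continuous_on {0..2*pi} (\<lambda>t. max (c t) 0)" "continuous_on {0..2*pi} (\<lambda>t. max (- c t) 0)"
    using c by (auto intro!: continuous_intros)
  have int: "(\<lambda>t. max (c t) 0) integrable_on {0..2*pi}" "(\<lambda>t. max (- c t) 0) integrable_on {0..2*pi}"
    using cont by (auto intro: integrable_continuous_real)
  have PN: "P - N = integral {0..2*pi} c"
    unfolding P_def N_def using int by (subst integral_diff[symmetric]) (auto intro!: integral_cong)
  have nn: "P \<ge> 0" "N \<ge> 0" unfolding P_def N_def using int by (auto intro!: integral_nonneg)
  have nnP: "(\<integral>\<^sup>+t. ennreal (max (c t) 0) * indicator {0..2*pi} t \<partial>lborel) = ennreal P"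
    using nn_integral_has_integral_lebesgue[OF _ integrable_integral[OF int(1)]]
    by (simp add: P_def ennreal_mult'' ennreal_indicator mult.commute)
  have nnN: "(\<integral>\<^sup>+t. ennreal (max (- c t) 0) * indicator {0..2*pi} t \<partial>lborel) = ennreal N"
    using nn_integral_has_integral_lebesgue[OF _ integrable_integral[OF int(2)]]
    by (simp add: N_def ennreal_mult'' ennreal_indicator mult.commute)
  let ?f = "\<lambda>t. lam (z + of_real r * cis t)"
  have 1: "(\<integral>\<^sup>+t\<in>{0..2*pi}. e2ennreal (?f t) \<partial>lborel) \<le> ennreal P"
    unfolding nnP[symmetric]
  proof (intro nn_integral_mono)
    fix t show "e2ennreal (?f t) * indicator {0..2*pi} t \<le> ennreal (max (c t) 0) * indicator {0..2*pi} t"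
    proof (cases "t \<in> {0..2*pi}")
      case True
      have "e2ennreal (?f t) \<le> e2ennreal (ereal (max (c t) 0))"
        using le[OF True] by (intro e2ennreal_mono) (auto simp: max_def split: if_splits intro: order_trans)
      then show ?thesis using True by (simp del: ereal_max)
    qed simp
  qed
  have 2: "ennreal N \<le> (\<integral>\<^sup>+t\<in>{0..2*pi}. e2ennreal (- ?f t) \<partial>lborel)"
    unfolding nnN[symmetric]
  proof (intro nn_integral_mono)
    fix t show "ennreal (max (- c t) 0) * indicator {0..2*pi} t \<le> e2ennreal (- ?f t) * indicator {0..2*pi} t"
    proof (cases "t \<in> {0..2*pi}")
      case True
      have "ereal (- c t) \<le> - ?f t" using le[OF True]
        by (metis ereal_uminus_le_reorder uminus_ereal.simps(1) ereal_minus_le_minus)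
      then have "e2ennreal (ereal (- c t)) \<le> e2ennreal (- ?f t)"
        by (rule e2ennreal_mono)
      then show ?thesis using True by (auto simp: max_def ennreal_neg)
    qed simp
  qed
  have 3: "enn2ereal (\<integral>\<^sup>+t\<in>{0..2*pi}. e2ennreal (?f t) \<partial>lborel) \<le> ereal P"
    using 1 nn(1) by (metis enn2ereal_ennreal less_eq_ennreal.rep_eq)
  have 4: "ereal N \<le> enn2ereal (\<integral>\<^sup>+t\<in>{0..2*pi}. e2ennreal (- ?f t) \<partial>lborel)"
    using 2 nn(2) by (metis enn2ereal_ennreal less_eq_ennreal.rep_eq)
  have "lam z \<le> circle_mean lam z r"
    using lam r unfolding subharmonic_on_def by blast
  also have "\<dots> \<le> (ereal P - ereal N) / ereal (2*pi)"
    unfolding circle_mean_def using ereal_minus_mono[OF 3 4] 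
    by (intro ereal_divide_right_mono) auto
  also have "\<dots> = ereal (integral {0..2*pi} c / (2*pi))"
    using PN by simp
  finally show ?thesis .
qed

lemma subharmonic_openin_less:
  assumes "subharmonic_on V lam" "K \<subseteq> V"
  shows "openin (top_of_set K) {z\<in>K. lam z < a}"
proof -
  have "{z\<in>K. lam z < a} = K \<inter> {z\<in>V. lam z < a}" using assms by auto
  then show ?thesis using assms unfolding subharmonic_on_def by (metis openin_open_Int)
qed

text \<open>Upper semicontinuity suffices for attaining a maximum. The last conclusion says that
  \<open>f + \<tau> lam\<close> is maximal at \<open>z\<close>; it is solved for \<open>lam\<close>, which may be \<open>-\<infinity>\<close> at other points.\<close>

lemma subharmonic_plus_continuous_attains_max:
  assumes lam: "subharmonic_on V lam" and K: "compact K" "K \<subseteq> V"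
    and f: "continuous_on K f" and \<tau>: "\<tau> > 0" and z1: "z1 \<in> K" "lam z1 \<noteq> -\<infinity>"
  obtains z where "z \<in> K" "lam z \<noteq> -\<infinity>" "ereal (f z1 / \<tau>) + lam z1 \<le> ereal (f z / \<tau>) + lam z" 
     "\<And>w. w \<in> K \<Longrightarrow> lam w \<le> lam z + ereal ((f z - f w) / \<tau>)"
proof -
  define g where "g = (\<lambda>w. ereal (f w / \<tau>) + lam w)"
  have fin: "lam w \<noteq> \<infinity>" if "w \<in> K" for w using lam K that unfolding subharmonic_on_def by auto
  have op: "openin (top_of_set K) {w\<in>K. g w < a}" for a
  proof (subst openin_subopen, intro allI ballI)
    fix w assume "w \<in> {w\<in>K. g w < a}"
    then have w: "w \<in> K" "g w < a" by auto
    have "\<exists>y e. e > 0 \<and> lam w < ereal y \<and> ereal (f w / \<tau> + e + y) \<le> a"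
    proof (cases "lam w")
      case (real l)
      obtain b where b: "g w < ereal b" "ereal b < a" using w(2) ereal_dense2 by blast
      have "f w / \<tau> + l < b" using b(1) real unfolding g_def by simp
      then show ?thesis using real b(2)
        by (intro exI[of _ "l + (b - (f w/\<tau> + l))/2"] exI[of _ "(b - (f w/\<tau> + l))/2"])
           (auto simp: field_simps)
    next
      case MInf
      obtain b where b: "ereal b < a" using w(2) ereal_dense2 by blast
      then show ?thesis using MInf
        by (intro exI[of _ "b - f w/\<tau> - 1"] exI[of _ 1]) auto
    qed (use fin[OF w(1)] in auto)
    then obtain y e where ye: "e > 0" "lam w < ereal y" "ereal (f w / \<tau> + e + y) \<le> a" by blast
    have o1: "openin (top_of_set K) {v\<in>K. lam v < ereal y}"
      by (rule subharmonic_openin_less[OF lam K(2)])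
    have o2: "openin (top_of_set K) (K \<inter> (\<lambda>v. f v / \<tau>) -` {..< f w / \<tau> + e})"
      using f \<tau> by (intro continuous_openin_preimage_gen continuous_intros) auto
    show "\<exists>T. openin (top_of_set K) T \<and> w \<in> T \<and> T \<subseteq> {w\<in>K. g w < a}"
    proof (intro exI conjI)
      show "openin (top_of_set K) ({v\<in>K. lam v < ereal y} \<inter> (K \<inter> (\<lambda>v. f v / \<tau>) -` {..< f w / \<tau> + e}))"
        using o1 o2 by blast
      show "w \<in> {v\<in>K. lam v < ereal y} \<inter> (K \<inter> (\<lambda>v. f v / \<tau>) -` {..< f w / \<tau> + e})"
        using w ye by auto
      show "{v\<in>K. lam v < ereal y} \<inter> (K \<inter> (\<lambda>v. f v / \<tau>) -` {..< f w / \<tau> + e}) \<subseteq> {w\<in>K. g w < a}"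
      proof clarsimp
        fix v assume v: "v \<in> K" "lam v < ereal y" "f v / \<tau> < f w / \<tau> + e"
        have "g v < ereal (f w / \<tau> + e) + ereal y"
          unfolding g_def using v by (intro ereal_add_strict_mono2) auto
        then show "g v < a" using ye(3) by simp
      qed
    qed
  qed
  have "\<exists>z\<in>K. \<forall>w\<in>K. g w \<le> g z"
  proof (rule ccontr)
    assume "\<not> ?thesis"
    then have nb: "\<forall>z\<in>K. \<exists>w\<in>K. g z < g w" by (auto simp: not_le)
    define C where "C = (\<lambda>w. {v\<in>K. g v < g w}) ` K"
    have "\<exists>D\<subseteq>C. finite D \<and> K \<subseteq> \<Union>D"
      using K(1) unfolding compact_eq_openin_cover
    proof (elim allE impE)
      show "(\<forall>c\<in>C. openin (top_of_set K) c) \<and> K \<subseteq> \<Union>C"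
        using op nb unfolding C_def by blast
    qed
    then obtain D where D: "D \<subseteq> C" "finite D" "K \<subseteq> \<Union>D" by blast
    then obtain F where F: "F \<subseteq> K" "finite F" "D = (\<lambda>w. {v\<in>K. g v < g w}) ` F"
      unfolding C_def using finite_subset_image[OF D(2) D(1)[unfolded C_def]] by blast
    have "F \<noteq> {}" using D F z1 by auto
    define m where "m = Max (g ` F)"
    have "m \<in> g ` F" unfolding m_def using F \<open>F \<noteq> {}\<close> by (intro Max_in) auto
    then obtain w where w: "w \<in> F" "g w = m" by auto
    then obtain x where x: "x \<in> F" "g w < g x" using D F by blast
    then have "g x \<le> m" unfolding m_def using F by auto
    then show False using x w by simp
  qed
  then obtain z where z: "z \<in> K" "\<And>w. w \<in> K \<Longrightarrow> g w \<le> g z" by blast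
  have le: "g z1 \<le> g z" using z z1 by auto
  have nz: "lam z \<noteq> -\<infinity>" using le z1 unfolding g_def by auto
  have "lam w \<le> lam z + ereal ((f z - f w) / \<tau>)" if "w \<in> K" for w
  proof -
    have "g w \<le> g z" using z that by auto
    then show ?thesis using nz fin[OF z(1)] fin[OF that] unfolding g_def
      by (cases "lam w"; cases "lam z") (auto simp: diff_divide_distrib)
  qed
  then show ?thesis using that[OF z(1) nz] le unfolding g_def by auto
qed

lemma subharmonic_bounded_above:
  assumes lam: "subharmonic_on V lam" and K: "compact K" "K \<subseteq> V"
  obtains B where "\<And>z. z \<in> K \<Longrightarrow> lam z \<le> ereal B"
proof (cases "\<exists>z1\<in>K. lam z1 \<noteq> -\<infinity>")
  case True
  then obtain z1 where z1: "z1 \<in> K" "lam z1 \<noteq> -\<infinity>" by blast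
  obtain z where z: "z \<in> K" "\<And>w. w \<in> K \<Longrightarrow> lam w \<le> lam z + ereal ((0 - 0) / 1)"
    by (rule subharmonic_plus_continuous_attains_max[OF lam K _ _ z1, of "\<lambda>_. 0" 1]) auto
  have "lam z \<noteq> \<infinity>" using lam K z unfolding subharmonic_on_def by auto
  then obtain b where "lam z \<le> ereal b" by (cases "lam z") auto
  then show ?thesis using z(2) by (intro that[of b]) (auto intro: order_trans)
next
  case False
  then show ?thesis by (intro that[of 0]) auto
qed

text \<open>Otherwise the negative part of \<open>lam\<close> has infinite integral over the circle, whereas the
  positive part is bounded, so the mean value, and with it \<open>lam z\<close>, would be \<open>-\<infinity>\<close>.\<close>

lemma subharmonic_circle_negligible:
  assumes lam: "subharmonic_on V lam" and r: "0 < r" "cball z r \<subseteq> V" and z: "lam z \<noteq> -\<infinity>"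
  shows "negligible {t\<in>{0..2*pi}. lam (z + of_real r * cis t) = -\<infinity>}"
proof -
  let ?f = "\<lambda>t. lam (z + of_real r * cis t)"
  define N where "N = {t\<in>{0..2*pi}. ?f t = -\<infinity>}"
  have inV: "z + of_real r * cis t \<in> V" for t
    using r by (auto intro!: subsetD[OF r(2)] simp: dist_norm norm_mult)
  have "N = (\<Inter>n::nat. {0..2*pi} \<inter> (\<lambda>t. z + of_real r * cis t) -` {w\<in>V. lam w < ereal (- real n)})"
  proof -
    have "x = -\<infinity>" if "\<And>n. x < ereal (- real n)" for x
    proof (cases x)
      case (real y)
      obtain n :: nat where "- y < real n" using reals_Archimedean2 by blast
      then show ?thesis using that[of n] real by simp
    qed (use that[of 0] in auto)
    then show ?thesis unfolding N_def using inV by auto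
  qed
  moreover have "(\<lambda>t. z + of_real r * cis t) -` {w\<in>V. lam w < ereal (- real n)} \<in> sets borel" for n
  proof -
    have "open {w\<in>V. lam w < ereal (- real n)}" using lam unfolding subharmonic_on_def by auto
    moreover have "continuous_on UNIV (\<lambda>t. z + of_real r * cis t)" by (intro continuous_intros)
    ultimately show ?thesis by (intro borel_open open_vimage) 
  qed
  ultimately have meas: "N \<in> sets borel" by auto
  obtain B where B: "\<And>w. w \<in> cball z r \<Longrightarrow> lam w \<le> ereal B"
    using subharmonic_bounded_above[OF lam compact_cball r(2)] by blast
  let ?P = "\<integral>\<^sup>+t\<in>{0..2*pi}. e2ennreal (?f t) \<partial>lborel"
  let ?N = "\<integral>\<^sup>+t\<in>{0..2*pi}. e2ennreal (- ?f t) \<partial>lborel"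
  have "?P \<le> (\<integral>\<^sup>+t\<in>{0..2*pi}. ennreal B \<partial>lborel)"
  proof (intro nn_integral_mono)
    fix t
    have "z + of_real r * cis t \<in> cball z r" using r by (auto simp: dist_norm norm_mult)
    then have "e2ennreal (?f t) \<le> e2ennreal (ereal B)"
      using B by (intro e2ennreal_mono) auto
    then show "e2ennreal (?f t) * indicator {0..2*pi} t \<le> ennreal B * indicator {0..2*pi} t"
      by (auto split: split_indicator)
  qed
  also have "\<dots> < top"
    by (simp add: nn_integral_cmult_indicator ennreal_mult_less_top)
  finally have Pfin: "?P < top" .
  have "?N < top"
  proof (rule ccontr)
    assume "\<not> ?N < top"
    then have "?N = top" by (metis less_top)
    moreover have "\<exists>p. enn2ereal ?P = ereal p" using Pfin
      by (cases "?P") auto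
    ultimately have "circle_mean lam z r = -\<infinity>"
      unfolding circle_mean_def by auto
    moreover have "lam z \<le> circle_mean lam z r" using lam r unfolding subharmonic_on_def by blast
    ultimately show False using z by auto
  qed
  moreover have "top * emeasure lborel N = (\<integral>\<^sup>+t. top * indicator N t \<partial>lborel)"
    using meas by (simp add: nn_integral_cmult_indicator)
  moreover have "(\<integral>\<^sup>+t. top * indicator N t \<partial>lborel) \<le> ?N"
    by (intro nn_integral_mono) (auto simp: N_def split: split_indicator)
  ultimately have "top * emeasure lborel N < top" by (metis le_less_trans)
  then have "emeasure lborel N = 0"
    by (metis ennreal_top_mult less_irrefl)
  then have "N \<in> null_sets lborel" using meas by auto
  then show ?thesis unfolding N_def[symmetric] negligible_iff_null_sets
    by (rule null_sets_completionI)
qed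

lemma not_negligible_Icc_inter_open:
  fixes t :: real
  assumes "open U" "t \<in> U" "t \<in> {a..b}" "a < b"
  shows "\<not> negligible ({a..b} \<inter> U)"
proof -
  obtain e where e: "e > 0" "ball t e \<subseteq> U" using assms openE by blast
  define c where "c = (if t < b then t else t - min (e/2) (b-a))"
  define d where "d = (if t < b then min b (t + e/2) else b)"
  have "{c<..<d} \<subseteq> {a..b} \<inter> U" using e assms
    by (auto simp: c_def d_def subset_iff dist_real_def min_def split: if_splits)
  moreover have "{c<..<d} \<noteq> {}" using assms e by (auto simp: c_def d_def min_def)
  then have "\<not> negligible {c<..<d}"
    by (metis box_real(1) negligible_interval(2))
  ultimately show ?thesis using negligible_subset by blast
qed

text \<open>Some point \<open>w\<close> close to \<open>p\<close> has a finite value. Any other point lies on a circle around \<open>w\<close>,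
  on which almost all values are finite.\<close>

lemma subharmonic_finite_dense:
  assumes lam: "subharmonic_on V lam" and V: "ball p R \<subseteq> V"
    and nontriv: "\<not> (\<forall>\<^sub>F w in nhds p. lam w = -\<infinity>)"
    and U: "open U" "q \<in> U" "q \<in> ball p (R/3)" 
  obtains z where "z \<in> U" "z \<in> ball p (R/3)" "lam z \<noteq> -\<infinity>"
proof -
  have R: "R > 0" using U(3) zero_le_dist[of p q] by (simp only: mem_ball)
  have "\<exists>\<^sub>F w in nhds p. lam w \<noteq> -\<infinity>" using nontriv by (simp add: frequently_def)
  moreover have "\<forall>\<^sub>F w in nhds p. w \<in> ball p (R/3)"
    by (rule eventually_nhds_in_open) (use R in auto)
  ultimately have "\<exists>\<^sub>F w in nhds p. lam w \<noteq> -\<infinity> \<and> w \<in> ball p (R/3)"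
    by (rule frequently_eventually_frequently)
  then have "\<exists>w. lam w \<noteq> -\<infinity> \<and> w \<in> ball p (R/3)" by (rule frequently_ex)
  then obtain w where w: "lam w \<noteq> -\<infinity>" "w \<in> ball p (R/3)" by blast
  show ?thesis
  proof (cases "q = w")
    case True
    then show ?thesis using that w U by auto
  next
    case False
    define r where "r = dist w q"
    have r: "r > 0" using False by (simp add: r_def)
    obtain t where t: "t \<in> {0..<2*pi}" "q - w = of_real r * cis t"
    proof -
      have "q - w = of_real (cmod (q - w)) * cis (Arg2pi (q - w))"
        using Arg2pi_eq[of "q - w"] by (simp add: cis_conv_exp)
      moreover have "Arg2pi (q-w) \<in> {0..<2*pi}" by (simp add: Arg2pi_ge_0 Arg2pi_lt_2pi)
      moreover have "cmod (q - w) = r" by (simp add: r_def dist_norm norm_minus_commute)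
      ultimately show ?thesis using that by metis
    qed
    have sub: "cball w r \<subseteq> V"
    proof -
      have "cball w r \<subseteq> ball p R"
      proof
        fix x assume x: "x \<in> cball w r"
        have "dist p x \<le> dist p w + dist w x" by (rule dist_triangle)
        moreover have "dist w x \<le> r" using x by simp
        moreover have "r \<le> dist p w + dist p q" unfolding r_def by (metis dist_triangle2 dist_commute)
        ultimately show "x \<in> ball p R" using w U(3) by auto
      qed
      then show ?thesis using V by auto
    qed
    let ?T = "(\<lambda>t. w + of_real r * cis t) -` (U \<inter> ball p (R/3))"
    have "open ?T" using U(1) by (intro open_vimage continuous_intros) auto
    moreover have "t \<in> ?T" using t(2) U by (auto simp: algebra_simps)
    ultimately have "\<not> negligible ({0..2*pi} \<inter> ?T)"
      using t by (intro not_negligible_Icc_inter_open) auto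
    then have "\<not> {0..2*pi} \<inter> ?T \<subseteq> {t\<in>{0..2*pi}. lam (w + of_real r * cis t) = -\<infinity>}"
      using subharmonic_circle_negligible[OF lam r sub w(1)] negligible_subset by blast
    then show ?thesis using that by blast
  qed
qed

text \<open>Points where \<open>lam = -\<infinity>\<close> are harmless for the maximum principle: adding \<open>\<tau> lam\<close> with a small
  \<open>\<tau> > 0\<close> keeps the maximum away from them and changes \<open>f z1\<close> only a little.\<close>

lemma subharmonic_exception_maximum_principle:
  assumes lam: "subharmonic_on V lam" and K: "compact K" "K \<subseteq> V"
    and f: "continuous_on K f"
    and strict: "\<And>z. z \<in> interior K \<Longrightarrow> lam z \<noteq> -\<infinity> \<Longrightarrow> M < f z \<Longrightarrow>
        \<forall>\<^sub>F r in at_right 0. 2*pi * f z < integral {0..2*pi} (\<lambda>t. f (z + of_real r * cis t))"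
    and bd: "\<And>z. z \<in> K \<Longrightarrow> z \<notin> interior K \<Longrightarrow> f z \<le> M"
    and z1: "z1 \<in> K" "lam z1 \<noteq> -\<infinity>"
  shows "f z1 \<le> M"
proof (rule ccontr)
  assume "\<not> f z1 \<le> M"
  then have gt: "f z1 > M" by simp
  obtain B where B: "\<And>z. z \<in> K \<Longrightarrow> lam z \<le> ereal B"
    using subharmonic_bounded_above[OF lam K] by blast
  have fin: "lam w \<noteq> \<infinity>" if "w \<in> K" for w using lam K that unfolding subharmonic_on_def by auto
  obtain l1 where l1: "lam z1 = ereal l1" using z1 fin by (cases "lam z1") auto
  have lB: "l1 \<le> B" using B[OF z1(1)] l1 by simp
  \<comment> \<open>so small that \<open>f + \<tau> (lam - B)\<close> still exceeds \<open>M\<close> at \<open>z1\<close>\<close>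
  define \<tau> where "\<tau> = (f z1 - M) / (2 * (B - l1 + 1))"
  have \<tau>: "\<tau> > 0" "\<tau> * (B - l1) < f z1 - M"
  proof -
    show "\<tau> > 0" using gt lB by (simp add: \<tau>_def)
    have "\<tau> * (B - l1) = (f z1 - M) * ((B - l1) / (2 * (B - l1 + 1)))" by (simp add: \<tau>_def)
    also have "\<dots> < (f z1 - M) * 1"
      using gt lB by (intro mult_strict_left_mono) (auto simp: field_simps)
    finally show "\<tau> * (B - l1) < f z1 - M" by simp
  qed
  obtain z where z: "z \<in> K" "lam z \<noteq> -\<infinity>" "ereal (f z1 / \<tau>) + lam z1 \<le> ereal (f z / \<tau>) + lam z" 
     "\<And>w. w \<in> K \<Longrightarrow> lam w \<le> lam z + ereal ((f z - f w) / \<tau>)"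
    using subharmonic_plus_continuous_attains_max[OF lam K f \<tau>(1) z1] by metis
  obtain l where l: "lam z = ereal l" using z fin by (cases "lam z") auto
  have "f z1 / \<tau> + l1 \<le> f z / \<tau> + l" using z(3) l l1 by simp
  moreover have "l \<le> B" using B[OF z(1)] l by simp
  ultimately have "f z1 / \<tau> - (B - l1) \<le> f z / \<tau>" by linarith
  then have "\<tau> * (f z1 / \<tau> - (B - l1)) \<le> \<tau> * (f z / \<tau>)" using \<tau>(1) by (intro mult_left_mono) auto
  then have "f z1 - \<tau> * (B - l1) \<le> f z" using \<tau>(1) by (simp add: right_diff_distrib)
  then have fz: "f z > M" using \<tau>(2) by linarith
  then have int: "z \<in> interior K" using bd z(1) by force
  then obtain e where e: "e > 0" "ball z e \<subseteq> K" by (meson mem_interior)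
  have "\<forall>\<^sub>F r in at_right 0. r \<in> {0<..<e}" using e by (intro eventually_at_right_real)
  with strict[OF int z(2) fz] have "\<forall>\<^sub>F r in at_right 0. r \<in> {0<..<e} \<and> 2*pi * f z < integral {0..2*pi} (\<lambda>t. f (z + of_real r * cis t))"
    by eventually_elim auto
  then obtain r where r: "0 < r" "r < e" "2*pi * f z < integral {0..2*pi} (\<lambda>t. f (z + of_real r * cis t))"
    by (metis (no_types, lifting) eventually_happens greaterThanLessThan_iff trivial_limit_at_right_real)
  have inK: "z + of_real r * cis t \<in> K" for t
    using r by (intro subsetD[OF e(2)]) (auto simp: dist_norm norm_mult)
  have cf: "continuous_on {0..2*pi} (\<lambda>t. f (z + of_real r * cis t))"
    using inK by (intro continuous_on_compose2[OF f] continuous_intros) auto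
  then have if1: "(\<lambda>t. f (z + of_real r * cis t)) integrable_on {0..2*pi}" by (rule integrable_continuous_real)
  \<comment> \<open>At the maximum \<open>z\<close> of \<open>f + \<tau> lam\<close>, \<open>lam\<close> lies below a continuous function of the angle, so its
      mean value inequality becomes the reverse of the one for \<open>f\<close>.\<close>
  have "lam z \<le> ereal (integral {0..2*pi} (\<lambda>t. l + (f z - f (z + of_real r * cis t)) / \<tau>) / (2*pi))"
  proof (rule subharmonic_le_mean[OF lam r(1)])
    show "cball z r \<subseteq> V" using r e K by (auto simp: subset_iff)
    show "continuous_on {0..2*pi} (\<lambda>t. l + (f z - f (z + of_real r * cis t)) / \<tau>)"
      using cf \<tau> by (intro continuous_intros) auto
    show "lam (z + of_real r * cis t) \<le> ereal (l + (f z - f (z + of_real r * cis t)) / \<tau>)" for t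
      using z(4)[OF inK] l by simp
  qed
  also have "integral {0..2*pi} (\<lambda>t. l + (f z - f (z + of_real r * cis t)) / \<tau>) =
     2*pi*l + (2*pi*f z - integral {0..2*pi} (\<lambda>t. f (z + of_real r * cis t))) / \<tau>"
  proof -
    have "((\<lambda>t. l + (f z - f (z + of_real r * cis t)) / \<tau>) has_integral
       ((2*pi - 0) *\<^sub>R l + ((2*pi - 0) *\<^sub>R f z - integral {0..2*pi} (\<lambda>t. f (z + of_real r * cis t))) / \<tau>)) {0..2*pi}"
      using if1 by (intro has_integral_add has_integral_divide has_integral_diff has_integral_const_real[THEN has_integral_eq_rhs] integrable_integral) auto
    then show ?thesis by (simp add: integral_unique)
  qed
  finally have 1: "l \<le> (2*pi*l + (2*pi*f z - integral {0..2*pi} (\<lambda>t. f (z + of_real r * cis t))) / \<tau>) / (2*pi)"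
    using l by simp
  have "(2*pi*f z - integral {0..2*pi} (\<lambda>t. f (z + of_real r * cis t))) / \<tau> < 0"
    using r(3) \<tau>(1) by (simp only: divide_less_0_iff) simp
  then have "(2*pi*l + (2*pi*f z - integral {0..2*pi} (\<lambda>t. f (z + of_real r * cis t))) / \<tau>) / (2*pi) < (2*pi*l) / (2*pi)"
    by (intro divide_strict_right_mono) auto
  also have "\<dots> = l" by simp
  finally show False using 1 by (meson not_le)
qed

section \<open>Circle means and the flux of the gradient\<close>

lemma complex_linear_decompose:
  fixes L :: "complex \<Rightarrow> 'a::real_normed_vector"
  assumes "linear L"
  shows "L h = Re h *\<^sub>R L 1 + Im h *\<^sub>R L \<i>"
proof -
  have "h = Re h *\<^sub>R 1 + Im h *\<^sub>R \<i>" by (simp add: complex_eq_iff)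
  then have "L h = L (Re h *\<^sub>R 1 + Im h *\<^sub>R \<i>)" by simp
  then show ?thesis using assms by (simp add: linear_add linear_scale)
qed

lemma circle_has_vector_derivative:
  assumes "(f has_derivative f') (at (c + of_real r * cis t))"
  shows "((\<lambda>t. f (c + of_real r * cis t)) has_vector_derivative r *\<^sub>R f' (\<i> * cis t)) (at t within T)"
proof -
  have "((\<lambda>t. c + of_real r * cis t) has_vector_derivative of_real r * (\<i> * cis t)) (at t within T)"
    by (auto intro!: derivative_eq_intros simp: has_vector_derivative_def scaleR_conv_of_real)
  from vector_derivative_diff_chain_within[OF this has_derivative_at_withinI[OF assms]]
  have "(f \<circ> (\<lambda>t. c + of_real r * cis t) has_vector_derivative f' (of_real r * (\<i> * cis t))) (at t within T)" .
  moreover have "f' (of_real r * (\<i> * cis t)) = r *\<^sub>R f' (\<i> * cis t)"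
    using linear_scale[OF has_derivative_linear[OF assms], of r "\<i> * cis t"] by (simp only: scaleR_conv_of_real)
  ultimately show ?thesis by (simp add: o_def)
qed

lemma radius_has_vector_derivative:
  assumes "(f has_derivative f') (at (c + of_real r * cis t))"
  shows "((\<lambda>r. f (c + of_real r * cis t)) has_vector_derivative f' (cis t)) (at r within T)"
proof -
  have "((\<lambda>r. c + of_real r * cis t) has_vector_derivative cis t) (at r within T)"
    by (auto intro!: derivative_eq_intros simp: has_vector_derivative_def scaleR_conv_of_real)
  from vector_derivative_diff_chain_within[OF this has_derivative_at_withinI[OF assms]]
  show ?thesis by (simp only: o_def)
qed

text \<open>The derivative in the radius of the integral of \<open>f\<close> over a circle is the integral of the
  radial derivative, so the circle means increase with the radius, starting from \<open>f c\<close>.\<close>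

lemma strict_submean_of_positive_flux:
  fixes f :: "complex \<Rightarrow> real"
  assumes \<delta>: "\<delta> > 0"
    and deriv: "\<And>z. z \<in> ball c \<delta> \<Longrightarrow> (f has_derivative f' z) (at z)"
    and cont: "\<And>h. continuous_on (ball c \<delta>) (\<lambda>z. f' z h)"
    and flux: "\<forall>\<^sub>F r in at_right 0. 0 < integral {0..2*pi} (\<lambda>t. f' (c + of_real r * cis t) (cis t))"
  shows "\<forall>\<^sub>F r in at_right 0. 2*pi * f c < integral {0..2*pi} (\<lambda>t. f (c + of_real r * cis t))"
proof -
  have inb: "c + of_real r * cis t \<in> ball c \<delta>" if "r \<in> {0..<\<delta>}" for r t
    using that by (auto simp: dist_norm norm_mult)
  have cf: "continuous_on (ball c \<delta>) f"
    using deriv by (meson continuous_at_imp_continuous_on has_derivative_continuous)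
  define m where "m = (\<lambda>r. integral (cbox 0 (2*pi)) (\<lambda>t. f (c + of_real r * cis t)))"
  define \<phi> where "\<phi> = (\<lambda>r. integral (cbox 0 (2*pi)) (\<lambda>t. f' (c + of_real r * cis t) (cis t)))"
  have dm: "(m has_vector_derivative \<phi> r) (at r within {0..<\<delta>})" if r: "r \<in> {0..<\<delta>}" for r
    unfolding m_def \<phi>_def
  proof (rule leibniz_rule_vector_derivative)
    show "((\<lambda>r. f (c + of_real r * cis t)) has_vector_derivative f' (c + of_real r * cis t) (cis t)) (at r within {0..<\<delta>})"
      if "r \<in> {0..<\<delta>}" for r t
      by (rule radius_has_vector_derivative[OF deriv[OF inb[OF that]]])
    show "(\<lambda>t. f (c + of_real r * cis t)) integrable_on cbox 0 (2*pi)" if "r \<in> {0..<\<delta>}" for r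
      by (intro integrable_continuous continuous_on_compose2[OF cf] continuous_intros) (use inb[OF that] in auto)
    have "continuous_on ({0..<\<delta>} \<times> cbox 0 (2*pi)) (\<lambda>x. cos (snd x) *\<^sub>R f' (c + of_real (fst x) * cis (snd x)) 1 
         + sin (snd x) *\<^sub>R f' (c + of_real (fst x) * cis (snd x)) \<i>)"
      using inb by (intro continuous_intros continuous_on_compose2[OF cont]) force+
    then show "continuous_on ({0..<\<delta>} \<times> cbox 0 (2*pi)) (\<lambda>(r, t). f' (c + of_real r * cis t) (cis t))"
    proof (rule continuous_on_eq)
      fix x assume x: "x \<in> {0..<\<delta>} \<times> cbox 0 (2*pi)"
      then have "linear (f' (c + of_real (fst x) * cis (snd x)))"
        by (intro has_derivative_linear[OF deriv] inb) auto
      from complex_linear_decompose[OF this, of "cis (snd x)"]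
      show "cos (snd x) *\<^sub>R f' (c + of_real (fst x) * cis (snd x)) 1 
         + sin (snd x) *\<^sub>R f' (c + of_real (fst x) * cis (snd x)) \<i> = (case x of (r, t) \<Rightarrow> f' (c + of_real r * cis t) (cis t))"
        by (simp add: split_beta)
    qed
  qed (use r in auto)
  obtain d where d: "d > 0" "\<And>r. 0 < r \<Longrightarrow> r < d \<Longrightarrow> 0 < \<phi> r"
    using flux unfolding \<phi>_def eventually_at_right_field by (auto simp: )
  have "2*pi * f c < m r" if r: "0 < r" "r < min d \<delta>" for r
  proof -
    have "m 0 < m r"
    proof (rule DERIV_pos_imp_increasing_open[OF r(1)])
      fix x assume x: "0 < x" "x < r"
      then have "(m has_vector_derivative \<phi> x) (at x within {0<..<\<delta>})"
        using r by (intro has_vector_derivative_within_subset[OF dm]) auto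
      then have "(m has_vector_derivative \<phi> x) (at x)"
        using x r by (subst (asm) at_within_open) auto
      then show "\<exists>y. DERIV m x :> y \<and> 0 < y"
        using d x r by (auto simp: has_real_derivative_iff_has_vector_derivative)
    next
      have "continuous_on {0..<\<delta>} m"
        unfolding continuous_on_eq_continuous_within
        using dm has_vector_derivative_continuous by blast
      then show "continuous_on {0..r} m" by (rule continuous_on_subset) (use r in auto)
    qed
    then show ?thesis by (simp add: m_def)
  qed
  then show ?thesis
    unfolding eventually_at_right_field m_def
    by (intro exI[of _ "min d \<delta>"]) (use d \<delta> in auto)
qed

text \<open>The integrand is \<open>1 / r\<close> times the derivative of \<open>w\<close> along the circle.\<close>

lemma integral_circle_tangential_zero:
  fixes w :: "complex \<Rightarrow> 'f::banach"
  assumes deriv: "\<And>t. (w has_derivative w' (c + of_real r * cis t)) (at (c + of_real r * cis t))" and r: "r \<noteq> 0"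
  shows "((\<lambda>t. w' (c + of_real r * cis t) (\<i> * cis t)) has_integral 0) {0..2*pi}"
proof -
  have "((\<lambda>t. r *\<^sub>R w' (c + of_real r * cis t) (\<i> * cis t)) has_integral
      (w (c + of_real r * cis (2*pi)) - w (c + of_real r * cis 0))) {0..2*pi}"
    by (intro fundamental_theorem_of_calculus circle_has_vector_derivative deriv) auto
  from has_integral_cmul[OF this, of "inverse r"] show ?thesis using r by simp
qed

lemma integral_quadratic_cis:
  fixes B :: "'f::real_inner \<Rightarrow> 'f"
  assumes "linear B"
  shows "((\<lambda>t. inner (B (cos t *\<^sub>R x + sin t *\<^sub>R y)) (cos t *\<^sub>R x + sin t *\<^sub>R y)) has_integral
      pi * (inner (B x) x + inner (B y) y)) {0..2*pi}"
proof -
  define F where "F = (\<lambda>t. (t/2 + sin (2*t)/4) * inner (B x) x + (t/2 - sin (2*t)/4) * inner (B y) y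
     + (sin t)\<^sup>2 / 2 * (inner (B x) y + inner (B y) x))"
  have eq: "inner (B (cos t *\<^sub>R x + sin t *\<^sub>R y)) (cos t *\<^sub>R x + sin t *\<^sub>R y) =
      (cos t)^2 * inner (B x) x + (sin t)^2 * inner (B y) y + (sin t * cos t) * (inner (B x) y + inner (B y) x)" for t
    using assms by (simp add: linear_add linear_scale inner_add_left inner_add_right algebra_simps power2_eq_square)
  have "((\<lambda>t. (cos t)^2 * inner (B x) x + (sin t)^2 * inner (B y) y + (sin t * cos t) * (inner (B x) y + inner (B y) x))
      has_integral (F (2*pi) - F 0)) {0..2*pi}"
  proof (intro fundamental_theorem_of_calculus)
    fix t :: real
    show "(F has_vector_derivative ((cos t)^2 * inner (B x) x + (sin t)^2 * inner (B y) y + (sin t * cos t) * (inner (B x) y + inner (B y) x)))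
       (at t within {0..2*pi})"
    proof -
      have e: "(cos t)\<^sup>2 = 1/2 + cos (2*t)/2" "(sin t)\<^sup>2 = 1/2 - cos (2*t)/2"
        using cos_double_cos[of t] sin_squared_eq[of t] by linarith+
      show ?thesis
        unfolding has_real_derivative_iff_has_vector_derivative[symmetric] F_def e
        by (auto intro!: derivative_eq_intros)
    qed
  qed simp
  moreover have "F (2*pi) - F 0 = pi * (inner (B x) x + inner (B y) y)"
  proof -
    have "sin (2*(2*pi)) = 0" by (simp only: sin_double sin_two_pi) simp
    then show ?thesis by (simp add: F_def algebra_simps)
  qed
  ultimately show ?thesis unfolding eq by simp
qed

text \<open>Think of \<open>g\<close> as the gradient of a function \<open>\<rho>\<close>; \<open>r\<close> times the integral is the flux of the
  gradient of \<open>\<rho> \<circ> w\<close> through a small circle. Although \<open>w\<close> is only of class \<open>C\<^sup>1\<close>, the integral can be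
  bounded up to \<open>o(r)\<close>: subtract from \<open>g (w z)\<close> its value at the centre; the remaining constant vector pairs with
  \<open>w' (cis t) = - JJ (w' (\<i> cis t))\<close>, whose integral vanishes if \<open>JJ\<close> is replaced by its value at the
  centre. So the second derivatives of \<open>\<rho>\<close> in the directions \<open>w' 1\<close> and \<open>w' \<i>\<close> remain, and an error
  from the variation of \<open>JJ\<close>. The constant is \<open>18 = 2 \<cdot> 3\<^sup>2\<close>, as \<open>w' c\<close> has norm at most three times that
  of \<open>w' c 1\<close>.\<close>

lemma flux_lower_bound:
  fixes w :: "complex \<Rightarrow> 'f::euclidean_space" and g :: "'f \<Rightarrow> 'f" and JJ :: "complex \<Rightarrow> 'f \<Rightarrow> 'f"
  assumes \<delta>: "\<delta> > 0"
    and deriv: "\<And>z. z \<in> ball c \<delta> \<Longrightarrow> (w has_derivative w' z) (at z)"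
    and cont: "\<And>h. continuous_on (ball c \<delta>) (\<lambda>z. w' z h)"
    and Jeq: "\<And>z h. z \<in> ball c \<delta> \<Longrightarrow> w' z (\<i> * h) = JJ z (w' z h)"
    and lin: "linear (JJ c)"
    and lip: "\<And>z y. z \<in> ball c \<delta> \<Longrightarrow> norm (JJ z y - JJ c y) \<le> \<kappa> * norm (w z - w c) * norm y" and \<kappa>: "\<kappa> \<ge> 0"
    and g: "(g has_derivative g') (at (w c))" and gcont: "continuous_on (w ` ball c \<delta>) g"
    and size: "norm (w' c \<i>) \<le> 2 * norm (w' c 1)" and b: "b > 0"
  shows "\<forall>\<^sub>F r in at_right 0. 
     r * (pi * (inner (g' (w' c 1)) (w' c 1) + inner (g' (w' c \<i>)) (w' c \<i>))
          - 18 * pi * \<kappa> * norm (g (w c)) * (norm (w' c 1))\<^sup>2 - b)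
     \<le> integral {0..2*pi} (\<lambda>t. inner (g (w (c + of_real r * cis t))) (w' (c + of_real r * cis t) (cis t)))"
proof -
  have cin: "c \<in> ball c \<delta>" using \<delta> by simp
  define M where "M = 3 * norm (w' c 1)"
  have linw: "linear (w' z)" if "z \<in> ball c \<delta>" for z using deriv[OF that] by (rule has_derivative_linear)
  have Mb: "norm (w' c (cis t)) \<le> M" for t
  proof -
    have "norm (w' c (cis t)) \<le> \<bar>cos t\<bar> * norm (w' c 1) + \<bar>sin t\<bar> * norm (w' c \<i>)"
      using complex_linear_decompose[OF linw[OF cin], of "cis t"]
        norm_triangle_ineq[of "cos t *\<^sub>R w' c 1" "sin t *\<^sub>R w' c \<i>"] by simp
    also have "\<dots> \<le> 1 * norm (w' c 1) + 1 * norm (w' c \<i>)"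
      by (intro add_mono mult_right_mono) auto
    finally show ?thesis using size by (simp add: M_def)
  qed
  have Mi: "norm (w' c (\<i> * cis t)) \<le> M" for t
    using Mb[of "t + pi/2"] by (simp add: cis_mult[symmetric] mult.commute)
  have M0: "M \<ge> 0" by (simp add: M_def)
  have bl: "bounded_linear g'" using g by (rule has_derivative_bounded_linear)
  define G where "G = onorm g'"
  have Gb: "norm (g' y) \<le> G * norm y" for y unfolding G_def by (rule onorm[OF bl])
  have G0: "G \<ge> 0" unfolding G_def by (rule onorm_pos_le[OF bl])
  define Q where "Q = M + G * M + 1 + \<kappa> * norm (g (w c)) * (2 * M + 1)"
  have Q0: "Q > 0" unfolding Q_def using M0 G0 \<kappa> by (intro add_nonneg_pos add_pos_nonneg) auto
  define e where "e = min 1 (b / (2*pi*Q))"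
  have e: "e > 0" "e \<le> 1" using b Q0 by (auto simp: e_def)
  have eQ: "2 * pi * (e * Q) \<le> b"
  proof -
    have "e * Q \<le> b / (2*pi*Q) * Q" unfolding e_def using Q0 by (intro mult_right_mono) auto
    also have "\<dots> = b / (2*pi)" using Q0 by simp
    finally show ?thesis by (simp add: field_simps)
  qed
  have gw: "((\<lambda>z. g (w z)) has_derivative (\<lambda>h. g' (w' c h))) (at c)"
    using diff_chain_at[OF deriv[OF cin] g] by (simp add: o_def)
  obtain d1 where d1: "d1 > 0" "\<And>z. norm (z - c) < d1 \<Longrightarrow> norm (g (w z) - g (w c) - g' (w' c (z - c))) \<le> e * norm (z - c)"
    using gw e(1) unfolding has_derivative_at_alt by blast
  obtain d2 where d2: "d2 > 0" "\<And>z. norm (z - c) < d2 \<Longrightarrow> norm (w z - w c - w' c (z - c)) \<le> e * norm (z - c)"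
    using deriv[OF cin] e(1) unfolding has_derivative_at_alt by blast
  have "\<exists>d>0. \<forall>z\<in>ball c \<delta>. dist z c < d \<longrightarrow> dist (w' z h) (w' c h) < e/2" for h
    using cont[of h] cin e(1) unfolding continuous_on_iff by (meson half_gt_zero)
  then obtain d3 where d3: "\<And>h. d3 h > 0" "\<And>h z. z \<in> ball c \<delta> \<Longrightarrow> dist z c < d3 h \<Longrightarrow> dist (w' z h) (w' c h) < e/2"
    by metis
  define r0 where "r0 = Min {d1, d2, d3 1, d3 \<i>, \<delta>}"
  have r0: "r0 > 0" unfolding r0_def using d1 d2 d3 \<delta> by auto
  have main: "r * (pi * (inner (g' (w' c 1)) (w' c 1) + inner (g' (w' c \<i>)) (w' c \<i>))
          - 18 * pi * \<kappa> * norm (g (w c)) * (norm (w' c 1))\<^sup>2 - b)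
     \<le> integral {0..2*pi} (\<lambda>t. inner (g (w (c + of_real r * cis t))) (w' (c + of_real r * cis t) (cis t)))"
    if r: "0 < r" "r < r0" for r
  proof -
    define Z where "Z = (\<lambda>t. c + of_real r * cis t)"
    have Zb: "Z t \<in> ball c \<delta>" for t using r by (auto simp: Z_def dist_norm norm_mult r0_def)
    have Zd: "norm (Z t - c) = r" "dist (Z t) c = r" for t using r by (auto simp: Z_def norm_mult dist_norm)
    have near: "norm (w' (Z t) h - w' c h) \<le> e" if h: "norm h = 1" for t h
    proof -
      have A: "norm (w' (Z t) 1 - w' c 1) \<le> e/2" "norm (w' (Z t) \<i> - w' c \<i>) \<le> e/2"
        using d3(2)[OF Zb, of t 1] d3(2)[OF Zb, of t \<i>] r Zd[of t] by (auto simp: r0_def dist_norm)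
      have "w' (Z t) h - w' c h = Re h *\<^sub>R (w' (Z t) 1 - w' c 1) + Im h *\<^sub>R (w' (Z t) \<i> - w' c \<i>)"
        using complex_linear_decompose[OF linw[OF Zb], of t h] complex_linear_decompose[OF linw[OF cin], of h]
        by (simp add: algebra_simps)
      also have "norm \<dots> \<le> \<bar>Re h\<bar> * norm (w' (Z t) 1 - w' c 1) + \<bar>Im h\<bar> * norm (w' (Z t) \<i> - w' c \<i>)"
        by (rule order_trans[OF norm_triangle_ineq]) simp
      also have "\<dots> \<le> 1 * (e/2) + 1 * (e/2)"
        using h abs_Re_le_cmod[of h] abs_Im_le_cmod[of h] A e by (intro add_mono mult_mono) auto
      finally show ?thesis by simp
    qed
    define x where "x = (\<lambda>t. w' (Z t) (\<i> * cis t))"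
    define v where "v = (\<lambda>t. w' (Z t) (cis t))"
    have vJ: "v t = - JJ (Z t) (x t)" for t
    proof -
      have "JJ (Z t) (x t) = w' (Z t) (\<i> * (\<i> * cis t))" unfolding x_def by (rule Jeq[OF Zb, symmetric])
      also have "\<i> * (\<i> * cis t) = - cis t" by simp
      finally show ?thesis unfolding v_def using linw[OF Zb] by (simp add: linear_neg)
    qed
    have xint: "(x has_integral 0) {0..2*pi}"
      unfolding x_def Z_def by (rule integral_circle_tangential_zero) (use deriv[OF Zb] r in \<open>auto simp: Z_def\<close>)
    have blJ: "bounded_linear (\<lambda>y. inner (g (w c)) (JJ c y))"
      using lin bounded_linear_compose[OF bounded_linear_inner_right] linear_conv_bounded_linear by blast
    have xJ: "((\<lambda>t. inner (g (w c)) (JJ c (x t))) has_integral 0) {0..2*pi}"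
      using has_integral_linear[OF xint blJ] lin by (simp add: o_def linear_0)
    have Zcont: "continuous_on {0..2*pi} Z" unfolding Z_def by (intro continuous_intros)
    have vdec: "v t = cos t *\<^sub>R w' (Z t) 1 + sin t *\<^sub>R w' (Z t) \<i>" for t
      unfolding v_def using complex_linear_decompose[OF linw[OF Zb], of t "cis t"] by simp
    have wcont: "continuous_on (ball c \<delta>) w"
      using deriv by (meson continuous_at_imp_continuous_on has_derivative_continuous)
    have "continuous_on {0..2*pi} (\<lambda>t. inner (g (w (Z t))) (v t))"
      unfolding vdec
      by (intro continuous_intros continuous_on_compose2[OF gcont] continuous_on_compose2[OF wcont] continuous_on_compose2[OF cont] Zcont)
         (use Zb in auto)
    then have gvint: "((\<lambda>t. inner (g (w (Z t))) (v t)) has_integral integral {0..2*pi} (\<lambda>t. inner (g (w (Z t))) (v t))) {0..2*pi}"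
      by (intro integrable_integral integrable_continuous_real)
    define a where "a = (\<lambda>t. cos t *\<^sub>R w' c 1 + sin t *\<^sub>R w' c \<i>)"
    have a: "w' c (cis t) = a t" for t
      unfolding a_def using complex_linear_decompose[OF linw[OF cin], of "cis t"] by simp
    \<comment> \<open>The term added on the right has integral 0.\<close>
    have pw: "r * (inner (g' (a t)) (a t) - (\<kappa> * norm (g (w c)) * M\<^sup>2 + e * Q)) \<le> inner (g (w (Z t))) (v t) + inner (g (w c)) (JJ c (x t))" for t
    proof -
      define p where "p = (g (w (Z t)) - g (w c) - r *\<^sub>R g' (a t)) /\<^sub>R r"
      define q where "q = v t - a t"
      have w'r: "w' c (Z t - c) = r *\<^sub>R a t"
        using linear_scale[OF linw[OF cin], of r "cis t"] by (simp add: Z_def scaleR_conv_of_real a)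
      have "norm (g (w (Z t)) - g (w c) - r *\<^sub>R g' (a t)) \<le> e * r"
        using d1(2)[of "Z t"] Zd(1)[of t] r w'r linear_scale[OF bounded_linear.linear[OF bl]] by (simp add: r0_def)
      moreover have "norm p = norm (g (w (Z t)) - g (w c) - r *\<^sub>R g' (a t)) / r"
        unfolding p_def norm_scaleR using r by (simp add: divide_inverse mult.commute)
      ultimately have p: "norm p \<le> e" using r by (simp only: pos_divide_le_eq)
      have q: "norm q \<le> e" unfolding q_def v_def using near[of "cis t" t] a by simp
      have gp: "g (w (Z t)) - g (w c) = r *\<^sub>R (g' (a t) + p)" using r by (simp add: p_def scaleR_right_diff_distrib)
      have na: "norm (a t) \<le> M" using Mb a by metis
      have nx: "norm (x t) \<le> M + e"
      proof -
        have "norm (x t) \<le> norm (w' c (\<i> * cis t)) + norm (w' (Z t) (\<i> * cis t) - w' c (\<i> * cis t))"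
          unfolding x_def by (metis add.commute norm_triangle_sub)
        then show ?thesis using Mi[of t] near[of "\<i> * cis t" t] by (simp add: norm_mult)
      qed
      have nw: "norm (w (Z t) - w c) \<le> r * (M + e)"
      proof -
        have "norm (w (Z t) - w c) \<le> norm (w' c (Z t - c)) + norm (w (Z t) - w c - w' c (Z t - c))"
          by (metis add.commute norm_triangle_sub)
        also have "\<dots> \<le> r * M + e * r"
          using d2(2)[of "Z t"] Zd(1)[of t] r w'r na by (intro add_mono) (auto simp: r0_def)
        finally show ?thesis by (simp add: algebra_simps)
      qed
      have eq: "inner (g (w (Z t))) (v t) + inner (g (w c)) (JJ c (x t)) = 
          inner (g (w (Z t)) - g (w c)) (v t) - inner (g (w c)) (JJ (Z t) (x t) - JJ c (x t))"
        using vJ[of t] by (simp add: inner_diff_left inner_diff_right)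
      have "inner (g (w c)) (JJ (Z t) (x t) - JJ c (x t)) \<le> norm (g (w c)) * norm (JJ (Z t) (x t) - JJ c (x t))"
        by (rule norm_cauchy_schwarz)
      also have "\<dots> \<le> norm (g (w c)) * (\<kappa> * norm (w (Z t) - w c) * norm (x t))"
        by (intro mult_left_mono lip Zb) auto
      also have "\<dots> \<le> norm (g (w c)) * (\<kappa> * (r * (M + e)) * (M + e))"
        using nw nx \<kappa> M0 e r by (intro mult_left_mono mult_mono) auto
      also have "\<dots> = r * (\<kappa> * norm (g (w c)) * (M\<^sup>2 + e * (2 * M + e)))"
        by (simp add: power2_eq_square algebra_simps)
      also have "\<dots> \<le> r * (\<kappa> * norm (g (w c)) * (M\<^sup>2 + e * (2 * M + 1)))"
        using e \<kappa> r M0 by (intro mult_left_mono add_left_mono) auto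
      finally have t2: "inner (g (w c)) (JJ (Z t) (x t) - JJ c (x t)) \<le> r * (\<kappa> * norm (g (w c)) * (M\<^sup>2 + e * (2 * M + 1)))" .
      have "inner (g' (a t) + p) (v t) = inner (g' (a t)) (a t) + inner (g' (a t)) q + inner p (a t) + inner p q"
        by (simp add: q_def inner_diff_right inner_add_left)
      moreover have "inner (g' (a t)) q \<ge> - (G * M * e)"
      proof -
        have "\<bar>inner (g' (a t)) q\<bar> \<le> norm (g' (a t)) * norm q" by (rule Cauchy_Schwarz_ineq2)
        also have "\<dots> \<le> (G * M) * e"
          using q G0 M0 na order_trans[OF Gb mult_left_mono[OF na G0]] by (intro mult_mono) auto
        finally show ?thesis by linarith
      qed
      moreover have "inner p (a t) \<ge> - (e * M)"
      proof -
        have "\<bar>inner p (a t)\<bar> \<le> norm p * norm (a t)" by (rule Cauchy_Schwarz_ineq2)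
        also have "\<dots> \<le> e * M" using p na e by (intro mult_mono) auto
        finally show ?thesis by linarith
      qed
      moreover have "inner p q \<ge> - (e * 1)"
      proof -
        have "\<bar>inner p q\<bar> \<le> norm p * norm q" by (rule Cauchy_Schwarz_ineq2)
        also have "\<dots> \<le> e * 1" using p q e by (intro mult_mono) auto
        finally show ?thesis by linarith
      qed
      ultimately have "inner (g' (a t) + p) (v t) \<ge> inner (g' (a t)) (a t) - e * (M + G * M + 1)"
        by (simp add: algebra_simps)
      then have "r * inner (g' (a t) + p) (v t) \<ge> r * (inner (g' (a t)) (a t) - e * (M + G * M + 1))"
        using r by (intro mult_left_mono) auto
      then have t1: "inner (g (w (Z t)) - g (w c)) (v t) \<ge> r * (inner (g' (a t)) (a t) - e * (M + G * M + 1))"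
        unfolding gp by simp
      have "r * (inner (g' (a t)) (a t) - (\<kappa> * norm (g (w c)) * M\<^sup>2 + e * Q)) = 
         r * (inner (g' (a t)) (a t) - e * (M + G * M + 1)) - r * (\<kappa> * norm (g (w c)) * (M\<^sup>2 + e * (2 * M + 1)))"
        by (simp add: Q_def algebra_simps)
      then show ?thesis using t1 t2 eq by linarith
    qed
    have ling: "linear g'" using bl by (rule bounded_linear.linear)
    have "((\<lambda>t. r * (inner (g' (a t)) (a t) - (\<kappa> * norm (g (w c)) * M\<^sup>2 + e * Q))) has_integral
        r * (pi * (inner (g' (w' c 1)) (w' c 1) + inner (g' (w' c \<i>)) (w' c \<i>)) - (2*pi-0) *\<^sub>R (\<kappa> * norm (g (w c)) * M\<^sup>2 + e * Q))) {0..2*pi}"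
      unfolding a_def
      by (intro has_integral_mult_right has_integral_diff integral_quadratic_cis[OF ling] has_integral_const_real[THEN has_integral_eq_rhs]) auto
    from has_integral_le[OF this has_integral_add[OF gvint xJ] pw]
    have "r * (pi * (inner (g' (w' c 1)) (w' c 1) + inner (g' (w' c \<i>)) (w' c \<i>)) - (2*pi-0) *\<^sub>R (\<kappa> * norm (g (w c)) * M\<^sup>2 + e * Q))
       \<le> integral {0..2*pi} (\<lambda>t. inner (g (w (Z t))) (v t))" by simp
    moreover have "r * (pi * (inner (g' (w' c 1)) (w' c 1) + inner (g' (w' c \<i>)) (w' c \<i>))
          - 18 * pi * \<kappa> * norm (g (w c)) * (norm (w' c 1))\<^sup>2 - b) \<le> 
       r * (pi * (inner (g' (w' c 1)) (w' c 1) + inner (g' (w' c \<i>)) (w' c \<i>)) - (2*pi-0) *\<^sub>R (\<kappa> * norm (g (w c)) * M\<^sup>2 + e * Q))"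
      using r eQ by (intro mult_left_mono) (auto simp: M_def power2_eq_square algebra_simps)
    ultimately show ?thesis unfolding Z_def v_def by linarith
  qed
  show ?thesis unfolding eventually_at_right_field using r0 main by blast
qed

section \<open>Plurisubharmonicity of Chirka's function\<close>

text \<open>The gradient of \<open>ln (norm y) + A * norm y\<close>.\<close>

definition log_grad :: "real \<Rightarrow> 'f::real_inner \<Rightarrow> 'f" where
  "log_grad A y = (1 / (norm y)\<^sup>2 + A / norm y) *\<^sub>R y"

lemma norm_log_grad:
  assumes "y \<noteq> 0" "0 \<le> A"
  shows "norm (log_grad A y) = 1 / norm y + A"
proof -
  have "norm (log_grad A y) = (1 / (norm y)\<^sup>2 + A / norm y) * norm y"
    using assms(2) by (simp add: log_grad_def abs_of_nonneg)
  also have "\<dots> = 1 / norm y + A"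
    using assms(1) by (simp add: distrib_right power2_eq_square)
  finally show ?thesis .
qed

lemma has_derivative_norm_inner:
  fixes y :: "'f::real_inner"
  assumes "y \<noteq> 0"
  shows "(norm has_derivative (\<lambda>h. inner y h / norm y)) (at y)"
proof -
  have "(\<lambda>h. inner h (sgn y)) = (\<lambda>h. inner y h / norm y)"
    by (simp add: fun_eq_iff sgn_div_norm inner_commute field_simps)
  then show ?thesis using GDERIV_norm[OF assms] by (simp add: gderiv_def)
qed

lemma log_norm_has_derivative:
  fixes y :: "'f::real_inner"
  assumes "y \<noteq> 0"
  shows "((\<lambda>y. ln (norm y) + A * norm y) has_derivative (\<lambda>h. inner (log_grad A y) h)) (at y)"
proof -
  have "((\<lambda>s. ln s + A * s) has_real_derivative (1 / norm y + A)) (at (norm y))"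
    using assms by (auto intro!: derivative_eq_intros)
  from DERIV_compose_FDERIV[OF this has_derivative_norm_inner[OF assms]]
  have "((\<lambda>y. ln (norm y) + A * norm y) has_derivative (\<lambda>h. inner y h / norm y * (1 / norm y + A))) (at y)" .
  moreover have "inner y h / norm y * (1 / norm y + A) = inner (log_grad A y) h" for h
    using assms by (simp add: log_grad_def distrib_left distrib_right power2_eq_square)
  ultimately show ?thesis by simp
qed

lemma log_grad_has_derivative:
  fixes y :: "'f::real_inner"
  assumes "y \<noteq> 0"
  shows "(log_grad A has_derivative (\<lambda>h. (1 / (norm y)\<^sup>2 + A / norm y) *\<^sub>R h
            - ((2 / (norm y)^4 + A / (norm y)^3) * inner y h) *\<^sub>R y)) (at y)"
proof -
  have "((\<lambda>s. 1 / s\<^sup>2 + A / s) has_real_derivative (- (2 / (norm y)^3 + A / (norm y)^2))) (at (norm y))"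
    using assms by (auto intro!: derivative_eq_intros simp: power2_eq_square power3_eq_cube power4_eq_xxxx field_simps)
  from DERIV_compose_FDERIV[OF this has_derivative_norm_inner[OF assms]]
  have "((\<lambda>y. (1 / (norm y)\<^sup>2 + A / norm y)) has_derivative
       (\<lambda>h. inner y h / norm y * (- (2 / (norm y)^3 + A / (norm y)^2)))) (at y)" .
  moreover have "inner y h / norm y * (- (2 / (norm y)^3 + A / (norm y)^2)) = - ((2 / (norm y)^4 + A / (norm y)^3) * inner y h)" for h
    using assms by (simp add: field_simps power2_eq_square power3_eq_cube power4_eq_xxxx)
  ultimately have "((\<lambda>y. (1 / (norm y)\<^sup>2 + A / norm y)) has_derivative
       (\<lambda>h. - ((2 / (norm y)^4 + A / (norm y)^3) * inner y h))) (at y)" by simp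
  from has_derivative_scaleR[OF this has_derivative_ident]
  show ?thesis unfolding log_grad_def[abs_def] by (simp add: algebra_simps)
qed

lemma continuous_on_log_grad:
  assumes "0 \<notin> T"
  shows "continuous_on T (log_grad A)"
proof (rule continuous_at_imp_continuous_on, rule ballI)
  fix y assume "y \<in> T"
  then have "y \<noteq> 0" using assms by blast
  then show "isCont (log_grad A) y" by (rule has_derivative_continuous[OF log_grad_has_derivative])
qed

lemma bessel_two:
  fixes y e1 e2 :: "'f::real_inner"
  assumes orth: "inner e1 e2 = 0" and eq: "norm e1 = norm e2"
  shows "(inner y e1)\<^sup>2 + (inner y e2)\<^sup>2 \<le> (norm y)\<^sup>2 * (norm e1)\<^sup>2"
proof (cases "e1 = 0")
  case True
  then show ?thesis using eq by simp
next
  case False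
  define N where "N = (norm e1)\<^sup>2"
  have N: "N > 0" "inner e1 e1 = N" "inner e2 e2 = N" using False eq by (auto simp: N_def dot_square_norm)
  define a b where "a = inner y e1" and "b = inner y e2"
  have "0 \<le> inner (N *\<^sub>R y - a *\<^sub>R e1 - b *\<^sub>R e2) (N *\<^sub>R y - a *\<^sub>R e1 - b *\<^sub>R e2)" by (rule inner_ge_zero)
  also have "\<dots> = N * (N * inner y y - (a\<^sup>2 + b\<^sup>2))"
    using orth N(2,3) by (simp add: inner_diff_left inner_diff_right inner_commute[of e1 y] inner_commute[of e2 y]
        inner_commute[of e2 e1] a_def[symmetric] b_def[symmetric] algebra_simps power2_eq_square)
  finally have "a\<^sup>2 + b\<^sup>2 \<le> N * inner y y" using N by (simp add: zero_le_mult_iff)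
  then show ?thesis by (simp add: a_def b_def N_def dot_square_norm mult.commute)
qed

text \<open>The Levi form of Chirka's function \<open>ln (norm y) + A * norm y\<close>. If \<open>e2\<close> is the product of \<open>e1\<close>
  with the imaginary unit of a Hermitian structure, the logarithm contributes a nonnegative amount
  by Bessel's inequality, and \<open>A * norm y\<close> contributes at least \<open>A (norm e1)\<^sup>2 / norm y\<close>. Replacing
  \<open>e2\<close> by \<open>\<eta>\<close>, as for a structure that differs by \<open>O(norm y)\<close>, costs \<open>O((norm e1)\<^sup>2 / norm y)\<close>.
  With \<open>A = 52 * \<kappa>\<close> enough is left for the error term in the flux of the gradient when \<open>norm y\<close> is
  at most \<open>1 / (46 * \<kappa>)\<close>.\<close>

lemma log_grad_levi_form_bound:
  fixes y e1 e2 \<eta> :: "'f::real_inner"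
  defines "D \<equiv> (\<lambda>A h. (1 / (norm y)\<^sup>2 + A / norm y) *\<^sub>R h - ((2 / (norm y)^4 + A / (norm y)^3) * inner y h) *\<^sub>R y)"
  assumes y: "y \<noteq> 0" "norm y \<le> 1 / (46 * \<kappa>)" and \<kappa>: "\<kappa> > 0" and A: "A = 52 * \<kappa>"
    and orth: "inner e1 e2 = 0" and eq: "norm e1 = norm e2" and near: "norm (\<eta> - e2) \<le> \<kappa> * norm y * norm e1"
  shows "18 * \<kappa> * norm (log_grad A y) * (norm e1)\<^sup>2 \<le> inner (D A e1) e1 + inner (D A \<eta>) \<eta>"
proof -
  define q where "q = norm y"
  define n where "n = norm e1"
  have q: "q > 0" using y by (simp add: q_def)
  have n: "n \<ge> 0" by (simp add: n_def)
  have kq: "46 * (\<kappa> * q) \<le> 1" using y(2) \<kappa> by (simp add: q_def field_simps)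
  have kq0: "\<kappa> * q > 0" using \<kappa> q by simp
  have near': "norm (\<eta> - e2) \<le> \<kappa> * q * n" using near by (simp add: q_def n_def)
  have e2n: "norm e2 = n" using eq by (simp add: n_def)
  have \<eta>n: "norm \<eta> \<ge> n * (1 - \<kappa> * q)"
    using norm_triangle_ineq2[of e2 "e2 - \<eta>"] near' e2n by (simp add: norm_minus_commute algebra_simps)
  have \<eta>2: "(norm \<eta>)\<^sup>2 \<ge> n\<^sup>2 * (1 - 2 * (\<kappa> * q))"
  proof -
    have "n\<^sup>2 * (1 - 2 * (\<kappa> * q)) \<le> (n * (1 - \<kappa> * q))\<^sup>2"
      by (simp add: power_mult_distrib power2_diff mult_left_mono)
    also have "\<dots> \<le> (norm \<eta>)\<^sup>2" using \<eta>n kq n by (intro power_mono) auto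
    finally show ?thesis .
  qed
  define a b b' where "a = inner y e1" and "b = inner y e2" and "b' = inner y \<eta>"
  have ab: "a\<^sup>2 + b\<^sup>2 \<le> q\<^sup>2 * n\<^sup>2" using bessel_two[OF orth eq, of y] by (simp add: a_def b_def q_def n_def)
  have babs: "\<bar>b\<bar> \<le> q * n" using Cauchy_Schwarz_ineq2[of y e2] by (simp add: b_def q_def e2n)
  have bb: "\<bar>b' - b\<bar> \<le> q * (\<kappa> * q * n)"
  proof -
    have "\<bar>b' - b\<bar> = \<bar>inner y (\<eta> - e2)\<bar>" by (simp add: b'_def b_def inner_diff_right)
    also have "\<dots> \<le> q * norm (\<eta> - e2)" unfolding q_def by (rule Cauchy_Schwarz_ineq2)
    also have "\<dots> \<le> q * (\<kappa> * q * n)" using near' q by (intro mult_left_mono) auto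
    finally show ?thesis .
  qed
  have b'2: "b'\<^sup>2 \<le> b\<^sup>2 + q\<^sup>2 * n\<^sup>2 * (3 * (\<kappa> * q))"
  proof -
    have "b'\<^sup>2 = b\<^sup>2 + 2 * b * (b' - b) + (b' - b)\<^sup>2" by (simp add: power2_eq_square algebra_simps)
    moreover have "2 * b * (b' - b) \<le> 2 * ((q * n) * (q * (\<kappa> * q * n)))"
    proof -
      have "b * (b' - b) \<le> \<bar>b\<bar> * \<bar>b' - b\<bar>" by (metis abs_ge_self abs_mult)
      also have "\<dots> \<le> (q * n) * (q * (\<kappa> * q * n))" using babs bb q n by (intro mult_mono) auto
      finally show ?thesis by simp
    qed
    moreover have "(b' - b)\<^sup>2 \<le> (q * (\<kappa> * q * n))\<^sup>2" using bb by (metis abs_ge_zero power2_abs power_mono)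
    moreover have "(q * (\<kappa> * q * n))\<^sup>2 \<le> q\<^sup>2 * n\<^sup>2 * (\<kappa> * q)"
    proof -
      have "(q * (\<kappa> * q * n))\<^sup>2 = (q\<^sup>2 * n\<^sup>2 * (\<kappa> * q)) * (\<kappa> * q)" by (simp add: power2_eq_square algebra_simps)
      also have "\<dots> \<le> (q\<^sup>2 * n\<^sup>2 * (\<kappa> * q)) * 1" using kq kq0 by (intro mult_left_mono) auto
      finally show ?thesis by simp
    qed
    ultimately show ?thesis by (simp add: power2_eq_square algebra_simps)
  qed
  have A0: "A > 0" using A \<kappa> by simp
  define c d where "c = 1 / q\<^sup>2 + A / q" and "d = 2 / q^4 + A / q^3"
  have c0: "c \<ge> 0" "d \<ge> 0" using q A0 by (auto simp: c_def d_def)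
  have "inner (D A e1) e1 + inner (D A \<eta>) \<eta> = c * (n\<^sup>2 + (norm \<eta>)\<^sup>2) - d * (a\<^sup>2 + b'\<^sup>2)"
    by (simp add: D_def a_def b'_def c_def d_def q_def n_def inner_diff_left dot_square_norm power2_eq_square algebra_simps)
  moreover have "c * (n\<^sup>2 + (norm \<eta>)\<^sup>2) \<ge> c * (n\<^sup>2 + n\<^sup>2 * (1 - 2 * (\<kappa> * q)))"
    using c0 \<eta>2 by (intro mult_left_mono) auto
  moreover have "d * (a\<^sup>2 + b'\<^sup>2) \<le> d * (q\<^sup>2 * n\<^sup>2 * (1 + 3 * (\<kappa> * q)))"
    using c0 ab b'2 by (intro mult_left_mono) (auto simp: algebra_simps)
  moreover have "c * (n\<^sup>2 + n\<^sup>2 * (1 - 2 * (\<kappa> * q))) - d * (q\<^sup>2 * n\<^sup>2 * (1 + 3 * (\<kappa> * q))) 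
      = n\<^sup>2 * ((A - 8 * \<kappa>) / q - 5 * \<kappa> * A)"
    unfolding c_def d_def using q by (simp add: field_simps power2_eq_square power3_eq_cube power4_eq_xxxx)
  moreover have "18 * \<kappa> * (1 / q + A) \<le> (A - 8 * \<kappa>) / q - 5 * \<kappa> * A"
  proof -
    have "23 * \<kappa> * A * q \<le> 26 * \<kappa>"
    proof -
      have "23 * \<kappa> * A * q = 26 * \<kappa> * (46 * (\<kappa> * q))" by (simp add: A)
      also have "\<dots> \<le> 26 * \<kappa> * 1" using kq \<kappa> by (intro mult_left_mono) auto
      finally show ?thesis by simp
    qed
    then have "18 * \<kappa> * (1 + A * q) \<le> (A - 8 * \<kappa>) - 5 * \<kappa> * A * q"
      by (simp add: A algebra_simps)
    then have "18 * \<kappa> * (1 + A * q) / q \<le> ((A - 8 * \<kappa>) - 5 * \<kappa> * A * q) / q" using q by (intro divide_right_mono) auto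
    then show ?thesis using q by (simp add: add_divide_distrib diff_divide_distrib algebra_simps)
  qed
  then have "18 * \<kappa> * (1 / q + A) * n\<^sup>2 \<le> n\<^sup>2 * ((A - 8 * \<kappa>) / q - 5 * \<kappa> * A)"
    by (subst mult.commute) (intro mult_left_mono, auto)
  moreover have "18 * \<kappa> * norm (log_grad A y) * n\<^sup>2 = 18 * \<kappa> * (1 / q + A) * n\<^sup>2"
    using norm_log_grad[OF y(1)] A0 by (simp add: q_def)
  ultimately show ?thesis unfolding n_def[symmetric] by linarith
qed

text \<open>A field of complex structures on \<open>S\<close>, with one constant \<open>K\<close> for all bounds.\<close>

locale lipschitz_structure =
  fixes S :: "'e::euclidean_space set" and J :: "'e \<Rightarrow> 'e \<Rightarrow> 'e" and K :: real
  assumes J_linear: "x \<in> S \<Longrightarrow> linear (J x)"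
    and J_square: "x \<in> S \<Longrightarrow> J x (J x h) = - h"
    and J_bound: "x \<in> S \<Longrightarrow> norm (J x h) \<le> K * norm h"
    and J_lipschitz: "x \<in> S \<Longrightarrow> y \<in> S \<Longrightarrow> norm (J x h - J y h) \<le> K * norm (x - y) * norm h"
    and K1: "K \<ge> 1"
begin

text \<open>The Lipschitz constant of the structure in the norms of \<open>hermitian p x\<close>.\<close>

definition \<kappa> where "\<kappa> = K * (1 + K)"

lemma \<kappa>_pos: "\<kappa> > 0" using K1 by (simp add: \<kappa>_def)

text \<open>The norm of \<open>hermitian p x\<close> is the norm of \<open>x\<close> for the Hermitian metric
  \<open>\<langle>x, y\<rangle> + \<langle>J p x, J p y\<rangle>\<close>, for which \<open>J p\<close> is orthogonal. The pairing makes it the norm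
  induced by a product of Euclidean spaces, the same for all \<open>p\<close>.\<close>

definition hermitian :: "'e \<Rightarrow> 'e \<Rightarrow> 'e \<times> 'e" where
  "hermitian p x = (x, J p x)"

lemma norm_hermitian_le: "p \<in> S \<Longrightarrow> norm (hermitian p x) \<le> (1 + K) * norm x"
  using norm_Pair_le[of x "J p x"] J_bound[of p x] by (simp add: hermitian_def distrib_right)

lemma norm_hermitian_ge: "norm x \<le> norm (hermitian p x)"
  using norm_fst_le[of "x" "J p x"] by (simp add: hermitian_def)

lemma bounded_linear_hermitian: "p \<in> S \<Longrightarrow> bounded_linear (hermitian p)"
  unfolding hermitian_def[abs_def] using J_linear linear_conv_bounded_linear
  by (intro bounded_linear_Pair bounded_linear_ident) auto

lemma holomorphic_derivative_times_i:
  assumes "linear L" "x \<in> S" "L \<i> = J x (L 1)"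
  shows "L (\<i> * h) = J x (L h)"
proof -
  note lx = J_linear[OF assms(2)]
  have "L (\<i> * h) = - Im h *\<^sub>R L 1 + Re h *\<^sub>R L \<i>"
    using complex_linear_decompose[OF assms(1), of "\<i> * h"] by simp
  also have "\<dots> = J x (Re h *\<^sub>R L 1 + Im h *\<^sub>R L \<i>)"
    using assms(3) J_square[OF assms(2)] by (simp add: linear_add[OF lx] linear_scale[OF lx])
  also have "Re h *\<^sub>R L 1 + Im h *\<^sub>R L \<i> = L h"
    using complex_linear_decompose[OF assms(1), of h] by simp
  finally show ?thesis .
qed

text \<open>Chirka's function of \<open>u - p\<close> is subharmonic to first order: the Levi form bound absorbs the
  error term in the lower bound of the flux.\<close>

lemma log_distance_flux:
  fixes u :: "complex \<Rightarrow> 'e"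
  assumes p: "p \<in> S" and \<delta>: "\<delta> > 0"
    and deriv: "\<And>z. z \<in> ball c \<delta> \<Longrightarrow> (u has_derivative u' z) (at z)"
    and cont: "\<And>h. continuous_on (ball c \<delta>) (\<lambda>z. u' z h)"
    and uS: "\<And>z. z \<in> ball c \<delta> \<Longrightarrow> u z \<in> S"
    and hol: "\<And>z. z \<in> ball c \<delta> \<Longrightarrow> u' z \<i> = J (u z) (u' z 1)"
    and nz: "\<And>z. z \<in> ball c \<delta> \<Longrightarrow> u z \<noteq> p"
    and small: "norm (hermitian p (u c - p)) \<le> 1 / (46 * \<kappa>)" and b: "b > 0"
  shows "\<forall>\<^sub>F r in at_right 0. - (b * r) \<le> integral {0..2*pi} (\<lambda>t.
      inner (log_grad (52 * \<kappa>) (hermitian p (u (c + of_real r * cis t) - p))) (hermitian p (u' (c + of_real r * cis t) (cis t))))"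
proof -
  define A where "A = 52 * \<kappa>"
  define w where "w = (\<lambda>z. hermitian p (u z - p))"
  define w' where "w' = (\<lambda>z h. hermitian p (u' z h))"
  define JJ where "JJ = (\<lambda>z (y::'e\<times>'e). hermitian p (J (u z) (fst y)))"
  note blT = bounded_linear_hermitian[OF p]
  note linT = bounded_linear.linear[OF blT]
  have cin: "c \<in> ball c \<delta>" using \<delta> by simp
  have dw: "(w has_derivative w' z) (at z)" if "z \<in> ball c \<delta>" for z
    unfolding w_def w'_def
    by (rule bounded_linear.has_derivative[OF blT]) (use deriv[OF that] in \<open>auto intro!: derivative_eq_intros\<close>)
  have w0: "w z \<noteq> 0" if "z \<in> ball c \<delta>" for z
    using norm_hermitian_ge[of "u z - p" p] nz[OF that] by (auto simp: w_def)
  define e1 e2 where "e1 = w' c 1" and "e2 = hermitian p (J p (u' c 1))"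
  have orth: "inner e1 e2 = 0" "norm e1 = norm e2"
    using J_square[OF p] by (simp_all add: e1_def e2_def w'_def hermitian_def norm_Pair inner_commute add.commute)
  have \<kappa>q: "\<kappa> * norm (w c) \<le> 1"
  proof -
    have "\<kappa> * norm (w c) \<le> \<kappa> * (1 / (46 * \<kappa>))" using small \<kappa>_pos unfolding w_def by (intro mult_left_mono) auto
    then show ?thesis using \<kappa>_pos by simp
  qed
  have near: "norm (w' c \<i> - e2) \<le> \<kappa> * norm (w c) * norm e1"
  proof -
    have "w' c \<i> - e2 = hermitian p (J (u c) (u' c 1) - J p (u' c 1))"
      using hol[OF cin] by (simp add: w'_def e2_def linear_diff[OF linT])
    also have "norm \<dots> \<le> (1 + K) * norm (J (u c) (u' c 1) - J p (u' c 1))" by (rule norm_hermitian_le[OF p])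
    also have "\<dots> \<le> (1 + K) * (K * norm (u c - p) * norm (u' c 1))"
      using K1 by (intro mult_left_mono J_lipschitz uS cin p) auto
    also have "\<dots> \<le> (1 + K) * (K * norm (w c) * norm e1)"
      using K1 norm_hermitian_ge[of "u c - p" p] norm_hermitian_ge[of "u' c 1" p] unfolding w_def e1_def w'_def
      by (intro mult_left_mono mult_mono) auto
    finally show ?thesis by (simp add: \<kappa>_def algebra_simps)
  qed
  have size: "norm (w' c \<i>) \<le> 2 * norm (w' c 1)"
  proof -
    have "norm (w' c \<i>) \<le> norm e2 + norm (w' c \<i> - e2)" by (metis add.commute norm_triangle_sub)
    also have "\<dots> \<le> norm e1 + 1 * norm e1" using near mult_right_mono[OF \<kappa>q norm_ge_zero[of e1]] orth by simp
    finally show ?thesis by (simp add: e1_def)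
  qed
  define g' where "g' = (\<lambda>h. (1 / (norm (w c))\<^sup>2 + A / norm (w c)) *\<^sub>R h - ((2 / (norm (w c))^4 + A / (norm (w c))^3) * inner (w c) h) *\<^sub>R w c)"
  have levi: "18 * \<kappa> * norm (log_grad A (w c)) * (norm e1)\<^sup>2 \<le> inner (g' e1) e1 + inner (g' (w' c \<i>)) (w' c \<i>)"
    unfolding g'_def
    by (rule log_grad_levi_form_bound[OF w0[OF cin] _ \<kappa>_pos _ orth near]) (use small in \<open>auto simp: A_def w_def\<close>)
  have "\<forall>\<^sub>F r in at_right 0. 
     r * (pi * (inner (g' (w' c 1)) (w' c 1) + inner (g' (w' c \<i>)) (w' c \<i>))
          - 18 * pi * \<kappa> * norm (log_grad A (w c)) * (norm (w' c 1))\<^sup>2 - b)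
     \<le> integral {0..2*pi} (\<lambda>t. inner (log_grad A (w (c + of_real r * cis t))) (w' (c + of_real r * cis t) (cis t)))"
  proof (rule flux_lower_bound[OF \<delta> dw, where JJ = JJ])
    show "continuous_on (ball c \<delta>) (\<lambda>z. w' z h)" for h
      unfolding w'_def by (rule bounded_linear.continuous_on[OF blT cont])
    show "w' z (\<i> * h) = JJ z (w' z h)" if "z \<in> ball c \<delta>" for z h
      using holomorphic_derivative_times_i[OF has_derivative_linear[OF deriv[OF that]] uS[OF that] hol[OF that]]
      by (simp add: w'_def JJ_def hermitian_def)
    show "linear (JJ c)"
      unfolding JJ_def
      using linear_compose[OF linear_compose[OF linear_fst J_linear[OF uS[OF cin]]] linT] by (simp add: o_def)
    show "norm (JJ z y - JJ c y) \<le> \<kappa> * norm (w z - w c) * norm y" if z: "z \<in> ball c \<delta>" for z y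
    proof -
      have "JJ z y - JJ c y = hermitian p (J (u z) (fst y) - J (u c) (fst y))"
        by (simp add: JJ_def linear_diff[OF linT])
      also have "norm \<dots> \<le> (1 + K) * norm (J (u z) (fst y) - J (u c) (fst y))" by (rule norm_hermitian_le[OF p])
      also have "\<dots> \<le> (1 + K) * (K * norm (u z - u c) * norm (fst y))"
        using K1 by (intro mult_left_mono J_lipschitz uS cin z) auto
      also have "\<dots> \<le> (1 + K) * (K * norm (w z - w c) * norm y)"
      proof -
        have "norm (u z - u c) \<le> norm (w z - w c)"
          using norm_hermitian_ge[of "u z - u c" p] by (simp add: w_def linear_diff[OF linT, symmetric])
        moreover have "norm (fst y) \<le> norm y" by (metis norm_fst_le prod.collapse)
        ultimately show ?thesis using K1 by (intro mult_left_mono mult_mono) auto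
      qed
      finally show ?thesis by (simp add: \<kappa>_def algebra_simps)
    qed
    show "(log_grad A has_derivative g') (at (w c))"
      unfolding g'_def by (rule log_grad_has_derivative[OF w0[OF cin]])
    show "continuous_on (w ` ball c \<delta>) (log_grad A)"
      by (rule continuous_on_log_grad) (use w0 in force)
  qed (use size b \<kappa>_pos in auto)
  moreover have "\<forall>\<^sub>F r in at_right (0::real). r > 0" by (simp add: eventually_at_right_less)
  ultimately show ?thesis
  proof eventually_elim
    case (elim r)
    have "pi * (18 * \<kappa> * norm (log_grad A (w c)) * (norm e1)\<^sup>2) \<le> pi * (inner (g' e1) e1 + inner (g' (w' c \<i>)) (w' c \<i>))"
      using levi by (intro mult_left_mono) auto
    then have "r * (- b) \<le> r * (pi * (inner (g' (w' c 1)) (w' c 1) + inner (g' (w' c \<i>)) (w' c \<i>))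
          - 18 * pi * \<kappa> * norm (log_grad A (w c)) * (norm (w' c 1))\<^sup>2 - b)"
      using elim(2) unfolding e1_def by (intro mult_left_mono) (auto simp: algebra_simps)
    then show ?case using elim(1) unfolding w_def w'_def A_def by (simp add: mult.commute)
  qed
qed

end

text \<open>This is the same flux computation for the identity map and the constant structure \<open>\<i>\<close>:
  \<open>ln (norm (z - z0))\<close> is harmonic off \<open>z0\<close> and \<open>\<eta> (norm (z - z0))\<^sup>2\<close> has Laplacian \<open>4 \<eta>\<close>.\<close>

lemma log_modulus_flux:
  fixes c z0 :: complex
  assumes c: "c \<noteq> z0" and b: "b > 0"
  shows "\<forall>\<^sub>F r in at_right 0. r * (4 * pi * \<eta> - b) \<le> integral {0..2*pi} (\<lambda>t.
      inner ((2 * \<eta>) *\<^sub>R (c + of_real r * cis t - z0) - a *\<^sub>R log_grad 0 (c + of_real r * cis t - z0)) (cis t))"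
proof -
  define \<delta> where "\<delta> = dist c z0"
  have \<delta>: "\<delta> > 0" using c by (simp add: \<delta>_def)
  define q where "q = norm (c - z0)"
  have q: "q > 0" using c by (simp add: q_def)
  define g where "g = (\<lambda>z. (2 * \<eta>) *\<^sub>R (z - z0) - a *\<^sub>R log_grad 0 (z - z0))"
  define g' where "g' = (\<lambda>h. (2 * \<eta>) *\<^sub>R h - a *\<^sub>R ((1 / q\<^sup>2) *\<^sub>R h - ((2 / q^4) * inner (c - z0) h) *\<^sub>R (c - z0)))"
  have dg: "(g has_derivative g') (at c)"
  proof -
    have "((\<lambda>z. z - z0) has_derivative (\<lambda>h. h)) (at c)" by (auto intro!: derivative_eq_intros)
    from diff_chain_at[OF this log_grad_has_derivative[of "c - z0" 0]] c
    have 1: "((\<lambda>z. log_grad 0 (z - z0)) has_derivative (\<lambda>h. (1 / q\<^sup>2) *\<^sub>R h - ((2 / q^4) * inner (c - z0) h) *\<^sub>R (c - z0))) (at c)"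
      by (simp add: o_def q_def)
    show ?thesis unfolding g_def g'_def by (rule derivative_eq_intros 1 refl)+ simp
  qed
  have tr: "inner (g' 1) 1 + inner (g' \<i>) \<i> = 4 * \<eta>"
  proof -
    define y k l where "y = c - z0" and "k = 1 / q\<^sup>2" and "l = 2 / q^4"
    have "inner (g' 1) 1 = 2 * \<eta> - a * (k - l * (Re y)\<^sup>2)" "inner (g' \<i>) \<i> = 2 * \<eta> - a * (k - l * (Im y)\<^sup>2)"
      unfolding g'_def y_def[symmetric] k_def[symmetric] l_def[symmetric]
      by (simp_all add: inner_complex_def power2_eq_square)
    then have "inner (g' 1) 1 + inner (g' \<i>) \<i> = 4 * \<eta> - a * (2 * k - l * ((Re y)\<^sup>2 + (Im y)\<^sup>2))"
      by (simp add: algebra_simps)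
    also have "(Re y)\<^sup>2 + (Im y)\<^sup>2 = q\<^sup>2" by (simp add: q_def y_def cmod_power2)
    also have "4 * \<eta> - a * (2 * k - l * q\<^sup>2) = 4 * \<eta> - a * (2 / q\<^sup>2 - 2 / q^4 * q\<^sup>2)"
      by (simp add: k_def l_def)
    also have "2 / q\<^sup>2 - 2 / q^4 * q\<^sup>2 = 0" using q by (simp add: field_simps power2_eq_square power4_eq_xxxx)
    finally show ?thesis by simp
  qed
  have "\<forall>\<^sub>F r in at_right 0. 
     r * (pi * (inner (g' 1) 1 + inner (g' \<i>) \<i>) - 18 * pi * 0 * norm (g c) * (norm (1::complex))\<^sup>2 - b)
     \<le> integral {0..2*pi} (\<lambda>t. inner (g (c + of_real r * cis t)) (cis t))"
  proof (rule flux_lower_bound[where w = "\<lambda>z. z" and w' = "\<lambda>z h. h" and JJ = "\<lambda>z h. \<i> * h" and \<delta> = \<delta>, OF \<delta>])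
    show "linear (\<lambda>h. \<i> * h)" by (intro linearI) (auto simp: algebra_simps)
    show "continuous_on ((\<lambda>z. z) ` ball c \<delta>) g"
      unfolding g_def
      by (intro continuous_intros continuous_on_compose2[OF continuous_on_log_grad[of "- {0}"]]) (auto simp: \<delta>_def)
  qed (use dg b in \<open>auto intro!: continuous_intros\<close>)
  then show ?thesis unfolding tr g_def by (simp add: mult.commute mult.left_commute)
qed

context lipschitz_structure
begin

text \<open>The quadratic term makes the inequality strict.\<close>

lemma log_quotient_strict_submean:
  fixes u :: "complex \<Rightarrow> 'e" and a :: real
  assumes p: "p \<in> S" and G: "open G" "c \<in> G"
    and deriv: "\<And>z. z \<in> G \<Longrightarrow> (u has_derivative u' z) (at z)"
    and cont: "\<And>h. continuous_on G (\<lambda>z. u' z h)"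
    and uS: "\<And>z. z \<in> G \<Longrightarrow> u z \<in> S"
    and hol: "\<And>z. z \<in> G \<Longrightarrow> u' z \<i> = J (u z) (u' z 1)"
    and nz: "u c \<noteq> p" "c \<noteq> z0"
    and small: "norm (hermitian p (u c - p)) \<le> 1 / (46 * \<kappa>)" and \<eta>: "\<eta> > 0"
  defines "f \<equiv> (\<lambda>z. ln (norm (hermitian p (u z - p))) + 52 * \<kappa> * norm (hermitian p (u z - p)) 
       + (\<eta> * (norm (z - z0))\<^sup>2 - a * ln (norm (z - z0))))"
  shows "\<forall>\<^sub>F r in at_right 0. 2*pi * f c < integral {0..2*pi} (\<lambda>t. f (c + of_real r * cis t))"
proof -
  note blT = bounded_linear_hermitian[OF p]
  have cu: "continuous_on G u" using deriv by (meson continuous_at_imp_continuous_on has_derivative_continuous)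
  have "open (G \<inter> u -` (- {p}))" by (rule continuous_open_preimage[OF cu G(1)]) auto
  then have "open ((G \<inter> u -` (- {p})) \<inter> - {z0})" by auto
  moreover have "c \<in> (G \<inter> u -` (- {p})) \<inter> - {z0}" using G nz by auto
  ultimately obtain \<delta> where \<delta>: "\<delta> > 0" "ball c \<delta> \<subseteq> (G \<inter> u -` (- {p})) \<inter> - {z0}" using openE by blast
  define f' where "f' = (\<lambda>z h. inner (log_grad (52*\<kappa>) (hermitian p (u z - p))) (hermitian p (u' z h)) +
     inner ((2 * \<eta>) *\<^sub>R (z - z0) - a *\<^sub>R log_grad 0 (z - z0)) h)"
  have bG: "z \<in> G" "u z \<noteq> p" "z \<noteq> z0" "hermitian p (u z - p) \<noteq> 0" if "z \<in> ball c \<delta>" for z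
    using \<delta>(2) that norm_hermitian_ge[of "u z - p" p] by auto
  have df: "(f has_derivative f' z) (at z)" if z: "z \<in> ball c \<delta>" for z
  proof -
    have 1: "((\<lambda>z. hermitian p (u z - p)) has_derivative (\<lambda>h. hermitian p (u' z h))) (at z)"
      by (rule bounded_linear.has_derivative[OF blT]) (use deriv[OF bG(1)[OF z]] in \<open>auto intro!: derivative_eq_intros\<close>)
    have 2: "((\<lambda>z. ln (norm (hermitian p (u z - p))) + 52 * \<kappa> * norm (hermitian p (u z - p))) has_derivative
       (\<lambda>h. inner (log_grad (52*\<kappa>) (hermitian p (u z - p))) (hermitian p (u' z h)))) (at z)"
      using diff_chain_at[OF 1 log_norm_has_derivative[OF bG(4)[OF z], of "52*\<kappa>"]] by (simp add: o_def)
    have 3: "((\<lambda>z. z - z0) has_derivative (\<lambda>h. h)) (at z)" by (auto intro!: derivative_eq_intros)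
    have 4: "((\<lambda>z. ln (norm (z - z0))) has_derivative (\<lambda>h. inner (log_grad 0 (z - z0)) h)) (at z)"
      using diff_chain_at[OF 3 log_norm_has_derivative[of "z - z0" 0]] bG(3)[OF z] by (simp add: o_def)
    have 5: "((\<lambda>z. (norm (z - z0))\<^sup>2) has_derivative (\<lambda>h. 2 * inner (z - z0) h)) (at z)"
      unfolding power2_norm_eq_inner by (auto intro!: derivative_eq_intros simp: inner_commute)
    show ?thesis unfolding f_def f'_def
      by (rule has_derivative_eq_rhs[OF has_derivative_add[OF 2 has_derivative_diff[OF
              has_derivative_mult_right[OF 5] has_derivative_mult_right[OF 4]]]])
         (simp add: inner_diff_left algebra_simps)
  qed
  have cu': "continuous_on (ball c \<delta>) u" using cu bG(1) by (meson continuous_on_subset subsetI)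
  have gc: "continuous_on (ball c \<delta>) (\<lambda>z. log_grad (52*\<kappa>) (hermitian p (u z - p)))"
    by (intro continuous_on_compose2[OF continuous_on_log_grad[of "- {0}"]] bounded_linear.continuous_on[OF blT] continuous_intros cu')
       (use bG in auto)
  have gc0: "continuous_on (ball c \<delta>) (\<lambda>z. log_grad 0 (z - z0))"
    by (intro continuous_on_compose2[OF continuous_on_log_grad[of "- {0}"]] continuous_intros) (use bG(3)[of z0] in auto)
  have cont': "continuous_on (ball c \<delta>) (\<lambda>z. u' z h)" for h
    using continuous_on_subset[OF cont] bG(1) by blast
  have cTu: "continuous_on (ball c \<delta>) (\<lambda>z. hermitian p (u' z h))" for h
    by (rule bounded_linear.continuous_on[OF blT cont'])
  have "\<forall>\<^sub>F r in at_right 0. - (pi * \<eta> * r) \<le> integral {0..2*pi} (\<lambda>t.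
      inner (log_grad (52 * \<kappa>) (hermitian p (u (c + of_real r * cis t) - p))) (hermitian p (u' (c + of_real r * cis t) (cis t))))"
    by (rule log_distance_flux[OF p \<delta>(1)]) (use bG deriv hol uS cont' small \<eta> in auto)
  moreover have "\<forall>\<^sub>F r in at_right 0. r * (4 * pi * \<eta> - pi * \<eta>) \<le> integral {0..2*pi} (\<lambda>t.
      inner ((2 * \<eta>) *\<^sub>R (c + of_real r * cis t - z0) - a *\<^sub>R log_grad 0 (c + of_real r * cis t - z0)) (cis t))"
    by (rule log_modulus_flux) (use nz \<eta> in auto)
  moreover have "\<forall>\<^sub>F r in at_right (0::real). r \<in> {0<..<\<delta>}" by (rule eventually_at_right_real[OF \<delta>(1)])
  ultimately have flux: "\<forall>\<^sub>F r in at_right 0. 0 < integral {0..2*pi} (\<lambda>t. f' (c + of_real r * cis t) (cis t))"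
  proof eventually_elim
    case (elim r)
    have Zb: "c + of_real r * cis t \<in> ball c \<delta>" for t using elim(3) by (auto simp: dist_norm norm_mult)
    have Zc: "continuous_on {0..2*pi} (\<lambda>t. c + of_real r * cis t)" by (intro continuous_intros)
    have "continuous_on {0..2*pi} (\<lambda>t. inner (log_grad (52 * \<kappa>) (hermitian p (u (c + of_real r * cis t) - p))) 
       (cos t *\<^sub>R hermitian p (u' (c + of_real r * cis t) 1) + sin t *\<^sub>R hermitian p (u' (c + of_real r * cis t) \<i>)))"
      by (intro continuous_intros continuous_on_compose2[OF gc Zc] continuous_on_compose2[OF cTu Zc]) (use Zb in auto)
    moreover have "hermitian p (u' (c + of_real r * cis t) (cis t)) = cos t *\<^sub>R hermitian p (u' (c + of_real r * cis t) 1) + sin t *\<^sub>R hermitian p (u' (c + of_real r * cis t) \<i>)" for t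
      using complex_linear_decompose[OF has_derivative_linear[OF deriv[OF bG(1)[OF Zb[of t]]]], of "cis t"]
        bounded_linear.linear[OF blT] by (simp add: linear_add linear_scale)
    ultimately have i1: "(\<lambda>t. inner (log_grad (52 * \<kappa>) (hermitian p (u (c + of_real r * cis t) - p))) (hermitian p (u' (c + of_real r * cis t) (cis t)))) integrable_on {0..2*pi}"
      by (intro integrable_continuous_real) simp
    have i2: "(\<lambda>t. inner ((2 * \<eta>) *\<^sub>R (c + of_real r * cis t - z0) - a *\<^sub>R log_grad 0 (c + of_real r * cis t - z0)) (cis t)) integrable_on {0..2*pi}"
      by (intro integrable_continuous_real continuous_intros continuous_on_compose2[OF gc0 Zc]) (use Zb in auto)
    have "0 < r * (2 * pi * \<eta>)" using elim(3) \<eta> by simp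
    then show ?case unfolding f'_def integral_add[OF i1 i2] using elim(1,2) by (simp add: algebra_simps)
  qed
  show ?thesis
  proof (rule strict_submean_of_positive_flux[OF \<delta>(1) df _ flux])
    show "continuous_on (ball c \<delta>) (\<lambda>z. f' z h)" for h
      unfolding f'_def by (intro continuous_intros gc gc0 cTu)
  qed
qed

end

section \<open>The Schwarz lemma\<close>

context lipschitz_structure
begin

text \<open>The maximum principle on an annulus around \<open>z0\<close> for the logarithm of \<open>W z / norm (z - z0)\<close>,
  perturbed by \<open>\<epsilon>\<close> so that it tends to \<open>-\<infinity>\<close> at \<open>z0\<close> and is strictly subharmonic.\<close>

lemma schwarz_log_bound:
  fixes u :: "complex \<Rightarrow> 'e"
  assumes lam: "subharmonic_on V lam" and R: "R > 0" "cball z0 R \<subseteq> V"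
    and uc: "continuous_on (cball z0 R) u"
    and G: "open G" "\<And>z. z \<in> cball z0 R \<Longrightarrow> lam z \<noteq> -\<infinity> \<Longrightarrow> z \<in> G" "z0 \<in> G"
    and deriv: "\<And>z. z \<in> G \<Longrightarrow> (u has_derivative u' z) (at z)"
    and cont: "\<And>h. continuous_on G (\<lambda>z. u' z h)"
    and uS: "\<And>z. z \<in> G \<Longrightarrow> u z \<in> S"
    and hol: "\<And>z. z \<in> G \<Longrightarrow> u' z \<i> = J (u z) (u' z 1)"
    and s: "\<And>z. z \<in> cball z0 R \<Longrightarrow> norm (hermitian (u z0) (u z - u z0)) \<le> s" "s > 0" "s \<le> 1 / (46 * \<kappa>)"
    and z1: "z1 \<in> cball z0 R" "lam z1 \<noteq> -\<infinity>" "u z1 \<noteq> u z0" and \<epsilon>: "0 < \<epsilon>" "\<epsilon> < 1"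
  defines "W \<equiv> (\<lambda>z. norm (hermitian (u z0) (u z - u z0)))"
  shows "ln (W z1) + 52 * \<kappa> * W z1 - (1 - \<epsilon>) * ln (norm (z1 - z0)) \<le> ln s + 52 * \<kappa> * s - (1 - \<epsilon>) * ln R + \<epsilon> * R\<^sup>2"
proof -
  define A where "A = 52 * \<kappa>"
  have A0: "A > 0" using \<kappa>_pos by (simp add: A_def)
  have pS: "u z0 \<in> S" using uS G by auto
  note blT = bounded_linear_hermitian[OF pS]
  have Wc: "continuous_on (cball z0 R) W"
    unfolding W_def by (intro continuous_intros bounded_linear.continuous_on[OF blT] uc)
  have W0: "W z \<ge> 0" for z by (simp add: W_def)
  have Wpos: "W z > 0 \<longleftrightarrow> u z \<noteq> u z0" for z
    using norm_hermitian_ge[of "u z - u z0" "u z0"] by (auto simp: W_def linear_0[OF bounded_linear.linear[OF blT]])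
  define M where "M = ln s + A * s - (1 - \<epsilon>) * ln R + \<epsilon> * R\<^sup>2"
  define f where "f = (\<lambda>z. ln (W z) + A * W z + (\<epsilon> * (norm (z - z0))\<^sup>2 - (1 - \<epsilon>) * ln (norm (z - z0))))"
  define Y where "Y = (\<lambda>z. W z * exp (A * W z + (\<epsilon> * (norm (z - z0))\<^sup>2 - (1 - \<epsilon>) * ln (norm (z - z0)))))"
  have fY: "f z = ln (Y z)" "(Y z > 0)" if "W z > 0" for z
    using that by (simp_all add: f_def Y_def ln_mult)
  have Y0: "Y z > 0 \<Longrightarrow> W z > 0" for z using W0[of z] by (auto simp: Y_def zero_less_mult_iff)
  have z10: "z1 \<noteq> z0" using z1 by auto
  \<comment> \<open>As \<open>u\<close> is differentiable at \<open>z0\<close>, \<open>Y\<close> is \<open>O(\<delta> powr \<epsilon>)\<close> on the circle of radius \<open>\<delta>\<close> around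
      \<open>z0\<close>: this is what the factor \<open>1 - \<epsilon>\<close> is for.\<close>
  have "\<exists>\<delta>. 0 < \<delta> \<and> \<delta> < R \<and> \<delta> < dist z0 z1 \<and> (\<forall>z. dist z0 z = \<delta> \<longrightarrow> Y z \<le> exp M)"
  proof -
    obtain B where B: "B > 0" "\<And>h. norm (u' z0 h) \<le> norm h * B"
      using bounded_linear.pos_bounded[OF has_derivative_bounded_linear[OF deriv[OF G(3)]]] by blast
    obtain d where d: "d > 0" "\<And>z. norm (z - z0) < d \<Longrightarrow> norm (u z - u z0 - u' z0 (z - z0)) \<le> 1 * norm (z - z0)"
      using deriv[OF G(3)] unfolding has_derivative_at_alt by (meson zero_less_one)
    define C where "C = (1 + K) * (B + 1) * exp (A * s + \<epsilon> * R\<^sup>2)"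
    have lim: "((\<lambda>\<delta>. C * \<delta> powr \<epsilon>) \<longlongrightarrow> C * 0) (at_right 0)"
      using \<epsilon>(1)
      by (intro tendsto_mult tendsto_const tendsto_zero_powrI[where b = \<epsilon>] tendsto_ident_at)
         (auto simp: eventually_at_right_less intro: eventually_mono[OF eventually_at_right_less[of "0::real"]])
    have "\<forall>\<^sub>F \<delta> in at_right 0. C * \<delta> powr \<epsilon> < exp M"
      by (rule order_tendstoD(2)[OF lim]) simp
    moreover have "\<forall>\<^sub>F \<delta> in at_right 0. \<delta> \<in> {0<..<min R (min d (dist z0 z1))}"
      using R d z10 by (intro eventually_at_right_real) auto
    ultimately have "\<forall>\<^sub>F \<delta> in at_right 0. C * \<delta> powr \<epsilon> < exp M \<and> \<delta> \<in> {0<..<min R (min d (dist z0 z1))}"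
      by eventually_elim auto
    then obtain \<delta> where \<delta>: "C * \<delta> powr \<epsilon> < exp M" "\<delta> \<in> {0<..<min R (min d (dist z0 z1))}"
      using eventually_happens[of _ "at_right (0::real)"] trivial_limit_at_right_real by blast
    have "Y z \<le> exp M" if z: "dist z0 z = \<delta>" for z
    proof -
      have nz: "norm (z - z0) = \<delta>" using z by (simp add: dist_norm norm_minus_commute)
      have zc: "z \<in> cball z0 R" using z \<delta> by auto
      have "norm (u z - u z0) \<le> norm (u' z0 (z - z0)) + norm (u z - u z0 - u' z0 (z - z0))"
        by (metis add.commute norm_triangle_sub)
      also have "\<dots> \<le> \<delta> * B + 1 * \<delta>" using B(2)[of "z - z0"] d(2)[of z] nz \<delta> by (intro add_mono) auto
      finally have "norm (u z - u z0) \<le> (B + 1) * \<delta>" by (simp add: algebra_simps)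
      then have Wz: "W z \<le> (1 + K) * ((B + 1) * \<delta>)"
        unfolding W_def using K1 by (intro order_trans[OF norm_hermitian_le[OF pS]] mult_left_mono) auto
      have Ws: "W z \<le> s" using s(1)[OF zc] by (simp add: W_def)
      have "A * W z + (\<epsilon> * (norm (z - z0))\<^sup>2 - (1 - \<epsilon>) * ln (norm (z - z0))) \<le> (A * s + \<epsilon> * R\<^sup>2) + (\<epsilon> - 1) * ln \<delta>"
      proof -
        have "A * W z \<le> A * s" using A0 Ws by (intro mult_left_mono) auto
        moreover have "\<epsilon> * (norm (z - z0))\<^sup>2 \<le> \<epsilon> * R\<^sup>2" using \<epsilon> nz \<delta> by (intro mult_left_mono power_mono) auto
        ultimately show ?thesis using nz by (simp add: algebra_simps)
      qed
      then have "Y z \<le> ((1 + K) * ((B + 1) * \<delta>)) * exp ((A * s + \<epsilon> * R\<^sup>2) + (\<epsilon> - 1) * ln \<delta>)"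
        unfolding Y_def using Wz W0 B K1 \<delta> by (intro mult_mono) auto
      also have "\<dots> = C * (exp (ln \<delta>) * exp ((\<epsilon> - 1) * ln \<delta>))"
        unfolding C_def exp_add using \<delta> by simp
      also have "exp (ln \<delta>) * exp ((\<epsilon> - 1) * ln \<delta>) = \<delta> powr \<epsilon>"
      proof -
        have "ln \<delta> + (\<epsilon> - 1) * ln \<delta> = \<epsilon> * ln \<delta>" by (simp add: algebra_simps)
        then show ?thesis using \<delta> by (simp add: powr_def del: exp_ln flip: exp_add)
      qed
      finally show ?thesis using \<delta>(1) by simp
    qed
    then show ?thesis using \<delta> by (intro exI[of _ \<delta>]) auto
  qed
  then obtain \<delta> where \<delta>: "0 < \<delta>" "\<delta> < R" "\<delta> < dist z0 z1" "\<And>z. dist z0 z = \<delta> \<Longrightarrow> Y z \<le> exp M" by blast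
  define AN where "AN = cball z0 R - ball z0 \<delta>"
  have ANc: "compact AN" unfolding AN_def by (intro compact_diff) auto
  have ANn: "norm (z - z0) \<noteq> 0" if "z \<in> AN" for z using that \<delta> by (auto simp: AN_def)
  have Yc: "continuous_on AN Y"
    unfolding Y_def
    by (intro continuous_intros continuous_on_subset[OF Wc]) (use ANn in \<open>auto simp: AN_def\<close>)
  \<comment> \<open>Where \<open>W\<close> vanishes \<open>f\<close> would have to be \<open>-\<infinity>\<close>, so the maximum principle is applied on the part
      of the annulus where \<open>Y\<close> is at least the boundary value.\<close>
  define L where "L = AN \<inter> Y -` {exp M..}"
  have "compact L" unfolding L_def
  proof -
    have "closedin (top_of_set AN) (AN \<inter> Y -` {exp M..})" by (rule continuous_closedin_preimage[OF Yc]) auto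
    then show "compact (AN \<inter> Y -` {exp M..})" using ANc closedin_compact by blast
  qed
  have LV: "L \<subseteq> V" using R by (auto simp: L_def AN_def)
  have LW: "W z > 0" "Y z \<ge> exp M" "z \<in> AN" "z \<in> cball z0 R" if "z \<in> L" for z
    using that Y0[of z] exp_gt_zero[of M] less_le_trans by (auto simp: L_def AN_def)
  have out: "Y z \<le> exp M" if z: "dist z0 z = R" for z
  proof (cases "W z > 0")
    case True
    have Ws: "W z \<le> s" using s(1)[of z] z by (simp add: W_def)
    have nz: "norm (z - z0) = R" using z by (simp add: dist_norm norm_minus_commute)
    have "ln (W z) \<le> ln s" "A * W z \<le> A * s"
      using True Ws A0 s(2) by (auto intro: mult_left_mono)
    then have "f z \<le> M" unfolding f_def M_def nz by linarith
    then have "exp (ln (Y z)) \<le> exp M" using fY(1)[OF True] by simp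
    then show ?thesis using fY(2)[OF True] by simp
  next
    case False
    then have "W z = 0" using W0[of z] by simp
    then show ?thesis by (simp add: Y_def)
  qed
  have inter: "z \<in> interior L" if z: "z \<in> L" and gt: "Y z > exp M" for z
  proof -
    define AO where "AO = ball z0 R - cball z0 \<delta>"
    have "open AO" unfolding AO_def by auto
    moreover have "AO \<subseteq> AN" unfolding AO_def AN_def by auto
    ultimately have "open (AO \<inter> Y -` {exp M<..})"
      using continuous_on_subset[OF Yc] by (intro continuous_open_preimage) auto
    moreover have "z \<in> AO \<inter> Y -` {exp M<..}"
      using LW(3)[OF z] gt \<delta>(4)[of z] out[of z] by (force simp: AO_def AN_def)
    moreover have "AO \<inter> Y -` {exp M<..} \<subseteq> L" using \<open>AO \<subseteq> AN\<close> by (auto simp: L_def)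
    ultimately show ?thesis by (meson interiorI)
  qed
  have fz1: "f z1 \<le> M"
  proof (cases "z1 \<in> L")
    case True
    show ?thesis
    proof (rule subharmonic_exception_maximum_principle[OF lam \<open>compact L\<close> LV _ _ _ True z1(2)])
      show "continuous_on L f"
        unfolding f_def
        by (intro continuous_intros continuous_on_subset[OF Wc])
           (use LW ANn in \<open>fastforce simp: L_def AN_def\<close>)+
      show "f z \<le> M" if z: "z \<in> L" "z \<notin> interior L" for z
      proof -
        have "Y z \<le> exp M" using inter z by force
        then have "ln (Y z) \<le> ln (exp M)" using fY(2)[OF LW(1)[OF z(1)]] by (simp only: ln_le_cancel_iff exp_gt_zero)
        then show ?thesis using fY(1)[OF LW(1)[OF z(1)]] by simp
      qed
      show "\<forall>\<^sub>F r in at_right 0. 2 * pi * f z < integral {0..2 * pi} (\<lambda>t. f (z + of_real r * cis t))"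
        if z: "z \<in> interior L" "lam z \<noteq> -\<infinity>" for z
      proof -
        have zL: "z \<in> L" using z interior_subset by blast
        have "z \<in> G" using G(2) LW(4)[OF zL] z by blast
        moreover have "u z \<noteq> u z0" using LW(1)[OF zL] Wpos by blast
        moreover have "z \<noteq> z0" using ANn[OF LW(3)[OF zL]] by auto
        moreover have "norm (hermitian (u z0) (u z - u z0)) \<le> 1 / (46 * \<kappa>)"
          using s(1)[OF LW(4)[OF zL]] s(3) by linarith
        ultimately show ?thesis
          unfolding f_def W_def A_def using \<epsilon>(1)
          by (intro log_quotient_strict_submean[OF pS G(1) _ deriv cont uS hol]) auto
      qed
    qed
  next
    case False
    have W1: "W z1 > 0" using Wpos z1 by blast
    have "Y z1 < exp M" using False z1 \<delta>(3) by (auto simp: L_def AN_def)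
    then have "ln (Y z1) < ln (exp M)" using fY(2)[OF W1] by (simp only: ln_less_cancel_iff exp_gt_zero)
    then show ?thesis using fY(1)[OF W1] by simp
  qed
  moreover have "0 \<le> \<epsilon> * (norm (z1 - z0))\<^sup>2" using \<epsilon> by simp
  ultimately show ?thesis unfolding f_def M_def A_def by linarith
qed

text \<open>The bound depends on the oscillation \<open>s\<close> of \<open>u\<close> and the radius, but not on the derivative of
  \<open>u\<close> at \<open>z0\<close>: this makes \<open>u\<close> Lipschitz.\<close>

lemma schwarz_lemma:
  fixes u :: "complex \<Rightarrow> 'e"
  assumes lam: "subharmonic_on V lam" and R: "R > 0" "cball z0 R \<subseteq> V"
    and uc: "continuous_on (cball z0 R) u"
    and G: "open G" "\<And>z. z \<in> cball z0 R \<Longrightarrow> lam z \<noteq> -\<infinity> \<Longrightarrow> z \<in> G" "z0 \<in> G"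
    and deriv: "\<And>z. z \<in> G \<Longrightarrow> (u has_derivative u' z) (at z)"
    and cont: "\<And>h. continuous_on G (\<lambda>z. u' z h)"
    and uS: "\<And>z. z \<in> G \<Longrightarrow> u z \<in> S"
    and hol: "\<And>z. z \<in> G \<Longrightarrow> u' z \<i> = J (u z) (u' z 1)"
    and s: "\<And>z. z \<in> cball z0 R \<Longrightarrow> norm (hermitian (u z0) (u z - u z0)) \<le> s" "s > 0" "s \<le> 1 / (46 * \<kappa>)"
    and z1: "z1 \<in> cball z0 R" "lam z1 \<noteq> -\<infinity>"
  shows "norm (u z1 - u z0) \<le> s * exp (52 * \<kappa> * s) / R * norm (z1 - z0)"
proof (cases "u z1 = u z0")
  case True
  then show ?thesis using s R by simp
next
  case False
  define W where "W = norm (hermitian (u z0) (u z1 - u z0))"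
  define X where "X = ln W + 52 * \<kappa> * W - ln (norm (z1 - z0)) - (ln s + 52 * \<kappa> * s - ln R)"
  define B where "B = \<bar>ln R - ln (norm (z1 - z0)) + R\<^sup>2\<bar>"
  have W2: "norm (u z1 - u z0) \<le> W" unfolding W_def by (rule norm_hermitian_ge)
  moreover have "norm (u z1 - u z0) > 0" using False by simp
  ultimately have W: "W > 0" "norm (u z1 - u z0) \<le> W" by linarith+
  have z10: "norm (z1 - z0) > 0" using False by auto
  have "X \<le> \<epsilon> * B" if \<epsilon>: "0 < \<epsilon>" "\<epsilon> < 1" for \<epsilon>
  proof -
    have "X \<le> \<epsilon> * (ln R - ln (norm (z1 - z0)) + R\<^sup>2)"
      using schwarz_log_bound[OF lam R uc G deriv cont uS hol s z1 False \<epsilon>]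
      unfolding X_def W_def[symmetric] by (simp add: algebra_simps)
    also have "\<dots> \<le> \<epsilon> * B" unfolding B_def using \<epsilon> by (intro mult_left_mono) auto
    finally show ?thesis .
  qed
  note Xb = this
  have "X \<le> 0"
  proof (rule ccontr)
    assume "\<not> X \<le> 0"
    define \<epsilon> where "\<epsilon> = min (1/2) (X / (2 * (B + 1)))"
    have B0: "B \<ge> 0" by (simp add: B_def)
    have \<epsilon>: "0 < \<epsilon>" "\<epsilon> < 1" using \<open>\<not> X \<le> 0\<close> B0 by (auto simp: \<epsilon>_def)
    have "\<epsilon> * B \<le> X / (2 * (B + 1)) * (B + 1)"
      using \<epsilon> B0 by (intro mult_mono) (auto simp: \<epsilon>_def)
    also have "\<dots> = X / 2" using B0 by (simp add: field_simps)
    finally show False using Xb[OF \<epsilon>] \<open>\<not> X \<le> 0\<close> by linarith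
  qed
  moreover have "0 \<le> 52 * \<kappa> * W" using \<kappa>_pos W by simp
  ultimately have "ln W \<le> ln s + 52 * \<kappa> * s + (ln (norm (z1 - z0)) - ln R)" unfolding X_def by linarith
  then have "exp (ln W) \<le> exp (ln s + 52 * \<kappa> * s + (ln (norm (z1 - z0)) - ln R))" by simp
  then have "W \<le> s * exp (52 * \<kappa> * s) * (norm (z1 - z0) / R)"
    using W s R z10 by (simp add: exp_add exp_diff)
  then show ?thesis using W by simp
qed

end

section \<open>Lipschitz functions that are differentiable almost everywhere\<close>

lemma has_vector_derivative_iff_quotient:
  fixes f :: "real \<Rightarrow> 'a::real_normed_vector"
  shows "(f has_vector_derivative d) (at x) \<longleftrightarrow> ((\<lambda>y. (f y - f x) /\<^sub>R (y - x)) \<longlongrightarrow> d) (at x)"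
proof -
  have eq: "norm ((f y - f x) - (y - x) *\<^sub>R d) / norm (y - x) = norm ((f y - f x) /\<^sub>R (y - x) - d)" if "y \<noteq> x" for y
  proof -
    have "norm ((f y - f x) - (y - x) *\<^sub>R d) / norm (y - x) = norm (((f y - f x) - (y - x) *\<^sub>R d) /\<^sub>R (y - x))"
      by (simp add: divide_inverse mult.commute)
    also have "((f y - f x) - (y - x) *\<^sub>R d) /\<^sub>R (y - x) = (f y - f x) /\<^sub>R (y - x) - d"
      using that by (simp add: scaleR_diff_right[of "inverse (y - x)" "f y - f x"])
    finally show ?thesis .
  qed
  have "(f has_vector_derivative d) (at x) \<longleftrightarrow> ((\<lambda>y. norm ((f y - f x) - (y - x) *\<^sub>R d) / norm (y - x)) \<longlongrightarrow> 0) (at x)"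
    unfolding has_vector_derivative_def has_derivative_iff_norm by (simp add: bounded_linear_scaleR_left)
  also have "\<dots> \<longleftrightarrow> ((\<lambda>y. norm ((f y - f x) /\<^sub>R (y - x) - d)) \<longlongrightarrow> 0) (at x)"
    by (intro tendsto_cong, unfold eventually_at_filter) (intro always_eventually allI impI eq)
  also have "\<dots> \<longleftrightarrow> ((\<lambda>y. (f y - f x) /\<^sub>R (y - x)) \<longlongrightarrow> d) (at x)"
    by (simp add: tendsto_norm_zero_iff LIM_zero_iff)
  finally show ?thesis .
qed

lemma norm_quotient_le: "y \<noteq> 0 \<Longrightarrow> norm x \<le> L * \<bar>y\<bar> \<Longrightarrow> norm (x /\<^sub>R y) \<le> L"
  for x :: "'a::real_normed_vector"
proof -
  assume "y \<noteq> 0" "norm x \<le> L * \<bar>y\<bar>"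
  moreover have "norm (x /\<^sub>R y) = norm x / \<bar>y\<bar>" by (simp add: divide_inverse mult.commute)
  ultimately show ?thesis by (simp add: pos_divide_le_eq)
qed

lemma has_vector_derivative_norm_le_lipschitz:
  fixes f :: "real \<Rightarrow> 'a::real_normed_vector"
  assumes d: "(f has_vector_derivative d) (at x)" and e: "e > 0"
    and lip: "\<And>y. \<bar>y - x\<bar> < e \<Longrightarrow> norm (f y - f x) \<le> L * \<bar>y - x\<bar>"
  shows "norm d \<le> L"
proof (rule tendsto_upperbound)
  show "((\<lambda>y. norm ((f y - f x) /\<^sub>R (y - x))) \<longlongrightarrow> norm d) (at x)"
    using d unfolding has_vector_derivative_iff_quotient by (rule tendsto_norm)
  have "\<forall>\<^sub>F y in at x. y \<in> ball x e - {x}" using e by (intro eventually_at_in_open) auto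
  then show "\<forall>\<^sub>F y in at x. norm ((f y - f x) /\<^sub>R (y - x)) \<le> L"
  proof eventually_elim
    case (elim y)
    then have "norm (f y - f x) \<le> L * \<bar>y - x\<bar>" by (intro lip) (auto simp: dist_real_def)
    then show ?case using elim by (intro norm_quotient_le) auto
  qed
qed auto

text \<open>Differentiation under the integral sign by dominated convergence of difference quotients; the
  derivative of the integrand may fail to exist on a null set.\<close>

lemma lipschitz_integral_has_vector_derivative:
  fixes W :: "real \<Rightarrow> real \<Rightarrow> 'f::euclidean_space"
  assumes e: "e > 0"
    and int: "\<And>r. \<bar>r - r0\<bar> < e \<Longrightarrow> W r integrable_on {a..b}"
    and lip: "\<And>r t. \<bar>r - r0\<bar> < e \<Longrightarrow> t \<in> {a..b} \<Longrightarrow> norm (W r t - W r0 t) \<le> L * \<bar>r - r0\<bar>"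
    and N: "negligible N"
    and deriv: "\<And>t. t \<in> {a..b} - N \<Longrightarrow> ((\<lambda>r. W r t) has_vector_derivative w t) (at r0)"
  shows "w integrable_on {a..b}"
    and "((\<lambda>r. integral {a..b} (W r)) has_vector_derivative integral {a..b} w) (at r0)"
proof -
  define D where "D = (\<lambda>r t. if t \<in> N then 0 else (W r t - W r0 t) /\<^sub>R (r - r0))"
  define v where "v = (\<lambda>t. if t \<in> N then 0 else w t)"
  have Dint: "D r integrable_on {a..b}" and Deq: "integral {a..b} (D r) = (integral {a..b} (W r) - integral {a..b} (W r0)) /\<^sub>R (r - r0)"
    if r: "\<bar>r - r0\<bar> < e" for r
  proof -
    have i: "W r integrable_on {a..b}" "W r0 integrable_on {a..b}" using int[OF r] int[of r0] e by auto
    have i2: "(\<lambda>t. (W r t - W r0 t) /\<^sub>R (r - r0)) integrable_on {a..b}"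
      using i by (intro integrable_cmul integrable_diff)
    show "D r integrable_on {a..b}"
      by (rule integrable_spike[OF i2 N]) (simp add: D_def)
    have "integral {a..b} (D r) = integral {a..b} (\<lambda>t. (W r t - W r0 t) /\<^sub>R (r - r0))"
      by (rule integral_spike[OF N]) (simp add: D_def)
    also have "\<dots> = (integral {a..b} (W r) - integral {a..b} (W r0)) /\<^sub>R (r - r0)"
      using i by (simp add: integral_diff)
    finally show "integral {a..b} (D r) = (integral {a..b} (W r) - integral {a..b} (W r0)) /\<^sub>R (r - r0)" .
  qed
  have main: "v integrable_on {a..b} \<and> (\<lambda>n. integral {a..b} (D (X n))) \<longlonglongrightarrow> integral {a..b} v"
    if X: "\<And>n. X n \<noteq> r0" "\<And>n. \<bar>X n - r0\<bar> < e" "X \<longlonglongrightarrow> r0" for X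
  proof -
    have le: "norm (D (X n) t) \<le> \<bar>L\<bar>" if "t \<in> {a..b}" for n t
    proof -
      have "norm (W (X n) t - W r0 t) \<le> \<bar>L\<bar> * \<bar>X n - r0\<bar>"
        using lip[OF X(2) that, of n] by (meson abs_ge_self abs_ge_zero mult_right_mono order_trans)
      then show ?thesis using X(1)[of n] norm_quotient_le[of "X n - r0" "W (X n) t - W r0 t"] by (simp add: D_def)
    qed
    have conv: "(\<lambda>n. D (X n) t) \<longlonglongrightarrow> v t" if "t \<in> {a..b}" for t
    proof (cases "t \<in> N")
      case False
      have "((\<lambda>y. (W y t - W r0 t) /\<^sub>R (y - r0)) \<longlongrightarrow> w t) (at r0)"
        using deriv that False unfolding has_vector_derivative_iff_quotient by blast
      moreover have "filterlim X (at r0) sequentially" using X by (simp add: filterlim_at)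
      ultimately have "(\<lambda>n. (W (X n) t - W r0 t) /\<^sub>R (X n - r0)) \<longlonglongrightarrow> w t" by (rule filterlim_compose)
      then show ?thesis using False by (simp add: D_def v_def)
    qed (simp add: D_def v_def)
    have hL: "(\<lambda>_. \<bar>L\<bar>) integrable_on {a..b}" by (rule integrable_const_ivl)
    show ?thesis using dominated_convergence[of "\<lambda>n. D (X n)", OF Dint[OF X(2)] hL le conv] by blast
  qed
  have wv: "integral {a..b} w = integral {a..b} v"
    by (rule integral_spike[OF N, symmetric]) (simp add: v_def)
  have "v integrable_on {a..b}"
  proof -
    define X where "X = (\<lambda>n. r0 + (e / 2) * inverse (real (Suc n)))"
    have "X \<longlonglongrightarrow> r0 + (e / 2) * 0" unfolding X_def
      by (intro tendsto_add tendsto_mult tendsto_const LIMSEQ_inverse_real_of_nat)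
    moreover have "(e / 2) * inverse (real (Suc n)) \<le> e / 2 * 1" for n
      using e by (intro mult_left_mono) (auto simp: field_simps)
    moreover have "(e / 2) * inverse (real (Suc n)) > 0" for n using e by simp
    ultimately have "X \<longlonglongrightarrow> r0" "\<And>n. X n \<noteq> r0" "\<And>n. \<bar>X n - r0\<bar> < e"
      using e unfolding X_def by (force intro: le_less_trans)+
    then show ?thesis using main[of X] by blast
  qed
  then show "w integrable_on {a..b}"
    by (rule integrable_spike[OF _ N]) (simp add: v_def)
  show "((\<lambda>r. integral {a..b} (W r)) has_vector_derivative integral {a..b} w) (at r0)"
    unfolding has_vector_derivative_iff_quotient wv
  proof (rule LIMSEQ_SEQ_conv[THEN iffD1], intro allI impI)
    fix X assume X: "(\<forall>n. X n \<noteq> r0) \<and> X \<longlonglongrightarrow> r0"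
    then obtain k where k: "\<And>n. n \<ge> k \<Longrightarrow> \<bar>X n - r0\<bar> < e"
      using e unfolding LIMSEQ_iff by (metis real_norm_def)
    have "(\<lambda>n. integral {a..b} (D (X (n + k)))) \<longlonglongrightarrow> integral {a..b} v"
      using main[of "\<lambda>n. X (n + k)"] X k LIMSEQ_ignore_initial_segment[of X r0 k] by auto
    then have "(\<lambda>n. (integral {a..b} (W (X (n + k))) - integral {a..b} (W r0)) /\<^sub>R (X (n + k) - r0)) \<longlonglongrightarrow> integral {a..b} v"
      using k by (simp add: Deq)
    then show "(\<lambda>n. (integral {a..b} (W (X n)) - integral {a..b} (W r0)) /\<^sub>R (X n - r0)) \<longlonglongrightarrow> integral {a..b} v"
      by (rule LIMSEQ_offset)
  qed
qed

text \<open>Differentiate the integral of \<open>G (r + t)\<close> over \<open>t\<close> at \<open>r = 0\<close>, once under the integral sign and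
  once by shifting the interval. Lipschitz continuity cannot be weakened to continuity here, as the
  Cantor function shows.\<close>

lemma lipschitz_fundamental_theorem:
  fixes G :: "real \<Rightarrow> 'f::euclidean_space"
  assumes ab: "a \<le> b" and lip: "\<And>s t. norm (G s - G t) \<le> L * \<bar>s - t\<bar>"
    and N: "negligible N" and deriv: "\<And>t. t \<in> {a..b} - N \<Longrightarrow> (G has_vector_derivative g t) (at t)"
  shows "(g has_integral (G b - G a)) {a..b}"
proof -
  have "continuous_on UNIV G"
  proof -
    have "L \<ge> 0" using order_trans[OF norm_ge_zero lip[of 0 1]] by simp
    then have "L-lipschitz_on UNIV G" using lip by (intro lipschitz_onI) (auto simp: dist_norm)
    then show ?thesis by (rule lipschitz_on_continuous_on)
  qed
  then have Gc: "continuous_on T G" for T by (rule continuous_on_subset) auto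
  have shift: "(G \<circ> (+) r has_integral integral {a + r..b + r} G) {a..b}" for r
    unfolding has_integral_shift_Icc_real by (intro integrable_integral integrable_continuous_real Gc)
  have 1: "g integrable_on {a..b}" 
    "((\<lambda>r. integral {a..b} (\<lambda>t. G (r + t))) has_vector_derivative integral {a..b} g) (at 0)"
  proof -
    have int: "(\<lambda>t. G (r + t)) integrable_on {a..b}" for r
      using has_integral_integrable[OF shift[of r]] by (simp add: o_def)
    have l: "norm (G (r + t) - G (0 + t)) \<le> L * \<bar>r - 0\<bar>" for r t using lip[of "r + t" "0 + t"] by simp
    have d: "((\<lambda>r. G (r + t)) has_vector_derivative g t) (at 0)" if "t \<in> {a..b} - N" for t
    proof -
      have "((\<lambda>r. r + t) has_vector_derivative 1) (at 0)" by (auto intro!: derivative_eq_intros)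
      from vector_diff_chain_at[OF this, of G "g t"] deriv[OF that] show ?thesis by (simp add: o_def)
    qed
    show "g integrable_on {a..b}" 
      "((\<lambda>r. integral {a..b} (\<lambda>t. G (r + t))) has_vector_derivative integral {a..b} g) (at 0)"
      using lipschitz_integral_has_vector_derivative[of 1 0 "\<lambda>r t. G (r + t)" a b L N g] int l N d by auto
  qed
  define F where "F = (\<lambda>x. integral {a - 1..x} G)"
  have dF: "(F has_vector_derivative G x) (at x)" if "a - 1 < x" "x < b + 1" for x
  proof -
    have "(F has_vector_derivative G x) (at x within {a - 1..b + 1})"
      unfolding F_def by (rule integral_has_vector_derivative[OF Gc]) (use that in auto)
    then show ?thesis using that at_within_Icc_at[of "a-1" x "b+1"] by simp
  qed
  have dFF: "((\<lambda>r. F (r + b) - F (r + a)) has_vector_derivative (G b - G a)) (at 0)"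
  proof (rule has_vector_derivative_diff)
    have i: "((\<lambda>r. r + t) has_vector_derivative 1) (at 0)" for t :: real by (auto intro!: derivative_eq_intros)
    show "((\<lambda>r. F (r + b)) has_vector_derivative G b) (at 0)"
      using vector_diff_chain_at[OF i[of b], of F "G b"] dF[of b] ab by (simp add: o_def)
    show "((\<lambda>r. F (r + a)) has_vector_derivative G a) (at 0)"
      using vector_diff_chain_at[OF i[of a], of F "G a"] dF[of a] ab by (simp add: o_def)
  qed
  have FG: "F (r + b) - F (r + a) = integral {a..b} (\<lambda>t. G (r + t))" if "\<bar>r\<bar> < 1" for r
  proof -
    have "F (r + a) + integral {r + a..r + b} G = F (r + b)"
      unfolding F_def using that ab by (intro Henstock_Kurzweil_Integration.integral_combine integrable_continuous_real Gc) auto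
    moreover have "integral {a..b} (\<lambda>t. G (r + t)) = integral {r + a..r + b} G"
      using integral_unique[OF shift[of r]] by (simp add: o_def add.commute)
    ultimately show ?thesis by (simp add: algebra_simps)
  qed
  have "((\<lambda>r. integral {a..b} (\<lambda>t. G (r + t))) has_vector_derivative (G b - G a)) (at 0)"
    by (rule has_vector_derivative_transform_within_open[OF dFF, of "ball 0 1"]) (auto simp: dist_real_def FG)
  then have "integral {a..b} g = G b - G a" using 1(2) vector_derivative_unique_at by blast
  then show ?thesis using 1(1) by (metis integrable_integral)
qed

lemma lipschitz_mean_value_inequality:
  fixes G :: "real \<Rightarrow> 'f::euclidean_space"
  assumes ab: "a \<le> b" and lip: "\<And>s t. norm (G s - G t) \<le> L * \<bar>s - t\<bar>"
    and N: "negligible N" and deriv: "\<And>t. t \<in> {a..b} - N \<Longrightarrow> (G has_vector_derivative g t) (at t)"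
    and B: "\<And>t. t \<in> {a..b} - N \<Longrightarrow> norm (g t) \<le> B" "B \<ge> 0"
  shows "norm (G b - G a) \<le> B * (b - a)"
proof -
  have "((\<lambda>t. if t \<in> N then 0 else g t) has_integral (G b - G a)) {a..b}"
    by (rule has_integral_spike[OF N _ lipschitz_fundamental_theorem[OF ab lip N deriv]]) auto
  then have "norm (G b - G a) \<le> B * measure lborel (cbox a b)"
    using B by (intro has_integral_bound[OF B(2), of "\<lambda>t. if t \<in> N then 0 else g t"]) auto
  then show ?thesis using ab by simp
qed

section \<open>Mean slopes\<close>

lemma circle_lipschitz:
  fixes u :: "complex \<Rightarrow> 'e::real_normed_vector"
  assumes lip: "\<And>z w. z \<in> ball p \<rho> \<Longrightarrow> w \<in> ball p \<rho> \<Longrightarrow> norm (u z - u w) \<le> C * norm (z - w)"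
    and c: "cball c r \<subseteq> ball p \<rho>" and r: "0 \<le> r" and C: "C \<ge> 0"
  shows "norm (u (c + of_real r * cis s) - u (c + of_real r * cis t)) \<le> C * r * \<bar>s - t\<bar>"
proof -
  have inb: "c + of_real r * cis t \<in> ball p \<rho>" for t
    using r by (intro subsetD[OF c]) (auto simp: dist_norm norm_mult)
  have "norm (u (c + of_real r * cis s) - u (c + of_real r * cis t)) \<le> C * norm ((c + of_real r * cis s) - (c + of_real r * cis t))"
    by (rule lip[OF inb inb])
  also have "(c + of_real r * cis s) - (c + of_real r * cis t) = of_real r * (cis s - cis t)" by (simp add: algebra_simps)
  also have "norm \<dots> = r * norm (cis s - cis t)" using r by (simp add: norm_mult)
  also have "norm (cis s - cis t) \<le> 1 * norm (s - t)"
  proof (rule differentiable_bound[of UNIV cis "\<lambda>t h. of_real h * (\<i> * cis t)"])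
    show "(cis has_derivative (\<lambda>h. of_real h * (\<i> * cis x))) (at x within UNIV)" for x
    proof -
      have "((\<lambda>x. 0 + of_real 1 * cis x) has_vector_derivative (\<i> * cis x)) (at x)"
        by (auto intro!: derivative_eq_intros simp: has_vector_derivative_def scaleR_conv_of_real)
      then show ?thesis by (simp add: has_vector_derivative_def scaleR_conv_of_real)
    qed
    show "onorm (\<lambda>h. complex_of_real h * (\<i> * cis x)) \<le> 1" for x
      by (rule onorm_le) (simp add: norm_mult)
  qed auto
  finally show ?thesis using C r by (simp add: mult_left_mono mult.assoc)
qed

context lipschitz_structure
begin

lemma continuous_on_J:
  assumes f: "continuous_on X f" and fS: "\<And>x. x \<in> X \<Longrightarrow> f x \<in> S" and g: "continuous_on X g"
  shows "continuous_on X (\<lambda>x. J (f x) (g x))"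
proof -
  have 1: "continuous_on S (\<lambda>x. J x h)" for h
  proof -
    have "(K * norm h)-lipschitz_on S (\<lambda>x. J x h)"
      using J_lipschitz K1 by (intro lipschitz_onI) (auto simp: dist_norm mult.assoc mult.left_commute mult.commute)
    then show ?thesis by (rule lipschitz_on_continuous_on)
  qed
  have "continuous_on X (\<lambda>x. \<Sum>b\<in>Basis. (g x \<bullet> b) *\<^sub>R J (f x) b)"
    using fS by (intro continuous_intros g continuous_on_compose2[OF 1 f]) auto
  moreover have "(\<Sum>b\<in>Basis. (g x \<bullet> b) *\<^sub>R J (f x) b) = J (f x) (g x)" if "x \<in> X" for x
  proof -
    note l = J_linear[OF fS[OF that]]
    have "J (f x) (g x) = J (f x) (\<Sum>b\<in>Basis. (g x \<bullet> b) *\<^sub>R b)" by (simp add: euclidean_representation)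
    then show ?thesis by (simp add: linear_sum[OF l] linear_scale[OF l])
  qed
  ultimately show ?thesis by (rule continuous_on_eq)
qed

text \<open>The product of \<open>y\<close> with \<open>exp (- \<i> t)\<close> for the complex structure \<open>J x\<close>.\<close>

definition rot :: "'e \<Rightarrow> real \<Rightarrow> 'e \<Rightarrow> 'e" where
  "rot x t y = cos t *\<^sub>R y - sin t *\<^sub>R J x y"

lemma norm_rot_le: "x \<in> S \<Longrightarrow> norm (rot x t y) \<le> (1 + K) * norm y"
proof -
  assume x: "x \<in> S"
  have "norm (rot x t y) \<le> \<bar>cos t\<bar> * norm y + \<bar>sin t\<bar> * norm (J x y)"
    unfolding rot_def by (rule order_trans[OF norm_triangle_ineq4]) simp
  also have "\<dots> \<le> 1 * norm y + 1 * (K * norm y)"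
    using J_bound[OF x, of y] K1 by (intro add_mono mult_mono) auto
  finally show ?thesis by (simp add: algebra_simps)
qed

lemma linear_rot: "x \<in> S \<Longrightarrow> linear (rot x t)"
  using J_linear[of x] unfolding rot_def[abs_def]
  by (intro linear_compose_sub linear_compose_scale_right linear_ident)

lemma rot_J: "x \<in> S \<Longrightarrow> J x (rot x t y) = rot x t (J x y)"
  using J_linear[of x] by (simp add: rot_def linear_diff linear_scale)

lemma rot_rotated: "x \<in> S \<Longrightarrow> rot x t (cos t *\<^sub>R y + sin t *\<^sub>R J x y) = y"
proof -
  assume x: "x \<in> S"
  have "rot x t (cos t *\<^sub>R y + sin t *\<^sub>R J x y) = (cos t * cos t) *\<^sub>R y + (sin t * sin t) *\<^sub>R y"
    unfolding rot_def using J_linear[OF x]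
    by (simp add: linear_add linear_scale J_square[OF x] scaleR_add_right scaleR_diff_right mult.commute)
  also have "\<dots> = y" by (simp flip: scaleR_add_left power2_eq_square)
  finally show ?thesis .
qed

text \<open>This is \<open>2 pi\<close> times Cauchy's integral for the complex derivative of \<open>u\<close> at \<open>z\<close> over the circle
  of radius \<open>r\<close>, with respect to the structure at \<open>u z\<close>. For a holomorphic map and constant \<open>J\<close> it
  does not depend on \<open>r\<close>.\<close>

definition mean_slope :: "(complex \<Rightarrow> 'e) \<Rightarrow> real \<Rightarrow> complex \<Rightarrow> 'e" where
  "mean_slope u r z = integral {0..2*pi} (\<lambda>t. rot (u z) t (u (z + of_real r * cis t))) /\<^sub>R r"

lemma rot_integral_const: 
  assumes "x \<in> S"
  shows "((\<lambda>t. rot x t y) has_integral 0) {0..2*pi}"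
proof -
  have "((\<lambda>t. cos t *\<^sub>R y - sin t *\<^sub>R J x y) has_integral ((sin (2*pi) *\<^sub>R y + cos (2*pi) *\<^sub>R J x y) - (sin 0 *\<^sub>R y + cos 0 *\<^sub>R J x y))) {0..2*pi}"
    by (intro fundamental_theorem_of_calculus) (auto intro!: derivative_eq_intros simp: has_vector_derivative_def scaleR_diff_right)
  then show ?thesis by (simp add: rot_def)
qed

lemma continuous_on_rot:
  fixes f :: "'x::t2_space \<Rightarrow> 'e"
  assumes f: "continuous_on X f" and fS: "\<And>x. x \<in> X \<Longrightarrow> f x \<in> S" and g: "continuous_on X g" and h: "continuous_on X h"
  shows "continuous_on X (\<lambda>x. rot (f x) (h x) (g x))"
  unfolding rot_def
  by (intro continuous_on_diff continuous_on_scaleR continuous_on_cos continuous_on_sin g h continuous_on_J[OF f fS g])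

text \<open>Where the structure is frozen at \<open>u z0\<close>, the mean slope does not depend on the radius. As \<open>u\<close>
  is Lipschitz, \<open>J (u z)\<close> differs from \<open>J (u z0)\<close> by \<open>O(r)\<close> on the circle, which costs \<open>O(r)\<close> in
  the numerator of a quotient with denominator \<open>r\<close>. The bound is thus uniform in \<open>z0\<close> and \<open>r\<close>.\<close>

lemma mean_slope_has_derivative:
  fixes u :: "complex \<Rightarrow> 'e"
  assumes lip: "\<And>z w. z \<in> ball p \<rho> \<Longrightarrow> w \<in> ball p \<rho> \<Longrightarrow> norm (u z - u w) \<le> C * norm (z - w)" and C: "C \<ge> 0"
    and uS: "\<And>z. z \<in> ball p \<rho> \<Longrightarrow> u z \<in> S"
    and deriv: "\<And>z. z \<in> G \<Longrightarrow> (u has_derivative u' z) (at z)"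
    and hol: "\<And>z. z \<in> G \<Longrightarrow> u' z \<i> = J (u z) (u' z 1)"
    and r: "0 < r" "cball z0 r \<subseteq> ball p \<rho>"
    and null: "negligible {t\<in>{0..2*pi}. z0 + of_real r * cis t \<notin> G}"
  shows "\<exists>D. ((\<lambda>r. mean_slope u r z0) has_vector_derivative D) (at r) \<and> norm D \<le> 2 * pi * (1 + K) * K\<^sup>2 * C\<^sup>2"
proof -
  define N where "N = {t\<in>{0..2*pi}. z0 + of_real r * cis t \<notin> G}"
  define Z where "Z = (\<lambda>t. z0 + of_real r * cis t)"
  define x where "x = (\<lambda>t. u' (Z t) (cis t))"
  have z0: "z0 \<in> ball p \<rho>" by (rule subsetD[OF r(2)]) (use r(1) in simp)
  note zS = uS[OF z0]
  note blr = linear_conv_bounded_linear[THEN iffD1, OF linear_rot[OF zS]]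
  note blJ = linear_conv_bounded_linear[THEN iffD1, OF J_linear[OF zS]]
  have Zb: "Z t \<in> ball p \<rho>" for t
    using r by (intro subsetD[OF r(2)]) (auto simp: dist_norm norm_mult Z_def)
  have dr: "dist z0 p + r < \<rho>" using r by (simp add: cball_subset_ball_iff)
  define e0 where "e0 = \<rho> - (dist z0 p + r)"
  have e0: "e0 > 0" "\<And>s. \<bar>s - r\<bar> < e0 \<Longrightarrow> cball z0 s \<subseteq> ball p \<rho>"
    using dr by (auto simp: e0_def cball_subset_ball_iff)
  define e where "e = min e0 r"
  have e: "e > 0" using e0 r by (simp add: e_def)
  have eb: "z0 + of_real s * cis t \<in> ball p \<rho>" if "\<bar>s - r\<bar> < e" for s t
    using that e0(2)[of s] by (intro subsetD[OF e0(2)[of s]]) (auto simp: dist_norm norm_mult e_def)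
  have uc: "continuous_on (ball p \<rho>) u"
  proof -
    have "C-lipschitz_on (ball p \<rho>) u" using lip C by (intro lipschitz_onI) (auto simp: dist_norm)
    then show ?thesis by (rule lipschitz_on_continuous_on)
  qed
  have lipr: "norm (u (z0 + of_real s * cis t) - u (Z t)) \<le> C * \<bar>s - r\<bar>" if "\<bar>s - r\<bar> < e" for s t
  proof -
    have "norm ((z0 + of_real s * cis t) - Z t) = \<bar>s - r\<bar>"
      by (simp add: Z_def norm_mult flip: left_diff_distrib of_real_diff)
    then show ?thesis using lip[OF eb[OF that] Zb, of t t] by simp
  qed
  have tan: "((\<lambda>t. u (Z t)) has_vector_derivative r *\<^sub>R J (u (Z t)) (x t)) (at t)" if "t \<in> {0..2*pi} - N" for t
  proof -
    have G: "Z t \<in> G" using that by (auto simp: N_def Z_def)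
    have "u' (Z t) (\<i> * cis t) = J (u (Z t)) (x t)"
      unfolding x_def by (rule holomorphic_derivative_times_i[OF has_derivative_linear[OF deriv[OF G]] uS[OF Zb] hol[OF G]])
    then show ?thesis
      using circle_has_vector_derivative[of u "u' (Z t)" z0 r t UNIV] deriv[OF G] by (simp add: Z_def)
  qed
  have rad: "((\<lambda>s. u (z0 + of_real s * cis t)) has_vector_derivative x t) (at r)" if "t \<in> {0..2*pi} - N" for t
    unfolding x_def Z_def by (rule radius_has_vector_derivative[OF deriv]) (use that in \<open>auto simp: N_def\<close>)
  have xC: "norm (x t) \<le> C" if "t \<in> {0..2*pi} - N" for t
    by (rule has_vector_derivative_norm_le_lipschitz[OF rad[OF that] e]) (use lipr in \<open>auto simp: Z_def\<close>)
  define I where "I = (\<lambda>s. integral {0..2*pi} (\<lambda>t. rot (u z0) t (u (z0 + of_real s * cis t))))"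
  have I1: "(\<lambda>t. rot (u z0) t (x t)) integrable_on {0..2*pi}"
    "(I has_vector_derivative integral {0..2*pi} (\<lambda>t. rot (u z0) t (x t))) (at r)"
  proof -
    have a: "(\<lambda>t. rot (u z0) t (u (z0 + of_real s * cis t))) integrable_on {0..2*pi}" if "\<bar>s - r\<bar> < e" for s
      by (intro integrable_continuous_real continuous_on_rot continuous_on_compose2[OF uc] continuous_intros)
         (use zS eb[OF that] in auto)
    have b: "norm (rot (u z0) t (u (z0 + of_real s * cis t)) - rot (u z0) t (u (z0 + of_real r * cis t))) \<le> ((1 + K) * C) * \<bar>s - r\<bar>"
      if "\<bar>s - r\<bar> < e" for s t
    proof -
      have "norm (rot (u z0) t (u (z0 + of_real s * cis t)) - rot (u z0) t (u (z0 + of_real r * cis t))) \<le> (1 + K) * norm (u (z0 + of_real s * cis t) - u (Z t))"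
        using norm_rot_le[OF zS, of t "u (z0 + of_real s * cis t) - u (Z t)"] by (simp add: linear_diff[OF linear_rot[OF zS]] Z_def)
      also have "\<dots> \<le> (1 + K) * (C * \<bar>s - r\<bar>)" using lipr[OF that] K1 by (intro mult_left_mono) auto
      finally show ?thesis by (simp add: mult.assoc)
    qed
    have c: "((\<lambda>s. rot (u z0) t (u (z0 + of_real s * cis t))) has_vector_derivative rot (u z0) t (x t)) (at r)" if "t \<in> {0..2*pi} - N" for t
      by (rule bounded_linear.has_vector_derivative[OF blr rad[OF that]])
    show "(\<lambda>t. rot (u z0) t (x t)) integrable_on {0..2*pi}"
      by (rule lipschitz_integral_has_vector_derivative(1)[OF e a b null[folded N_def] c])
    show "(I has_vector_derivative integral {0..2*pi} (\<lambda>t. rot (u z0) t (x t))) (at r)"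
      unfolding I_def
      by (rule lipschitz_integral_has_vector_derivative(2)[OF e a b null[folded N_def] c])
  qed
  \<comment> \<open>\<open>H\<close> is periodic, so its derivative, which exists off the null set \<open>N\<close>, has integral 0.\<close>
  define H where "H = (\<lambda>t. J (u z0) (rot (u z0) t (u (Z t) - u z0)))"
  have Hd: "(H has_vector_derivative (rot (u z0) t (u (Z t) - u z0) + r *\<^sub>R J (u z0) (rot (u z0) t (J (u (Z t)) (x t))))) (at t)"
    if t: "t \<in> {0..2*pi} - N" for t
  proof -
    have "((\<lambda>t. u (Z t) - u z0) has_vector_derivative r *\<^sub>R J (u (Z t)) (x t)) (at t)"
      using tan[OF t] by (auto intro!: derivative_eq_intros)
    moreover from bounded_linear.has_vector_derivative[OF blJ this]
    have "((\<lambda>t. J (u z0) (u (Z t) - u z0)) has_vector_derivative J (u z0) (r *\<^sub>R J (u (Z t)) (x t))) (at t)" .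
    moreover have "(cos has_real_derivative (- sin t)) (at t)" "(sin has_real_derivative (cos t)) (at t)"
      by (auto intro!: derivative_eq_intros)
    ultimately have "((\<lambda>t. rot (u z0) t (u (Z t) - u z0)) has_vector_derivative 
       ((cos t *\<^sub>R (r *\<^sub>R J (u (Z t)) (x t)) + (- sin t) *\<^sub>R (u (Z t) - u z0)) -
        (sin t *\<^sub>R J (u z0) (r *\<^sub>R J (u (Z t)) (x t)) + cos t *\<^sub>R J (u z0) (u (Z t) - u z0)))) (at t)"
      unfolding rot_def by (intro has_vector_derivative_diff has_vector_derivative_scaleR)
    from bounded_linear.has_vector_derivative[OF blJ this]
    have 1: "(H has_vector_derivative J (u z0) ((cos t *\<^sub>R (r *\<^sub>R J (u (Z t)) (x t)) + (- sin t) *\<^sub>R (u (Z t) - u z0)) -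
        (sin t *\<^sub>R J (u z0) (r *\<^sub>R J (u (Z t)) (x t)) + cos t *\<^sub>R J (u z0) (u (Z t) - u z0)))) (at t)"
      unfolding H_def .
    note l = J_linear[OF zS]
    show ?thesis
      by (rule has_vector_derivative_eq_rhs[OF 1])
         (simp add: rot_def linear_diff[OF l] linear_add[OF l] linear_scale[OF l] linear_neg[OF l] J_square[OF zS] algebra_simps)
  qed
  have Hlip: "\<exists>L. \<forall>s t. norm (H s - H t) \<le> L * \<bar>s - t\<bar>"
  proof -
    have a: "norm (u (Z s) - u (Z t)) \<le> C * r * \<bar>s - t\<bar>" for s t
      unfolding Z_def by (rule circle_lipschitz[OF lip r(2) _ C]) (use r in auto)
    have ub: "norm (u (Z t) - u z0) \<le> C * r" for t
      using lip[OF Zb z0, of t] r by (simp add: Z_def norm_mult)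
    have cs: "\<bar>cos s - cos t\<bar> \<le> \<bar>s - t\<bar>" "\<bar>sin s - sin t\<bar> \<le> \<bar>s - t\<bar>" for s t :: real
    proof -
      have "norm (cos s - cos t) \<le> 1 * norm (s - t)"
        by (rule differentiable_bound[of UNIV cos "\<lambda>t h. - sin t * h"])
           (auto intro!: derivative_eq_intros onorm_le simp: abs_mult mult_left_le_one_le)
      moreover have "norm (sin s - sin t) \<le> 1 * norm (s - t)"
        by (rule differentiable_bound[of UNIV sin "\<lambda>t h. cos t * h"])
           (auto intro!: derivative_eq_intros onorm_le simp: abs_mult mult_left_le_one_le)
      ultimately show "\<bar>cos s - cos t\<bar> \<le> \<bar>s - t\<bar>" "\<bar>sin s - sin t\<bar> \<le> \<bar>s - t\<bar>" by auto
    qed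
    have "norm (H s - H t) \<le> (K * ((1 + K) * (C * r) + (1 + K) * (C * r))) * \<bar>s - t\<bar>" for s t
    proof -
      let ?v = "\<lambda>t. u (Z t) - u z0"
      have eq: "rot (u z0) s (?v s) - rot (u z0) t (?v t) = rot (u z0) s (?v s - ?v t) + ((cos s - cos t) *\<^sub>R ?v t - (sin s - sin t) *\<^sub>R J (u z0) (?v t))"
        unfolding rot_def linear_diff[OF J_linear[OF zS]] by (simp add: algebra_simps)
      have "norm (H s - H t) \<le> K * norm (rot (u z0) s (?v s) - rot (u z0) t (?v t))"
        unfolding H_def using J_bound[OF zS] by (simp add: linear_diff[OF J_linear[OF zS], symmetric])
      also have "\<dots> \<le> K * ((1 + K) * (C * r * \<bar>s - t\<bar>) + (\<bar>s - t\<bar> * (C * r) + \<bar>s - t\<bar> * (K * (C * r))))"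
        unfolding eq
      proof (intro mult_left_mono order_trans[OF norm_triangle_ineq] add_mono order_trans[OF norm_triangle_ineq4])
        show "norm (rot (u z0) s (?v s - ?v t)) \<le> (1 + K) * (C * r * \<bar>s - t\<bar>)"
          using K1 a[of s t] by (intro order_trans[OF norm_rot_le[OF zS]] mult_left_mono) auto
        show "norm ((cos s - cos t) *\<^sub>R ?v t) \<le> \<bar>s - t\<bar> * (C * r)"
          using cs ub by (auto intro!: mult_mono)
        show "norm ((sin s - sin t) *\<^sub>R J (u z0) (?v t)) \<le> \<bar>s - t\<bar> * (K * (C * r))"
          using cs ub[of t] K1 by (auto intro!: mult_mono order_trans[OF J_bound[OF zS]] mult_left_mono)
      qed (use K1 in auto)
      finally show ?thesis by (simp add: algebra_simps)
    qed
    then show ?thesis by blast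
  qed
  then obtain L where L: "\<And>s t. norm (H s - H t) \<le> L * \<bar>s - t\<bar>" by blast
  have H0: "((\<lambda>t. rot (u z0) t (u (Z t) - u z0) + r *\<^sub>R J (u z0) (rot (u z0) t (J (u (Z t)) (x t)))) has_integral 0) {0..2*pi}"
    using lipschitz_fundamental_theorem[of 0 "2*pi" H L N, OF _ L null[folded N_def] Hd] by (simp add: H_def Z_def rot_def)
  have Ir: "((\<lambda>t. rot (u z0) t (u (Z t))) has_integral I r) {0..2*pi}"
    unfolding I_def Z_def
    by (intro integrable_integral integrable_continuous_real continuous_on_rot continuous_on_compose2[OF uc] continuous_intros)
         (use zS Zb in \<open>auto simp: Z_def\<close>)
  have Ir': "((\<lambda>t. rot (u z0) t (u (Z t) - u z0)) has_integral I r) {0..2*pi}"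
    using has_integral_diff[OF Ir rot_integral_const[OF zS, of "u z0"]] by (simp add: linear_diff[OF linear_rot[OF zS]])
  define Q where "Q = integral {0..2*pi} (\<lambda>t. rot (u z0) t (x t))"
  have Qi: "((\<lambda>t. rot (u z0) t (x t)) has_integral Q) {0..2*pi}" unfolding Q_def by (rule integrable_integral[OF I1(1)])
  \<comment> \<open>The first two terms integrate to \<open>r\<^sup>2\<close> times the derivative of the mean slope. Adding the
      vanishing tangential integral leaves a multiple of the variation of \<open>J\<close>.\<close>
  have comb0: "((\<lambda>t. r *\<^sub>R rot (u z0) t (x t) - rot (u z0) t (u (Z t) - u z0) 
      + (rot (u z0) t (u (Z t) - u z0) + r *\<^sub>R J (u z0) (rot (u z0) t (J (u (Z t)) (x t))))) has_integral (r *\<^sub>R Q - I r + 0)) {0..2*pi}"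
    by (intro has_integral_add has_integral_diff has_integral_cmul Qi Ir' H0)
  have comb: "((\<lambda>t. if t \<in> N then 0 else r *\<^sub>R rot (u z0) t (x t) - rot (u z0) t (u (Z t) - u z0) 
      + (rot (u z0) t (u (Z t) - u z0) + r *\<^sub>R J (u z0) (rot (u z0) t (J (u (Z t)) (x t))))) has_integral (r *\<^sub>R Q - I r)) {0..2*pi}"
    by (rule has_integral_spike[OF null[folded N_def] _ comb0[unfolded add_0_right]]) simp
  have pw: "norm (if t \<in> N then 0 else r *\<^sub>R rot (u z0) t (x t) - rot (u z0) t (u (Z t) - u z0) 
      + (rot (u z0) t (u (Z t) - u z0) + r *\<^sub>R J (u z0) (rot (u z0) t (J (u (Z t)) (x t))))) \<le> r * (r * ((1 + K) * K\<^sup>2 * C\<^sup>2))"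
    if t: "t \<in> cbox 0 (2*pi)" for t
  proof (cases "t \<in> N")
    case False
    have l: "linear (rot (u z0) t)" by (rule linear_rot[OF zS])
    have "x t + J (u z0) (J (u (Z t)) (x t)) = J (u z0) (J (u (Z t)) (x t) - J (u z0) (x t))"
      by (simp add: linear_diff[OF J_linear[OF zS]] J_square[OF zS])
    then have "r *\<^sub>R rot (u z0) t (x t) - rot (u z0) t (u (Z t) - u z0) 
      + (rot (u z0) t (u (Z t) - u z0) + r *\<^sub>R J (u z0) (rot (u z0) t (J (u (Z t)) (x t)))) = r *\<^sub>R rot (u z0) t (J (u z0) (J (u (Z t)) (x t) - J (u z0) (x t)))"
      by (simp add: rot_J[OF zS] linear_add[OF l, symmetric] scaleR_add_right[symmetric])
    also have "norm \<dots> = r * norm (rot (u z0) t (J (u z0) (J (u (Z t)) (x t) - J (u z0) (x t))))" using r by simp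
    also have "\<dots> \<le> r * ((1 + K) * (K * (K * (C * r) * C)))"
    proof (intro mult_left_mono order_trans[OF norm_rot_le[OF zS]] order_trans[OF J_bound[OF zS]])
      have "norm (J (u (Z t)) (x t) - J (u z0) (x t)) \<le> K * norm (u (Z t) - u z0) * norm (x t)"
        by (rule J_lipschitz[OF uS[OF Zb] zS])
      also have "\<dots> \<le> K * (C * r) * C"
        using lip[OF Zb z0, of t] r xC[of t] t False C K1 by (intro mult_mono) (auto simp: Z_def norm_mult)
      finally show "norm (J (u (Z t)) (x t) - J (u z0) (x t)) \<le> K * (C * r) * C" .
    qed (use r K1 in auto)
    also have "\<dots> = r * (r * ((1 + K) * K\<^sup>2 * C\<^sup>2))" by (simp add: power2_eq_square algebra_simps)
    finally show ?thesis using False by simp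
  qed (use K1 r in auto)
  have nb: "norm (r *\<^sub>R Q - I r) \<le> r * (r * ((1 + K) * K\<^sup>2 * C\<^sup>2)) * (2 * pi)"
    using has_integral_bound[OF _ comb[folded box_real(2)] pw] r K1 by simp
  have D: "((\<lambda>s. I s /\<^sub>R s) has_vector_derivative (Q /\<^sub>R r - I r /\<^sub>R (r * r))) (at r)"
  proof -
    have "((\<lambda>s. inverse s) has_real_derivative (- inverse (r * r))) (at r)"
      using r by (auto intro!: derivative_eq_intros simp: power2_eq_square)
    from has_vector_derivative_scaleR[OF this I1(2)] show ?thesis
      by (simp add: Q_def algebra_simps)
  qed
  have "Q /\<^sub>R r - I r /\<^sub>R (r * r) = (r *\<^sub>R Q - I r) /\<^sub>R (r * r)"
    using r by (simp add: scaleR_diff_right)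
  then have "norm (Q /\<^sub>R r - I r /\<^sub>R (r * r)) = norm (r *\<^sub>R Q - I r) / (r * r)"
    using r by (simp add: divide_inverse mult.commute)
  also have "\<dots> \<le> (r * (r * ((1 + K) * K\<^sup>2 * C\<^sup>2)) * (2 * pi)) / (r * r)"
    using nb r by (intro divide_right_mono) auto
  also have "\<dots> = 2 * pi * (1 + K) * K\<^sup>2 * C\<^sup>2" using r by simp
  finally show ?thesis using D unfolding mean_slope_def I_def by blast
qed

end

section \<open>Continuous differentiability\<close>

lemma le_on_dense_subset:
  fixes f g :: "'a::topological_space \<Rightarrow> real"
  assumes B: "open B" and f: "continuous_on B f" and g: "continuous_on B g"
    and dense: "\<And>U q. open U \<Longrightarrow> q \<in> U \<Longrightarrow> q \<in> B \<Longrightarrow> \<exists>z\<in>U \<inter> B. z \<in> F"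
    and le: "\<And>z. z \<in> B \<Longrightarrow> z \<in> F \<Longrightarrow> f z \<le> g z" and q: "q \<in> B"
  shows "f q \<le> g q"
proof (rule ccontr)
  assume "\<not> f q \<le> g q"
  then have "q \<in> B \<inter> (\<lambda>z. f z - g z) -` {0<..}" using q by auto
  moreover have "open (B \<inter> (\<lambda>z. f z - g z) -` {0<..})"
    using B f g by (intro continuous_open_preimage continuous_intros) auto
  ultimately obtain z where "z \<in> B" "z \<in> F" "f z - g z > 0" using dense q by blast
  then show False using le[of z] by simp
qed

lemma complex_polar_Icc:
  obtains t where "t \<in> {0..2*pi}" "k = of_real (norm k) * cis t"
proof -
  have "k = of_real (norm k) * cis (Arg2pi k)"
    using Arg2pi_eq[of k] by (simp add: cis_conv_exp)
  moreover have "Arg2pi k \<in> {0..2*pi}" using Arg2pi_ge_0[of k] Arg2pi_lt_2pi[of k] by auto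
  ultimately show ?thesis using that by blast
qed

context lipschitz_structure
begin

text \<open>At centres in \<open>F\<close> the mean slopes converge at a rate that does not depend on the centre. For a
  fixed radius they depend continuously on the centre, so by density they converge uniformly, and
  the continuous limit is \<open>2 pi\<close> times the partial derivative \<open>P\<close> of \<open>u\<close> on \<open>G\<close>. That \<open>P\<close> yields the
  derivative of \<open>u\<close> also off \<open>G\<close> follows by joining two points by half circles: those around a
  centre in \<open>F\<close> leave \<open>G\<close> on a null set only, and such centres approximate the midpoint.\<close>

lemma lipschitz_imp_continuously_differentiable:
  fixes u :: "complex \<Rightarrow> 'e"
  assumes \<rho>: "\<rho> > 0"
    and lip: "\<And>z w. z \<in> ball p \<rho> \<Longrightarrow> w \<in> ball p \<rho> \<Longrightarrow> norm (u z - u w) \<le> C * norm (z - w)" and C: "C \<ge> 0"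
    and uS: "\<And>z. z \<in> ball p \<rho> \<Longrightarrow> u z \<in> S"
    and deriv: "\<And>z. z \<in> G \<Longrightarrow> (u has_derivative u' z) (at z)"
    and hol: "\<And>z. z \<in> G \<Longrightarrow> u' z \<i> = J (u z) (u' z 1)"
    and dense: "\<And>U q. open U \<Longrightarrow> q \<in> U \<Longrightarrow> q \<in> ball p \<rho> \<Longrightarrow> \<exists>z\<in>U \<inter> ball p \<rho>. z \<in> F"
    and null: "\<And>z r. z \<in> F \<Longrightarrow> 0 < r \<Longrightarrow> cball z r \<subseteq> ball p \<rho> \<Longrightarrow> negligible {t\<in>{0..2*pi}. z + of_real r * cis t \<notin> G}"
  shows "\<exists>P. continuous_on (ball p (\<rho>/2)) P \<and>
     (\<forall>z\<in>ball p (\<rho>/2). (u has_derivative (\<lambda>h. Re h *\<^sub>R P z + Im h *\<^sub>R J (u z) (P z))) (at z))"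
proof -
  define B where "B = 2 * pi * (1 + K) * K\<^sup>2 * C\<^sup>2"
  have B0: "B \<ge> 0" using K1 by (simp add: B_def)
  define H where "H = ball p (\<rho>/2)"
  have Hb: "z + of_real r * cis t \<in> ball p \<rho>" if "z \<in> H" "0 \<le> r" "r < \<rho>/2" for z r t
  proof -
    have "dist p (z + of_real r * cis t) \<le> dist p z + dist z (z + of_real r * cis t)" by (rule dist_triangle)
    also have "dist z (z + of_real r * cis t) = r" using that by (simp add: dist_norm norm_mult)
    finally show ?thesis using that by (simp add: H_def)
  qed
  have HB: "H \<subseteq> ball p \<rho>" using \<rho> by (auto simp: H_def)
  have denseH: "\<exists>z\<in>U \<inter> H. z \<in> F" if "open U" "q \<in> U" "q \<in> H" for U q
  proof -
    have "open (U \<inter> H)" "q \<in> U \<inter> H" "q \<in> ball p \<rho>" using that HB by (auto simp: H_def)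
    from dense[OF this] show ?thesis by blast
  qed
  have uc: "continuous_on (ball p \<rho>) u"
  proof -
    have "C-lipschitz_on (ball p \<rho>) u" using lip C by (intro lipschitz_onI) (auto simp: dist_norm)
    then show ?thesis by (rule lipschitz_on_continuous_on)
  qed
  have slopeF: "norm (mean_slope u a z - mean_slope u b z) \<le> B * \<bar>a - b\<bar>"
    if z: "z \<in> H" "z \<in> F" and ab: "a \<in> {0<..<\<rho>/2}" "b \<in> {0<..<\<rho>/2}" for z a b
  proof -
    have "\<exists>D. ((\<lambda>r. mean_slope u r z) has_vector_derivative D) (at r) \<and> norm D \<le> B" if r: "r \<in> {0<..<\<rho>/2}" for r
    proof -
      have sub: "cball z r \<subseteq> ball p \<rho>" using z r by (auto simp: H_def cball_subset_ball_iff dist_commute)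
      show ?thesis unfolding B_def
        by (rule mean_slope_has_derivative[OF lip C uS deriv hol _ sub null[OF z(2) _ sub]]) (use r in auto)
    qed
    then obtain D where D: "\<And>r. r \<in> {0<..<\<rho>/2} \<Longrightarrow> ((\<lambda>r. mean_slope u r z) has_vector_derivative D r) (at r)"
      "\<And>r. r \<in> {0<..<\<rho>/2} \<Longrightarrow> norm (D r) \<le> B" by metis
    have "norm (mean_slope u a z - mean_slope u b z) \<le> B * norm (a - b)"
    proof (rule differentiable_bound[of "{0<..<\<rho>/2}" "\<lambda>r. mean_slope u r z" "\<lambda>r h. h *\<^sub>R D r"])
      show "((\<lambda>r. mean_slope u r z) has_derivative (\<lambda>h. h *\<^sub>R D x)) (at x within {0<..<\<rho>/2})" if "x \<in> {0<..<\<rho>/2}" for x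
        using D(1)[OF that] unfolding has_vector_derivative_def by (rule has_derivative_at_withinI)
      show "onorm (\<lambda>h. h *\<^sub>R D x) \<le> B" if "x \<in> {0<..<\<rho>/2}" for x
      proof (rule onorm_le)
        fix h :: real
        show "norm (h *\<^sub>R D x) \<le> B * norm h" using mult_left_mono[OF D(2)[OF that], of "\<bar>h\<bar>"] by (simp add: mult.commute)
      qed
    qed (use ab in auto)
    then show ?thesis by simp
  qed
  have slopec: "continuous_on H (mean_slope u r)" if r: "r \<in> {0<..<\<rho>/2}" for r
  proof -
    have "continuous_on (H \<times> cbox 0 (2*pi)) (\<lambda>x. rot (u (fst x)) (snd x) (u (fst x + of_real r * cis (snd x))))"
      by (intro continuous_on_rot continuous_on_compose2[OF uc] continuous_intros)
         (use Hb r HB uS in \<open>auto simp: subset_iff\<close>)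
    then have "continuous_on (H \<times> cbox 0 (2*pi)) (\<lambda>(z, t). rot (u z) t (u (z + of_real r * cis t)))"
      by (simp add: split_beta)
    from integral_continuous_on_param[OF this]
    show ?thesis unfolding mean_slope_def[abs_def] by (intro continuous_intros) simp
  qed
  have slope: "norm (mean_slope u a z - mean_slope u b z) \<le> B * \<bar>a - b\<bar>"
    if z: "z \<in> H" and ab: "a \<in> {0<..<\<rho>/2}" "b \<in> {0<..<\<rho>/2}" for z a b
    by (rule le_on_dense_subset[of H _ _ F z, OF _ _ _ denseH])
       (use z ab slopeF in \<open>auto intro!: continuous_intros slopec simp: H_def[symmetric]\<close>, simp add: H_def)
  define rad where "rad = (\<lambda>n. (\<rho>/4) * inverse (real (Suc n)))"
  have rad: "rad n \<in> {0<..<\<rho>/2}" for n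
  proof -
    have "(\<rho>/4) * inverse (real (Suc n)) \<le> (\<rho>/4) * 1" using \<rho> by (intro mult_left_mono) (auto simp: field_simps)
    moreover have "(\<rho>/4) * inverse (real (Suc n)) > 0" using \<rho> by simp
    ultimately show ?thesis using \<rho> by (simp add: rad_def)
  qed
  have rad0: "rad \<longlonglongrightarrow> 0"
    using tendsto_mult[OF tendsto_const LIMSEQ_inverse_real_of_nat, of "\<rho>/4"] by (simp add: rad_def)
  have conv: "convergent (\<lambda>n. mean_slope u (rad n) z)" if z: "z \<in> H" for z
  proof (rule Cauchy_convergent, rule metric_CauchyI)
    fix e :: real assume e: "e > 0"
    have "Cauchy rad" using rad0 by (rule LIMSEQ_imp_Cauchy)
    then obtain M where M: "\<And>m n. m \<ge> M \<Longrightarrow> n \<ge> M \<Longrightarrow> dist (rad m) (rad n) < e / (B + 1)"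
      using B0 e by (metis Cauchy_def divide_pos_pos add_nonneg_pos zero_less_one)
    have "dist (mean_slope u (rad m) z) (mean_slope u (rad n) z) < e" if "m \<ge> M" "n \<ge> M" for m n
    proof -
      have "dist (mean_slope u (rad m) z) (mean_slope u (rad n) z) \<le> B * dist (rad m) (rad n)"
        using slope[OF z rad rad] by (simp add: dist_norm)
      also have "\<dots> \<le> (B + 1) * dist (rad m) (rad n)" by (intro mult_right_mono) auto
      also have "\<dots> < (B + 1) * (e / (B + 1))" using M[OF that] B0 by (intro mult_strict_left_mono) auto
      finally show ?thesis using B0 by simp
    qed
    then show "\<exists>M. \<forall>m\<ge>M. \<forall>n\<ge>M. dist (mean_slope u (rad m) z) (mean_slope u (rad n) z) < e" by blast
  qed
  define L where "L = (\<lambda>z. lim (\<lambda>n. mean_slope u (rad n) z))"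
  have L: "(\<lambda>n. mean_slope u (rad n) z) \<longlonglongrightarrow> L z" if "z \<in> H" for z
    using conv[OF that] unfolding L_def by (simp add: convergent_LIMSEQ_iff)
  have QL: "norm (mean_slope u (rad n) z - L z) \<le> B * rad n" if z: "z \<in> H" for z n
  proof (rule tendsto_le[OF trivial_limit_sequentially])
    show "(\<lambda>m. norm (mean_slope u (rad n) z - mean_slope u (rad m) z)) \<longlonglongrightarrow> norm (mean_slope u (rad n) z - L z)"
      by (intro tendsto_intros L z)
    have "(\<lambda>m. B * \<bar>rad n - rad m\<bar>) \<longlonglongrightarrow> B * \<bar>rad n - 0\<bar>" by (intro tendsto_intros rad0)
    then show "(\<lambda>m. B * \<bar>rad n - rad m\<bar>) \<longlonglongrightarrow> B * rad n" using rad[of n] by simp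
  qed (use slope[OF z rad rad] in auto)
  have Lc: "continuous_on H L"
  proof (rule uniform_limit_theorem)
    show "uniform_limit H (\<lambda>n. mean_slope u (rad n)) L sequentially"
    proof (rule uniform_limitI)
      fix e :: real assume e: "e > 0"
      have "(\<lambda>n. B * rad n) \<longlonglongrightarrow> B * 0" by (intro tendsto_intros rad0)
      then have "\<forall>\<^sub>F n in sequentially. B * rad n < e" using e by (intro order_tendstoD(2)[of _ "B * 0"]) auto
      then show "\<forall>\<^sub>F n in sequentially. \<forall>z\<in>H. dist (mean_slope u (rad n) z) (L z) < e"
      proof eventually_elim
        case (elim n)
        show ?case
        proof
          fix z assume "z \<in> H"
          from QL[OF this, of n] elim show "dist (mean_slope u (rad n) z) (L z) < e" by (simp add: dist_norm)
        qed
      qed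
    qed
  qed (use slopec rad in auto)
  have LG: "L z = (2 * pi) *\<^sub>R u' z 1" if z: "z \<in> H" "z \<in> G" for z
  proof (rule LIMSEQ_unique[OF L[OF z(1)]])
    have zS: "u z \<in> S" using uS HB z by auto
    have lz: "linear (u' z)" by (rule has_derivative_linear[OF deriv[OF z(2)]])
    show "(\<lambda>n. mean_slope u (rad n) z) \<longlonglongrightarrow> (2 * pi) *\<^sub>R u' z 1"
    proof (rule metric_LIMSEQ_I)
      fix e :: real assume e: "e > 0"
      define \<epsilon> where "\<epsilon> = e / (4 * pi * (1 + K))"
      have pos: "4 * pi * (1 + K) > 0" using K1 by simp
      have "2 * pi * ((1 + K) * \<epsilon>) = (4 * pi * (1 + K)) * \<epsilon> / 2" by simp
      also have "\<dots> = e / 2" using K1 by (auto simp: \<epsilon>_def)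
      finally have \<epsilon>: "\<epsilon> > 0" "2 * pi * ((1 + K) * \<epsilon>) < e"
        using e divide_pos_pos[OF e pos] by (auto simp: \<epsilon>_def)
      obtain d where d: "d > 0" "\<And>y. norm (y - z) < d \<Longrightarrow> norm (u y - u z - u' z (y - z)) \<le> \<epsilon> * norm (y - z)"
        using deriv[OF z(2)] \<epsilon>(1) unfolding has_derivative_at_alt by blast
      obtain M where M: "\<And>n. n \<ge> M \<Longrightarrow> rad n < d"
        using order_tendstoD(2)[OF rad0 d(1)] unfolding eventually_sequentially by blast
      have "dist (mean_slope u (rad n) z) ((2 * pi) *\<^sub>R u' z 1) < e" if n: "n \<ge> M" for n
      proof -
        define r where "r = rad n"
        have r: "0 < r" "r < d" "r < \<rho>/2" using rad[of n] M[OF n] by (auto simp: r_def)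
        have lr: "linear (rot (u z) t)" for t by (rule linear_rot[OF zS])
        have "((\<lambda>t. rot (u z) t (u (z + of_real r * cis t))) has_integral r *\<^sub>R mean_slope u r z) {0..2*pi}"
        proof -
          have "(\<lambda>t. rot (u z) t (u (z + of_real r * cis t))) integrable_on {0..2*pi}"
            by (intro integrable_continuous_real continuous_on_rot continuous_on_compose2[OF uc] continuous_intros)
               (use zS Hb[OF z(1)] r in auto)
          then show ?thesis using r by (simp add: mean_slope_def integrable_integral)
        qed
        moreover have "((\<lambda>t. u' z 1) has_integral (2 * pi - 0) *\<^sub>R u' z 1) {0..2*pi}"
          using has_integral_const_real[of "u' z 1" 0 "2*pi"] by simp
        ultimately have "((\<lambda>t. rot (u z) t (u (z + of_real r * cis t)) - rot (u z) t (u z) - r *\<^sub>R u' z 1) has_integral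
            (r *\<^sub>R mean_slope u r z - 0 - r *\<^sub>R ((2 * pi - 0) *\<^sub>R u' z 1))) {0..2*pi}"
          by (intro has_integral_diff has_integral_cmul rot_integral_const[OF zS])
        moreover have "norm (rot (u z) t (u (z + of_real r * cis t)) - rot (u z) t (u z) - r *\<^sub>R u' z 1) \<le> (1 + K) * (\<epsilon> * r)" for t
        proof -
          have "u' z (cis t) = cos t *\<^sub>R u' z 1 + sin t *\<^sub>R J (u z) (u' z 1)"
            using complex_linear_decompose[OF lz, of "cis t"] hol[OF z(2)] by simp
          then have 1: "rot (u z) t (u' z (cis t)) = u' z 1" using rot_rotated[OF zS] by simp
          have 2: "u' z (of_real r * cis t) = r *\<^sub>R u' z (cis t)"
            using linear_scale[OF lz, of r "cis t"] by (simp add: scaleR_conv_of_real)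
          have "rot (u z) t (u (z + of_real r * cis t)) - rot (u z) t (u z) - r *\<^sub>R u' z 1 = rot (u z) t (u (z + of_real r * cis t) - u z - u' z (of_real r * cis t))"
            by (simp add: linear_diff[OF lr] linear_scale[OF lr] 1 2)
          also have "norm \<dots> \<le> (1 + K) * norm (u (z + of_real r * cis t) - u z - u' z (of_real r * cis t))"
            by (rule norm_rot_le[OF zS])
          also have "\<dots> \<le> (1 + K) * (\<epsilon> * r)"
            using d(2)[of "z + of_real r * cis t"] r K1 by (intro mult_left_mono) (auto simp: norm_mult)
          finally show ?thesis .
        qed
        ultimately have "norm (r *\<^sub>R mean_slope u r z - 0 - r *\<^sub>R ((2 * pi - 0) *\<^sub>R u' z 1)) \<le> (1 + K) * (\<epsilon> * r) * measure lborel (cbox 0 (2*pi))"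
          using r \<epsilon> K1 by (intro has_integral_bound) auto
        then have "norm (r *\<^sub>R (mean_slope u r z - (2 * pi) *\<^sub>R u' z 1)) \<le> r * (2 * pi * ((1 + K) * \<epsilon>))"
          by (simp add: scaleR_diff_right algebra_simps)
        then have "r * norm (mean_slope u r z - (2 * pi) *\<^sub>R u' z 1) \<le> r * (2 * pi * ((1 + K) * \<epsilon>))" using r by simp
        then have "norm (mean_slope u r z - (2 * pi) *\<^sub>R u' z 1) \<le> 2 * pi * ((1 + K) * \<epsilon>)" using r by (simp only: mult_le_cancel_left_pos)
        then show ?thesis using \<epsilon>(2) by (simp add: dist_norm r_def)
      qed
      then show "\<exists>M. \<forall>n\<ge>M. dist (mean_slope u (rad n) z) ((2 * pi) *\<^sub>R u' z 1) < e" by blast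
    qed
  qed
  define P where "P = (\<lambda>z. L z /\<^sub>R (2 * pi))"
  have Pc: "continuous_on H P" unfolding P_def by (intro continuous_intros Lc)
  have PG: "u' z 1 = P z" if "z \<in> H" "z \<in> G" for z using LG[OF that] by (simp add: P_def)
  have uH: "continuous_on H u" using uc HB by (rule continuous_on_subset)
  have JPc: "continuous_on H (\<lambda>z. J (u z) (P z))"
    by (rule continuous_on_J[OF uH _ Pc]) (use uS HB in auto)
  have der: "(u has_derivative (\<lambda>h. Re h *\<^sub>R P c + Im h *\<^sub>R J (u c) (P c))) (at c)" if c: "c \<in> H" for c
  proof -
    define A where "A = (\<lambda>h. Re h *\<^sub>R P c + Im h *\<^sub>R J (u c) (P c))"
    have blA: "bounded_linear A" unfolding A_def
      by (intro bounded_linear_add bounded_linear_compose[OF bounded_linear_scaleR_left] bounded_linear_Re bounded_linear_Im)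
    show ?thesis unfolding A_def[symmetric] has_derivative_at_alt
    proof (intro conjI blA allI impI)
      fix e :: real assume e: "e > 0"
      \<comment> \<open>A half circle is \<open>pi / 2\<close> times as long as its diameter, and \<open>pi / 4 < 1\<close>.\<close>
      define \<epsilon> where "\<epsilon> = e / 2"
      have \<epsilon>: "\<epsilon> > 0" using e by (simp add: \<epsilon>_def)
      obtain d0 where d0: "d0 > 0" "ball c d0 \<subseteq> H" using c openE[of H c] by (auto simp: H_def)
      obtain d1 where d1: "d1 > 0" "\<And>z. z \<in> H \<Longrightarrow> dist z c < d1 \<Longrightarrow> dist (P z) (P c) < \<epsilon>/2"
        using Pc c \<epsilon> unfolding continuous_on_iff by (meson half_gt_zero)
      obtain d2 where d2: "d2 > 0" "\<And>z. z \<in> H \<Longrightarrow> dist z c < d2 \<Longrightarrow> dist (J (u z) (P z)) (J (u c) (P c)) < \<epsilon>/2"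
        using JPc c \<epsilon> unfolding continuous_on_iff by (meson half_gt_zero)
      define d where "d = min d0 (min d1 d2)"
      have d: "d > 0" "ball c d \<subseteq> H" using d0 d1 d2 by (auto simp: d_def)
      have near: "norm (u' z h - A h) \<le> \<epsilon> * norm h" if z: "z \<in> ball c d" "z \<in> G" for z h
      proof -
        have zH: "z \<in> H" using z d by auto
        have "u' z h = Re h *\<^sub>R P z + Im h *\<^sub>R J (u z) (P z)"
          using complex_linear_decompose[OF has_derivative_linear[OF deriv[OF z(2)]], of h] hol[OF z(2)] PG[OF zH z(2)] by simp
        then have "u' z h - A h = Re h *\<^sub>R (P z - P c) + Im h *\<^sub>R (J (u z) (P z) - J (u c) (P c))"
          by (simp add: A_def algebra_simps)
        also have "norm \<dots> \<le> \<bar>Re h\<bar> * norm (P z - P c) + \<bar>Im h\<bar> * norm (J (u z) (P z) - J (u c) (P c))"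
          by (rule order_trans[OF norm_triangle_ineq]) simp
        also have "\<dots> \<le> norm h * (\<epsilon>/2) + norm h * (\<epsilon>/2)"
          using d1(2)[OF zH] d2(2)[OF zH] z abs_Re_le_cmod[of h] abs_Im_le_cmod[of h]
          by (intro add_mono mult_mono) (auto simp: d_def dist_norm norm_minus_commute)
        finally show ?thesis by (simp add: mult.commute)
      qed
      define v where "v = (\<lambda>z. u z - A z)"
      obtain BA where BA: "BA > 0" "\<And>h. norm (A h) \<le> norm h * BA" using bounded_linear.pos_bounded[OF blA] by blast
      have vlip: "norm (v z - v w) \<le> (C + BA) * norm (z - w)" if "z \<in> ball p \<rho>" "w \<in> ball p \<rho>" for z w
      proof -
        have "v z - v w = (u z - u w) - A (z - w)" by (simp add: v_def bounded_linear.linear[OF blA] linear_diff)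
        then have "norm (v z - v w) \<le> norm (u z - u w) + norm (A (z - w))" by (metis norm_triangle_ineq4)
        then show ?thesis using lip[OF that] BA(2)[of "z - w"] by (simp add: algebra_simps)
      qed
      have vd: "(v has_derivative (\<lambda>h. u' z h - A h)) (at z)" if "z \<in> G" for z
        unfolding v_def by (intro has_derivative_diff deriv that bounded_linear_imp_has_derivative blA)
      \<comment> \<open>On a half circle around a point of \<open>F\<close> the derivative of \<open>v\<close> exists almost everywhere and
          is small, which bounds the difference of \<open>v\<close> at antipodal points.\<close>
      have arc: "norm (v (z - k) - v (z + k)) \<le> \<epsilon> * pi * norm k"
        if z: "z \<in> F" "norm k < d/2" "z \<in> ball c (d/2)" "k = of_real (norm k) * cis t" "t \<in> {0..pi}" for z k t
      proof (cases "k = 0")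
        case False
        define r where "r = norm k"
        have r: "r > 0" using False by (simp add: r_def)
        have sub: "cball z r \<subseteq> ball c d" using z by (auto simp: r_def cball_subset_ball_iff dist_commute)
        have sub': "cball z r \<subseteq> ball p \<rho>" using sub d HB by blast
        define N where "N = {t\<in>{0..2*pi}. z + of_real r * cis t \<notin> G}"
        have "norm (v (z + of_real r * cis (t + pi)) - v (z + of_real r * cis t)) \<le> (\<epsilon> * r) * ((t + pi) - t)"
        proof (rule lipschitz_mean_value_inequality[where G = "\<lambda>s. v (z + of_real r * cis s)" and L = "(C + BA) * r" and N = N
              and g = "\<lambda>s. r *\<^sub>R (u' (z + of_real r * cis s) (\<i> * cis s) - A (\<i> * cis s))"])
          show "norm (v (z + of_real r * cis s) - v (z + of_real r * cis s')) \<le> (C + BA) * r * \<bar>s - s'\<bar>" for s s'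
            by (rule circle_lipschitz[OF vlip sub']) (use r C BA in auto)
          show "negligible N" unfolding N_def by (rule null[OF z(1) r sub'])
          fix s assume "s \<in> {t..t + pi} - N"
          then have sG: "z + of_real r * cis s \<in> G" using z(5) by (auto simp: N_def)
          show "((\<lambda>s. v (z + of_real r * cis s)) has_vector_derivative r *\<^sub>R (u' (z + of_real r * cis s) (\<i> * cis s) - A (\<i> * cis s))) (at s)"
            by (rule circle_has_vector_derivative[OF vd[OF sG]])
          have "z + of_real r * cis s \<in> ball c d" using r by (intro subsetD[OF sub]) (simp add: dist_norm norm_mult)
          from near[OF this sG, of "\<i> * cis s"]
          show "norm (r *\<^sub>R (u' (z + of_real r * cis s) (\<i> * cis s) - A (\<i> * cis s))) \<le> \<epsilon> * r"
            using r by (simp add: norm_mult mult.commute)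
        qed (use r \<epsilon> in auto)
        moreover have "of_real r * cis (t + pi) = - k" using z(4) by (simp add: r_def cis_mult[symmetric])
        moreover have "of_real r * cis t = k" using z(4) by (simp add: r_def)
        ultimately show ?thesis by (simp add: r_def mult.commute mult.left_commute)
      qed simp
      have arc2: "norm (v (z - k) - v (z + k)) \<le> \<epsilon> * pi * norm k"
        if z: "z \<in> F" "norm k < d/2" "z \<in> ball c (d/2)" for z k
      proof -
        obtain t where t: "t \<in> {0..2*pi}" "k = of_real (norm k) * cis t" by (rule complex_polar_Icc)
        show ?thesis
        proof (cases "t \<le> pi")
          case True
          then show ?thesis using arc[OF z t(2)] t by auto
        next
          case False
          have a: "- k = of_real (norm (- k)) * cis (t - pi)"
            using t(2) by (simp add: cis_divide[symmetric])
          have b: "t - pi \<in> {0..pi}" using t False by auto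
          have "norm (v (z - (- k)) - v (z + (- k))) \<le> \<epsilon> * pi * norm (- k)"
            by (rule arc[OF z(1) _ z(3) a b]) (use z in simp)
          then show ?thesis by (simp add: norm_minus_commute)
        qed
      qed
      have arc3: "norm (v (z - k) - v (z + k)) \<le> \<epsilon> * pi * norm k" if k: "norm k < d/2" and z: "z \<in> ball c (d/2)" for z k
      proof (rule le_on_dense_subset[of "ball c (d/2)" _ _ F z])
        have vc: "continuous_on (ball p \<rho>) v" unfolding v_def
          by (intro continuous_intros uc linear_continuous_on blA)
        have in1: "w + s \<in> ball p \<rho>" if "w \<in> ball c (d/2)" "norm s < d/2" for w s
        proof -
          have "dist c (w + s) \<le> dist c w + dist w (w + s)" by (rule dist_triangle)
          then have "w + s \<in> ball c d" using that by (simp add: dist_norm)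
          then show ?thesis using d HB by blast
        qed
        show "continuous_on (ball c (d/2)) (\<lambda>z. norm (v (z - k) - v (z + k)))"
          by (intro continuous_intros continuous_on_compose2[OF vc])
             (use in1[of _ k] in1[of _ "- k"] k in auto)
        show "\<exists>z\<in>U \<inter> ball c (d/2). z \<in> F" if "open U" "q \<in> U" "q \<in> ball c (d/2)" for U q
        proof -
          have "q \<in> H" using that d by (auto intro!: subsetD[OF d(2)])
          then show ?thesis using denseH[of "U \<inter> ball c (d/2)" q] that by auto
        qed
      qed (use arc2 k z in auto)
      show "\<exists>d>0. \<forall>y. norm (y - c) < d \<longrightarrow> norm (u y - u c - A (y - c)) \<le> e * norm (y - c)"
      proof (intro exI[of _ "d/2"] conjI allI impI)
        fix y assume y: "norm (y - c) < d/2"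
        define k where "k = (y - c) /\<^sub>R 2"
        have nk: "norm k = norm (y - c) / 2" by (simp add: k_def)
        have "dist c (c + k) = norm k" by (simp add: dist_norm)
        then have "norm (v ((c + k) - k) - v ((c + k) + k)) \<le> \<epsilon> * pi * norm k"
          using y nk norm_ge_zero[of "y - c"] d(1) by (intro arc3) auto
        moreover have "(c + k) + k = y" by (simp add: k_def complex_eq_iff field_simps)
        ultimately have "norm (v y - v c) \<le> \<epsilon> * pi * (norm (y - c) / 2)" by (simp add: nk norm_minus_commute)
        also have "\<dots> = (pi / 4) * (e * norm (y - c))" by (simp add: \<epsilon>_def)
        also have "\<dots> \<le> 1 * (e * norm (y - c))" using e pi_less_4 by (intro mult_right_mono) auto
        finally show "norm (u y - u c - A (y - c)) \<le> e * norm (y - c)"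
          by (simp add: v_def linear_diff[OF bounded_linear.linear[OF blA]] algebra_simps)
      qed (use d in auto)
    qed
  qed
  show ?thesis using Pc der unfolding H_def by blast
qed

text \<open>The Schwarz lemma gives a uniform Lipschitz bound at pairs of points where \<open>lam\<close> is finite, and
  density extends it to all pairs.\<close>

lemma removable_polar_set_local:
  fixes u :: "complex \<Rightarrow> 'e"
  assumes lam: "subharmonic_on V lam" and R: "R > 0" "ball p R \<subseteq> V"
    and nontriv: "\<not> (\<forall>\<^sub>F w in nhds p. lam w = -\<infinity>)"
    and uc: "continuous_on (ball p R) u" and uS: "\<And>z. z \<in> ball p R \<Longrightarrow> u z \<in> S"
    and G: "open G" "G \<subseteq> ball p R" "\<And>z. z \<in> ball p R \<Longrightarrow> lam z \<noteq> -\<infinity> \<Longrightarrow> z \<in> G"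
    and deriv: "\<And>z. z \<in> G \<Longrightarrow> (u has_derivative u' z) (at z)"
    and cont: "\<And>h. continuous_on G (\<lambda>z. u' z h)"
    and hol: "\<And>z. z \<in> G \<Longrightarrow> u' z \<i> = J (u z) (u' z 1)"
    and small: "\<And>z w. z \<in> ball p R \<Longrightarrow> w \<in> ball p R \<Longrightarrow> (1 + K) * norm (u z - u w) \<le> 1 / (46 * \<kappa>)"
  shows "\<exists>P. continuous_on (ball p (R/12)) P \<and>
     (\<forall>z\<in>ball p (R/12). (u has_derivative (\<lambda>h. Re h *\<^sub>R P z + Im h *\<^sub>R J (u z) (P z))) (at z))"
proof -
  define F where "F = {z. lam z \<noteq> -\<infinity>}"
  \<comment> \<open>Two points of \<open>D\<close> are less than \<open>R/3\<close> apart, and a disc of radius \<open>R/3\<close> around a point of \<open>D\<close>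
      stays in \<open>ball p R\<close>.\<close>
  define D where "D = ball p (R/6)"
  define s where "s = 1 / (46 * \<kappa>)"
  define C where "C = s * exp (52 * \<kappa> * s) / (R/3)"
  have s0: "s > 0" using \<kappa>_pos by (simp add: s_def)
  have C0: "C \<ge> 0" using s0 R by (simp add: C_def)
  have DR: "D \<subseteq> ball p R" using R by (auto simp: D_def)
  have dense: "\<exists>z\<in>U \<inter> D. z \<in> F" if U: "open U" "q \<in> U" "q \<in> D" for U q
  proof -
    have "ball p (R/2) \<subseteq> V" using R by (auto simp: subset_iff)
    then obtain z where "z \<in> U" "z \<in> ball p (R/2/3)" "lam z \<noteq> -\<infinity>"
      using subharmonic_finite_dense[OF lam _ nontriv U(1,2), of "R/2"] U(3) unfolding D_def by auto
    then show ?thesis unfolding D_def F_def by auto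
  qed
  have ucD: "continuous_on D u" using uc DR by (rule continuous_on_subset)
  have lip1: "norm (u z - u w) \<le> C * norm (z - w)" if z: "z \<in> D" "z \<in> F" and w: "w \<in> D" "w \<in> F" for z w
  proof -
    have sub: "cball w (R/3) \<subseteq> ball p R" using w R by (auto simp: D_def cball_subset_ball_iff dist_commute)
    have wG: "w \<in> G" using w DR G(3) by (auto simp: F_def)
    have zw: "z \<in> cball w (R/3)"
      using z w dist_triangle[of w z p] by (auto simp: D_def dist_commute)
    show ?thesis unfolding C_def
    proof (rule schwarz_lemma[OF lam _ _ _ G(1) _ wG deriv cont _ hol])
      show "cball w (R/3) \<subseteq> V" using sub R by blast
      show "continuous_on (cball w (R/3)) u" using uc sub by (rule continuous_on_subset)
      show "x \<in> G" if "x \<in> cball w (R/3)" "lam x \<noteq> -\<infinity>" for x using G(3) sub that by blast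
      show "u x \<in> S" if "x \<in> G" for x using uS G(2) that by blast
      show "norm (hermitian (u w) (u x - u w)) \<le> s" if "x \<in> cball w (R/3)" for x
        using norm_hermitian_le[OF uS, of w "u x - u w"] small[of x w] sub that w DR unfolding s_def
        by (meson order_trans subsetD)
      show "s \<le> 1 / (46 * \<kappa>)" by (simp add: s_def)
      show "lam z \<noteq> -\<infinity>" using z by (simp add: F_def)
    qed (use R s0 zw in auto)
  qed
  have lip2: "norm (u z - u w) \<le> C * norm (z - w)" if "z \<in> D" "w \<in> D" "w \<in> F" for z w
    by (rule le_on_dense_subset[of D "\<lambda>z. norm (u z - u w)" "\<lambda>z. C * norm (z - w)" F, OF _ _ _ dense])
       (use that lip1 in \<open>auto intro!: continuous_intros ucD simp: D_def[symmetric]\<close>, simp add: D_def)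
  have lip: "norm (u z - u w) \<le> C * norm (z - w)" if "z \<in> D" "w \<in> D" for z w
    by (rule le_on_dense_subset[of D "\<lambda>w. norm (u z - u w)" "\<lambda>w. C * norm (z - w)" F, OF _ _ _ dense])
       (use that lip2 in \<open>auto intro!: continuous_intros ucD simp: D_def[symmetric]\<close>, simp add: D_def)
  have null: "negligible {t\<in>{0..2*pi}. z + of_real r * cis t \<notin> G}" if z: "z \<in> F" "0 < r" "cball z r \<subseteq> ball p (R/6)" for z r
  proof (rule negligible_subset[OF subharmonic_circle_negligible[OF lam z(2)]])
    have sub: "cball z r \<subseteq> ball p R" using z DR by (auto simp: D_def)
    then show "cball z r \<subseteq> V" using R by blast
    show "lam z \<noteq> -\<infinity>" using z by (simp add: F_def)
    have "z + of_real r * cis t \<in> ball p R" for t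
      using z(2) by (intro subsetD[OF sub]) (simp add: dist_norm norm_mult)
    then show "{t\<in>{0..2*pi}. z + of_real r * cis t \<notin> G} \<subseteq> {t\<in>{0..2*pi}. lam (z + of_real r * cis t) = -\<infinity>}"
      using G(3) by blast
  qed
  show ?thesis
    using lipschitz_imp_continuously_differentiable[of "R/6" p u C G u' F] R lip C0 uS DR deriv hol dense null
    unfolding D_def by (simp add: subset_iff)
qed

end

section \<open>Maps into almost complex manifolds\<close>

lemma Ck_on_1_iff:
  "Ck_on 1 S f \<longleftrightarrow> (\<exists>f'. (\<forall>x\<in>S. (f has_derivative f' x) (at x)) \<and> (\<forall>h. continuous_on S (\<lambda>x. f' x h)))"
  by (simp only: One_nat_def Ck_on.simps)

lemma Ck_on_1_bounded_lipschitz: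
  fixes f :: "'a::euclidean_space \<Rightarrow> 'b::euclidean_space"
  assumes f: "Ck_on 1 S f" and sub: "cball y \<sigma> \<subseteq> S"
  obtains M where "M \<ge> 0" "\<And>x. x \<in> cball y \<sigma> \<Longrightarrow> norm (f x) \<le> M"
    "\<And>x z. x \<in> cball y \<sigma> \<Longrightarrow> z \<in> cball y \<sigma> \<Longrightarrow> norm (f x - f z) \<le> M * norm (x - z)"
proof -
  obtain f' where f': "\<And>x. x \<in> S \<Longrightarrow> (f has_derivative f' x) (at x)" "\<And>h. continuous_on S (\<lambda>x. f' x h)"
    using f unfolding Ck_on_1_iff by blast
  have bd: "\<exists>M. \<forall>x\<in>cball y \<sigma>. norm (g x) \<le> M" if "continuous_on S g" for g :: "'a \<Rightarrow> 'b"
  proof -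
    have "compact (g ` cball y \<sigma>)"
      using that sub by (intro compact_continuous_image) (auto intro: continuous_on_subset)
    then show ?thesis using compact_imp_bounded bounded_iff by (metis imageI)
  qed
  have "continuous_on S f" using f'(1) by (meson continuous_at_imp_continuous_on has_derivative_continuous)
  then obtain M0 where M0: "\<And>x. x \<in> cball y \<sigma> \<Longrightarrow> norm (f x) \<le> M0" using bd by blast
  obtain m where m: "\<And>h x. x \<in> cball y \<sigma> \<Longrightarrow> norm (f' x h) \<le> m h" using bd[OF f'(2)] by metis
  define M where "M = \<bar>M0\<bar> + (\<Sum>b\<in>Basis. \<bar>m b\<bar>)"
  have on: "onorm (f' x) \<le> (\<Sum>b\<in>Basis. \<bar>m b\<bar>)" if x: "x \<in> cball y \<sigma>" for x
  proof (rule onorm_le)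
    fix h :: 'a
    have l: "linear (f' x)" using f'(1) x sub has_derivative_linear by blast
    have "f' x h = f' x (\<Sum>b\<in>Basis. (h \<bullet> b) *\<^sub>R b)" by (simp add: euclidean_representation)
    also have "\<dots> = (\<Sum>b\<in>Basis. (h \<bullet> b) *\<^sub>R f' x b)" by (simp add: linear_sum[OF l] linear_scale[OF l])
    also have "norm \<dots> \<le> (\<Sum>b\<in>Basis. \<bar>m b\<bar> * norm h)"
    proof (rule sum_norm_le)
      fix b :: 'a assume b: "b \<in> Basis"
      have "\<bar>h \<bullet> b\<bar> * norm (f' x b) \<le> norm h * \<bar>m b\<bar>"
        using m[OF x, of b] Basis_le_norm[OF b, of h] by (intro mult_mono) auto
      then show "norm ((h \<bullet> b) *\<^sub>R f' x b) \<le> \<bar>m b\<bar> * norm h" by (simp add: mult.commute)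
    qed
    finally show "norm (f' x h) \<le> (\<Sum>b\<in>Basis. \<bar>m b\<bar>) * norm h" by (simp add: sum_distrib_right)
  qed
  show ?thesis
  proof (rule that[of M])
    have s0: "(\<Sum>b\<in>(Basis :: 'a set). \<bar>m b\<bar>) \<ge> 0" by (intro sum_nonneg) auto
    then show "M \<ge> 0" by (simp add: M_def)
    show "norm (f x) \<le> M" if "x \<in> cball y \<sigma>" for x
      using M0[OF that] s0 abs_ge_self[of M0] unfolding M_def by linarith
    show "norm (f x - f z) \<le> M * norm (x - z)" if xz: "x \<in> cball y \<sigma>" "z \<in> cball y \<sigma>" for x z
    proof (rule differentiable_bound[OF convex_cball[of y \<sigma>] _ _ xz])
      show "(f has_derivative f' x) (at x within cball y \<sigma>)" if "x \<in> cball y \<sigma>" for x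
        using f'(1) sub that by (blast intro: has_derivative_at_withinI)
      show "onorm (f' x) \<le> M" if "x \<in> cball y \<sigma>" for x using on[OF that] abs_ge_zero[of M0] unfolding M_def by linarith
    qed
  qed
qed

text \<open>The partial derivatives of the columns are bounded on a compact ball, and summing over the
  basis passes from the columns to the matrix.\<close>

lemma C1_structure_locally_lipschitz:
  fixes J :: "'e::euclidean_space \<Rightarrow> 'e \<Rightarrow> 'e"
  assumes S: "open S" "y \<in> S" and lin: "\<And>x. x \<in> S \<Longrightarrow> linear (J x)"
    and sq: "\<And>x h. x \<in> S \<Longrightarrow> J x (J x h) = - h"
    and C1: "\<And>h. Ck_on 1 S (\<lambda>x. J x h)"
  obtains \<sigma> K where "\<sigma> > 0" "ball y \<sigma> \<subseteq> S" "lipschitz_structure (ball y \<sigma>) J K"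
proof -
  obtain \<sigma> where \<sigma>: "\<sigma> > 0" "cball y \<sigma> \<subseteq> S" using S open_contains_cball by blast
  have "\<exists>M. M \<ge> 0 \<and> (\<forall>x\<in>cball y \<sigma>. norm (J x h) \<le> M) \<and>
    (\<forall>x\<in>cball y \<sigma>. \<forall>z\<in>cball y \<sigma>. norm (J x h - J z h) \<le> M * norm (x - z))" for h
    using Ck_on_1_bounded_lipschitz[OF C1[of h] \<sigma>(2)] by metis
  then obtain M where M: "\<And>h. M h \<ge> 0" "\<And>h x. x \<in> cball y \<sigma> \<Longrightarrow> norm (J x h) \<le> M h"
    "\<And>h x z. x \<in> cball y \<sigma> \<Longrightarrow> z \<in> cball y \<sigma> \<Longrightarrow> norm (J x h - J z h) \<le> M h * norm (x - z)" by metis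
  define K where "K = 1 + (\<Sum>b\<in>Basis. M b)"
  have s0: "(\<Sum>b\<in>(Basis :: 'e set). M b) \<ge> 0" using M(1) by (intro sum_nonneg) auto
  have rep: "J x h = (\<Sum>b\<in>Basis. (h \<bullet> b) *\<^sub>R J x b)" if "x \<in> cball y \<sigma>" for x h
  proof -
    have l: "linear (J x)" using lin that \<sigma> by blast
    have "J x h = J x (\<Sum>b\<in>Basis. (h \<bullet> b) *\<^sub>R b)" by (simp add: euclidean_representation)
    then show ?thesis by (simp add: linear_sum[OF l] linear_scale[OF l])
  qed
  have bound: "norm (J x h) \<le> K * norm h" if xc: "x \<in> cball y \<sigma>" for x h
  proof -
    have "norm (J x h) \<le> (\<Sum>b\<in>Basis. M b * norm h)"
      unfolding rep[OF xc, of h]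
    proof (rule sum_norm_le)
      fix b :: 'e assume b: "b \<in> Basis"
      have "\<bar>h \<bullet> b\<bar> * norm (J x b) \<le> norm h * M b"
        using M(2)[OF xc, of b] Basis_le_norm[OF b, of h] by (intro mult_mono) auto
      then show "norm ((h \<bullet> b) *\<^sub>R J x b) \<le> M b * norm h" by (simp add: mult.commute)
    qed
    also have "\<dots> = (\<Sum>b\<in>Basis. M b) * norm h" by (simp add: sum_distrib_right)
    also have "\<dots> \<le> K * norm h" by (intro mult_right_mono) (auto simp: K_def)
    finally show ?thesis .
  qed
  have lip: "norm (J x h - J z h) \<le> K * norm (x - z) * norm h" if xc: "x \<in> cball y \<sigma>" and zc: "z \<in> cball y \<sigma>" for x z h
  proof -
    have "J x h - J z h = (\<Sum>b\<in>Basis. (h \<bullet> b) *\<^sub>R (J x b - J z b))"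
      unfolding rep[OF xc, of h] rep[OF zc, of h] by (simp add: sum_subtractf scaleR_diff_right)
    also have "norm \<dots> \<le> (\<Sum>b\<in>Basis. M b * (norm (x - z) * norm h))"
    proof (rule sum_norm_le)
      fix b :: 'e assume b: "b \<in> Basis"
      have "\<bar>h \<bullet> b\<bar> * norm (J x b - J z b) \<le> norm h * (M b * norm (x - z))"
        using M(3)[OF xc zc, of b] Basis_le_norm[OF b, of h] by (intro mult_mono) auto
      then show "norm ((h \<bullet> b) *\<^sub>R (J x b - J z b)) \<le> M b * (norm (x - z) * norm h)" by (simp add: mult.assoc mult.left_commute mult.commute)
    qed
    also have "\<dots> = (\<Sum>b\<in>Basis. M b) * (norm (x - z) * norm h)" by (simp add: sum_distrib_right)
    also have "\<dots> \<le> K * (norm (x - z) * norm h)" by (intro mult_right_mono) (auto simp: K_def)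
    finally show ?thesis by (simp add: mult.assoc)
  qed
  have cb: "x \<in> cball y \<sigma>" "x \<in> S" if "x \<in> ball y \<sigma>" for x using that \<sigma>(2) by auto
  have "lipschitz_structure (ball y \<sigma>) J K"
    using lin sq bound lip cb s0 by (intro lipschitz_structure.intro) (auto simp: K_def)
  then show ?thesis using that[of \<sigma> K] \<sigma> by (meson ball_subset_cball order_trans)
qed

context
  fixes X :: "'m topology" and A :: "('m, 'e::euclidean_space) chart set"
  assumes man: "smooth_manifold X A"
begin

lemma chart_props:
  assumes c: "c \<in> A"
  shows "openin X (fst c)" "open (snd c ` fst c)" "inj_on (snd c) (fst c)"
    "homeomorphic_map (subtopology X (fst c)) (top_of_set (snd c ` fst c)) (snd c)"
    "\<And>q. q \<in> fst c \<Longrightarrow> chart_inv c (snd c q) = q"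
proof -
  have ch: "is_chart X c" using man c by (auto simp: smooth_manifold_def)
  then show 1: "openin X (fst c)" "open (snd c ` fst c)"
    "homeomorphic_map (subtopology X (fst c)) (top_of_set (snd c ` fst c)) (snd c)"
    by (auto simp: is_chart_def)
  have "topspace (subtopology X (fst c)) = fst c"
    using openin_subset[OF 1(1)] by auto
  then show inj: "inj_on (snd c) (fst c)" using homeomorphic_imp_injective_map[OF 1(3)] by simp
  show "chart_inv c (snd c q) = q" if "q \<in> fst c" for q
    unfolding chart_inv_def using inj that by (rule inv_into_f_f)
qed

lemma chart_image_open:
  assumes c: "c \<in> A" and T: "openin X T" "T \<subseteq> fst c"
  shows "open (snd c ` T)"
proof -
  have "openin (subtopology X (fst c)) T" using T by (simp add: openin_subtopology_alt) blast
  then have "openin (top_of_set (snd c ` fst c)) (snd c ` T)"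
    using homeomorphic_imp_open_map[OF chart_props(4)[OF c]] unfolding open_map_def by blast
  then show ?thesis using chart_props(2)[OF c] openin_open_trans by blast
qed

lemma transition_apply: "c \<in> A \<Longrightarrow> q \<in> fst c \<Longrightarrow> transition c d (snd c q) = snd d q"
  by (simp add: transition_def chart_props(5))

lemma transition_has_derivative:
  assumes "c \<in> A" "d \<in> A" "q \<in> fst c" "q \<in> fst d"
  shows "(transition c d has_derivative frechet_derivative (transition c d) (at (snd c q))) (at (snd c q))"
proof -
  have "Ck_on 1 (snd c ` (fst c \<inter> fst d)) (transition c d)"
    using man assms unfolding smooth_manifold_def smooth_on_def by blast
  then have "transition c d differentiable (at (snd c q))"
    unfolding Ck_on_1_iff differentiable_def using assms by blast
  then show ?thesis by (simp add: frechet_derivative_works)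
qed

lemma transition_derivative_compose:
  assumes c: "c \<in> A" "q \<in> fst c" and d: "d \<in> A" "q \<in> fst d" and e: "e \<in> A" "q \<in> fst e"
  shows "frechet_derivative (transition d e) (at (snd d q)) (frechet_derivative (transition c d) (at (snd c q)) h)
    = frechet_derivative (transition c e) (at (snd c q)) h"
proof -
  let ?T = "fst c \<inter> fst d \<inter> fst e"
  have T: "open (snd c ` ?T)"
    using c d e by (intro chart_image_open openin_Int chart_props(1)) auto
  have "(transition d e \<circ> transition c d has_derivative
      frechet_derivative (transition d e) (at (snd d q)) \<circ> frechet_derivative (transition c d) (at (snd c q))) (at (snd c q))"
    using transition_has_derivative[OF c(1) d(1) c(2) d(2)] transition_has_derivative[OF d(1) e(1) d(2) e(2)]
    by (intro diff_chain_at) (auto simp: transition_apply[OF c])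
  then have "(transition c e has_derivative
      frechet_derivative (transition d e) (at (snd d q)) \<circ> frechet_derivative (transition c d) (at (snd c q))) (at (snd c q))"
  proof (rule has_derivative_transform_within_open[OF _ T])
    show "snd c q \<in> snd c ` ?T" using c d e by auto
    show "(transition d e \<circ> transition c d) x = transition c e x" if "x \<in> snd c ` ?T" for x
      using that c(1) d(1) by (auto simp: transition_apply)
  qed
  then have "frechet_derivative (transition d e) (at (snd d q)) \<circ> frechet_derivative (transition c d) (at (snd c q))
      = frechet_derivative (transition c e) (at (snd c q))"
    by (rule frechet_derivative_at)
  then show ?thesis by (metis comp_apply)
qed

lemma transition_self_derivative:
  assumes c: "c \<in> A" "q \<in> fst c"
  shows "frechet_derivative (transition c c) (at (snd c q)) h = h"
proof -
  have "((\<lambda>x. x) has_derivative (\<lambda>h. h)) (at (snd c q))" by (rule has_derivative_ident)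
  then have "(transition c c has_derivative (\<lambda>h. h)) (at (snd c q))"
    by (rule has_derivative_transform_within_open[OF _ chart_props(2)[OF c(1)]])
       (use c in \<open>auto simp: transition_apply\<close>)
  then have "(\<lambda>h. h) = frechet_derivative (transition c c) (at (snd c q))" by (rule frechet_derivative_at)
  then show ?thesis by metis
qed

lemma tangent_of_coord_in_tangent_space:
  assumes c: "c \<in> A" "q \<in> fst c"
  shows "tangent_of_coord A c q h \<in> tangent_space A q"
proof -
  let ?t = "tangent_of_coord A c q h"
  have "?t d' = frechet_derivative (transition d d') (at (snd d q)) (?t d)"
    if "d \<in> charts_at A q" "d' \<in> charts_at A q" for d d'
  proof -
    have "d \<in> A" "q \<in> fst d" "d' \<in> A" "q \<in> fst d'" using that by (simp_all add: charts_at_def)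
    from transition_derivative_compose[OF c this, of h] that show ?thesis
      by (simp only: tangent_of_coord_def if_True)
  qed
  moreover have "?t d = 0" if "d \<notin> charts_at A q" for d
    using that by (simp only: tangent_of_coord_def if_False)
  ultimately show ?thesis unfolding tangent_space_def by blast
qed

lemma tangent_of_coord_self: "c \<in> A \<Longrightarrow> q \<in> fst c \<Longrightarrow> tangent_of_coord A c q h c = h"
  by (simp add: tangent_of_coord_def charts_at_def transition_self_derivative)

lemma tangent_space_coord:
  assumes c: "c \<in> A" "q \<in> fst c" and v: "v \<in> tangent_space A q"
  shows "tangent_of_coord A c q (v c) = v"
proof
  fix d
  have cq: "c \<in> charts_at A q" using c by (simp add: charts_at_def)
  show "tangent_of_coord A c q (v c) d = v d"
  proof (cases "d \<in> charts_at A q")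
    case True
    then have "v d = frechet_derivative (transition c d) (at (snd c q)) (v c)"
      using v cq unfolding tangent_space_def by blast
    then show ?thesis using True by (simp only: tangent_of_coord_def if_True)
  next
    case False
    then have "v d = 0" using v unfolding tangent_space_def by blast
    then show ?thesis using False by (simp only: tangent_of_coord_def if_False)
  qed
qed

lemma linear_tangent_of_coord:
  assumes c: "c \<in> A" "q \<in> fst c"
  shows "tangent_of_coord A c q (a *\<^sub>R h + b *\<^sub>R k) = (\<lambda>d. a *\<^sub>R tangent_of_coord A c q h d + b *\<^sub>R tangent_of_coord A c q k d)"
proof
  fix d
  show "tangent_of_coord A c q (a *\<^sub>R h + b *\<^sub>R k) d = a *\<^sub>R tangent_of_coord A c q h d + b *\<^sub>R tangent_of_coord A c q k d"
  proof (cases "d \<in> charts_at A q")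
    case True
    then have "linear (frechet_derivative (transition c d) (at (snd c q)))"
      using has_derivative_linear[OF transition_has_derivative[OF c(1) _ c(2)]] by (auto simp: charts_at_def)
    then show ?thesis using True by (simp add: tangent_of_coord_def linear_add linear_scale)
  qed (simp add: tangent_of_coord_def)
qed

definition coord_J :: "('m \<Rightarrow> ('m, 'e) tangent_vec \<Rightarrow> ('m, 'e) tangent_vec) \<Rightarrow> ('m, 'e) chart \<Rightarrow> 'e \<Rightarrow> 'e \<Rightarrow> 'e" where
  "coord_J J c x h = J (chart_inv c x) (tangent_of_coord A c (chart_inv c x) h) c"

text \<open>Near \<open>z\<close> the expression of \<open>w\<close> in another chart is its expression in \<open>c\<close> followed by a
  transition map, so the derivative in the single chart \<open>c\<close> determines all coordinates.\<close>

lemma partial_deriv_eq_tangent_of_coord: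
  assumes c: "c \<in> A" "w z \<in> fst c" and W: "open W" "z \<in> W" "continuous_map (top_of_set W) X w"
    and d: "((\<lambda>z. snd c (w z)) has_derivative f') (at z)"
  shows "partial_deriv A w h z = tangent_of_coord A c (w z) (f' h)"
proof
  fix d
  show "partial_deriv A w h z d = tangent_of_coord A c (w z) (f' h) d"
  proof (cases "d \<in> charts_at A (w z)")
    case True
    then have dA: "d \<in> A" "w z \<in> fst d" by (auto simp: charts_at_def)
    let ?D = "frechet_derivative (transition c d) (at (snd c (w z)))"
    have "openin (top_of_set W) {x \<in> topspace (top_of_set W). w x \<in> fst c \<inter> fst d}"
      using chart_props(1)[OF c(1)] chart_props(1)[OF dA(1)] by (intro openin_continuous_map_preimage[OF W(3)]) auto
    then have op: "open {x \<in> W. w x \<in> fst c \<inter> fst d}" using W(1) openin_open_trans by fastforce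
    have "(transition c d \<circ> (\<lambda>z. snd c (w z)) has_derivative ?D \<circ> f') (at z)"
      by (intro diff_chain_at d transition_has_derivative c dA)
    then have der: "((\<lambda>z. snd d (w z)) has_derivative ?D \<circ> f') (at z)"
      by (rule has_derivative_transform_within_open[OF _ op])
         (use c dA W in \<open>auto simp: transition_apply\<close>)
    have "((\<lambda>t. z + t *\<^sub>R h) has_derivative (\<lambda>t. t *\<^sub>R h)) (at 0)" by (auto intro!: derivative_eq_intros)
    moreover have "((\<lambda>z. snd d (w z)) has_derivative ?D \<circ> f') (at (z + 0 *\<^sub>R h))" using der by simp
    ultimately have "((\<lambda>z. snd d (w z)) \<circ> (\<lambda>t. z + t *\<^sub>R h) has_derivative (?D \<circ> f') \<circ> (\<lambda>t. t *\<^sub>R h)) (at 0)"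
      by (rule diff_chain_at)
    moreover have "(?D \<circ> f') \<circ> (\<lambda>t. t *\<^sub>R h) = (\<lambda>t. t *\<^sub>R (?D (f' h)))"
      using has_derivative_linear[OF der] by (auto simp: fun_eq_iff linear_scale dest: linear_scale)
    ultimately have "((\<lambda>t. snd d (w (z + t *\<^sub>R h))) has_vector_derivative ?D (f' h)) (at 0)"
      by (simp add: has_vector_derivative_def o_def)
    then show ?thesis using True by (simp add: partial_deriv_def tangent_of_coord_def vector_derivative_at)
  qed (simp add: partial_deriv_def tangent_of_coord_def)
qed

context
  fixes J :: "'m \<Rightarrow> ('m, 'e) tangent_vec \<Rightarrow> ('m, 'e) tangent_vec"
  assumes ac: "almost_complex_structure X A J" and C1: "C1_structure A J"
begin

lemma chart_subset_topspace:
  assumes "c \<in> A" "q \<in> fst c"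
  shows "q \<in> topspace X"
  by (rule subsetD[OF openin_subset[OF chart_props(1)[OF assms(1)]] assms(2)])

lemma J_tangent_of_coord:
  assumes c: "c \<in> A" "q \<in> fst c"
  shows "J q (tangent_of_coord A c q h) = tangent_of_coord A c q (coord_J J c (snd c q) h)"
proof -
  have "J q (tangent_of_coord A c q h) \<in> tangent_space A q"
    using ac chart_subset_topspace[OF c] tangent_of_coord_in_tangent_space[OF c]
    unfolding almost_complex_structure_def by blast
  from tangent_space_coord[OF c this] show ?thesis by (simp add: coord_J_def chart_props(5)[OF c])
qed

lemma coord_J_linear:
  assumes c: "c \<in> A" and x: "x \<in> snd c ` fst c"
  shows "linear (coord_J J c x)"
proof -
  obtain q where q: "q \<in> fst c" "x = snd c q" using x by blast
  have "coord_J J c x (a *\<^sub>R h + b *\<^sub>R k) = a *\<^sub>R coord_J J c x h + b *\<^sub>R coord_J J c x k" for a b h k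
  proof -
    let ?t = "tangent_of_coord A c q"
    have inT: "?t h \<in> tangent_space A q" for h by (rule tangent_of_coord_in_tangent_space[OF c q(1)])
    have "\<forall>v\<in>tangent_space A q. \<forall>w\<in>tangent_space A q. \<forall>a b.
        J q (\<lambda>c. a *\<^sub>R v c + b *\<^sub>R w c) = (\<lambda>c. a *\<^sub>R J q v c + b *\<^sub>R J q w c)"
      using ac chart_subset_topspace[OF c q(1)] unfolding almost_complex_structure_def by blast
    then have "J q (\<lambda>d. a *\<^sub>R ?t h d + b *\<^sub>R ?t k d) = (\<lambda>d. a *\<^sub>R J q (?t h) d + b *\<^sub>R J q (?t k) d)"
      using inT[of h] inT[of k] by blast
    then have "J q (?t (a *\<^sub>R h + b *\<^sub>R k)) c = a *\<^sub>R J q (?t h) c + b *\<^sub>R J q (?t k) c"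
      by (simp only: linear_tangent_of_coord[OF c q(1)])
    then show ?thesis by (simp only: coord_J_def q(2) chart_props(5)[OF c q(1)])
  qed
  note lin = this
  show ?thesis
  proof (rule linearI)
    show "coord_J J c x (h + k) = coord_J J c x h + coord_J J c x k" for h k using lin[of 1 h 1 k] by simp
    show "coord_J J c x (a *\<^sub>R h) = a *\<^sub>R coord_J J c x h" for a h using lin[of a h 0 h] by simp
  qed
qed

lemma coord_J_square:
  assumes c: "c \<in> A" and x: "x \<in> snd c ` fst c"
  shows "coord_J J c x (coord_J J c x h) = - h"
proof -
  obtain q where q: "q \<in> fst c" "x = snd c q" using x by blast
  have "J q (J q (tangent_of_coord A c q h)) = (\<lambda>d. - tangent_of_coord A c q h d)"
    using ac chart_subset_topspace[OF c q(1)] tangent_of_coord_in_tangent_space[OF c q(1)]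
    unfolding almost_complex_structure_def by blast
  then have "tangent_of_coord A c q (coord_J J c x (coord_J J c x h)) c = - tangent_of_coord A c q h c"
    by (simp add: J_tangent_of_coord[OF c q(1)] q(2))
  then show ?thesis by (simp add: tangent_of_coord_self[OF c q(1)])
qed

text \<open>It suffices to test the equation in one chart around the value.\<close>

lemma holomorphic_in_chart:
  assumes c: "c \<in> A" "w z \<in> fst c" and W: "open W" "z \<in> W" "continuous_map (top_of_set W) X w"
    and d: "((\<lambda>z. snd c (w z)) has_derivative f') (at z)"
  shows "partial_deriv A w \<i> z = J (w z) (partial_deriv A w 1 z) \<longleftrightarrow> f' \<i> = coord_J J c (snd c (w z)) (f' 1)"
proof -
  have inj: "tangent_of_coord A c (w z) a = tangent_of_coord A c (w z) b \<longleftrightarrow> a = b" for a b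
  proof
    assume "tangent_of_coord A c (w z) a = tangent_of_coord A c (w z) b"
    from fun_cong[OF this, of c] show "a = b" by (simp only: tangent_of_coord_self[OF c])
  qed simp
  show ?thesis
    unfolding partial_deriv_eq_tangent_of_coord[OF c W d] J_tangent_of_coord[OF c] inj by (rule refl)
qed

lemma chart_preimage:
  assumes c: "c \<in> A" and W: "open W" "continuous_map (top_of_set W) X w"
  shows "open {z\<in>W. w z \<in> fst c}" "continuous_on {z\<in>W. w z \<in> fst c} (\<lambda>z. snd c (w z))"
proof -
  define T where "T = {z\<in>W. w z \<in> fst c}"
  have "openin (top_of_set W) {x \<in> topspace (top_of_set W). w x \<in> fst c}"
    by (rule openin_continuous_map_preimage[OF W(2) chart_props(1)[OF c]])
  then have "openin (top_of_set W) T" by (simp add: T_def)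
  then have "open T" using W(1) by (rule openin_open_trans)
  then show "open {z\<in>W. w z \<in> fst c}" by (simp add: T_def)
  have "T \<subseteq> W" by (auto simp: T_def)
  then have "subtopology (top_of_set W) T = top_of_set T" by (simp add: subtopology_subtopology Int_absorb1)
  then have "continuous_map (top_of_set T) X w"
    using continuous_map_from_subtopology[OF W(2), of T] by simp
  then have "continuous_map (top_of_set T) (subtopology X (fst c)) w"
    by (simp add: continuous_map_in_subtopology) (auto simp: T_def)
  from continuous_map_compose[OF this homeomorphic_imp_continuous_map[OF chart_props(4)[OF c]]]
  have "continuous_on T (snd c \<circ> w)" by (simp add: continuous_map_in_subtopology)
  then show "continuous_on {z\<in>W. w z \<in> fst c} (\<lambda>z. snd c (w z))" by (simp add: T_def o_def)
qed

lemma removable_polar_set_in_chart: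
  fixes \<Omega> E :: "complex set" and u :: "complex \<Rightarrow> 'm"
  assumes \<Omega>: "open \<Omega>" and E: "closedin (top_of_set \<Omega>) E" "polar_in \<Omega> E"
    and u: "continuous_map (top_of_set \<Omega>) X u" and hol: "J_holomorphic_on X A J (\<Omega> - E) u"
    and c: "c \<in> A" and p: "p \<in> \<Omega>" "u p \<in> fst c"
  shows "\<exists>r f'. r > 0 \<and> ball p r \<subseteq> {z\<in>\<Omega>. u z \<in> fst c} \<and>
    (\<forall>z\<in>ball p r. ((\<lambda>z. snd c (u z)) has_derivative f' z) (at z) \<and> f' z \<i> = coord_J J c (snd c (u z)) (f' z 1)) \<and>
    (\<forall>h. continuous_on (ball p r) (\<lambda>z. f' z h))"
proof -
  define U where "U = (\<lambda>z. snd c (u z))"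
  define JJ where "JJ = coord_J J c"
  have "\<exists>V lam. p \<in> V \<and> subharmonic_on V lam \<and> \<not> (\<forall>\<^sub>F w in nhds p. lam w = -\<infinity>) \<and> E \<inter> V \<subseteq> lam -` {-\<infinity>}"
    using E(2) p unfolding polar_in_def by blast
  then obtain V lam where V: "p \<in> V" "subharmonic_on V lam" "\<not> (\<forall>\<^sub>F w in nhds p. lam w = -\<infinity>)" "E \<inter> V \<subseteq> lam -` {-\<infinity>}"
    by blast
  have oV: "open V" using V(2) by (simp add: subharmonic_on_def)
  define W where "W = {z\<in>\<Omega>. u z \<in> fst c}"
  have W: "open W" "continuous_on W U" "p \<in> W"
    using chart_preimage[OF c \<Omega> u] p unfolding W_def U_def by auto
  have yS: "U p \<in> snd c ` fst c" using p by (auto simp: U_def)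
  have JC1: "Ck_on 1 (snd c ` fst c) (\<lambda>x. JJ x h)" for h
    using C1 c unfolding C1_structure_def JJ_def coord_J_def by blast
  obtain \<sigma> K where \<sigma>: "\<sigma> > 0" "ball (U p) \<sigma> \<subseteq> snd c ` fst c" "lipschitz_structure (ball (U p) \<sigma>) JJ K"
    by (rule C1_structure_locally_lipschitz[OF chart_props(2)[OF c] yS coord_J_linear[OF c] coord_J_square[OF c] JC1[unfolded JJ_def], folded JJ_def])
  interpret lipschitz_structure "ball (U p) \<sigma>" JJ K by (rule \<sigma>(3))
  \<comment> \<open>At most half of the bound on the oscillation of the coordinates that the Schwarz lemma requires.\<close>
  define \<mu> where "\<mu> = min \<sigma> (1 / (46 * \<kappa>) / (2 * (1 + K)))"
  have \<mu>: "\<mu> > 0" using \<sigma>(1) \<kappa>_pos K1 by (simp add: \<mu>_def)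
  have "open (W \<inter> U -` ball (U p) \<mu>)" using W by (intro continuous_open_preimage) auto
  then have "open (W \<inter> U -` ball (U p) \<mu> \<inter> V)" using oV by blast
  moreover have "p \<in> W \<inter> U -` ball (U p) \<mu> \<inter> V" using W V \<mu> by auto
  ultimately obtain R where R: "R > 0" "ball p R \<subseteq> W \<inter> U -` ball (U p) \<mu> \<inter> V" using openE by blast
  have "open (\<Omega> - E)" using hol by (simp add: J_holomorphic_on_def)
  define G where "G = ball p R \<inter> (\<Omega> - E)"
  have G: "open G" "G \<subseteq> ball p R" using \<open>open (\<Omega> - E)\<close> by (auto simp: G_def)
  have cm: "continuous_map (top_of_set (\<Omega> - E)) X u" and "Ck_on 1 {z\<in>\<Omega> - E. u z \<in> fst c} U"
    using hol c unfolding J_holomorphic_on_def C1_map_on_def U_def by blast+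
  then obtain u' where u': "\<And>z. z \<in> \<Omega> - E \<Longrightarrow> u z \<in> fst c \<Longrightarrow> (U has_derivative u' z) (at z)"
    "\<And>h. continuous_on {z\<in>\<Omega> - E. u z \<in> fst c} (\<lambda>z. u' z h)" unfolding Ck_on_1_iff by auto
  have GW: "z \<in> \<Omega> - E \<and> u z \<in> fst c" if "z \<in> G" for z using that R(2) by (auto simp: G_def W_def)
  have "\<exists>P. continuous_on (ball p (R/12)) P \<and>
     (\<forall>z\<in>ball p (R/12). (U has_derivative (\<lambda>h. Re h *\<^sub>R P z + Im h *\<^sub>R JJ (U z) (P z))) (at z))"
  proof (rule removable_polar_set_local[OF V(2) R(1) _ V(3) _ _ G])
    show "ball p R \<subseteq> V" using R by blast
    show "continuous_on (ball p R) U" using W(2) R(2) by (blast intro: continuous_on_subset)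
    show "U z \<in> ball (U p) \<sigma>" if "z \<in> ball p R" for z using that R(2) by (auto simp: \<mu>_def)
    show "z \<in> G" if "z \<in> ball p R" "lam z \<noteq> -\<infinity>" for z using that R(2) V(4) by (auto simp: G_def W_def)
    show "(U has_derivative u' z) (at z)" if "z \<in> G" for z using u'(1) GW[OF that] by blast
    show "continuous_on G (\<lambda>z. u' z h)" for h by (rule continuous_on_subset[OF u'(2)]) (use GW in blast)
    show "u' z \<i> = JJ (U z) (u' z 1)" if "z \<in> G" for z
    proof -
      have zz: "z \<in> \<Omega> - E" "u z \<in> fst c" using GW[OF that] by auto
      have "partial_deriv A u \<i> z = J (u z) (partial_deriv A u 1 z)" using hol zz unfolding J_holomorphic_on_def by blast
      then show ?thesis
        using holomorphic_in_chart[OF c zz(2) \<open>open (\<Omega> - E)\<close> zz(1) cm u'(1)[OF zz, unfolded U_def]]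
        unfolding JJ_def U_def by blast
    qed
    show "(1 + K) * norm (U z - U w) \<le> 1 / (46 * \<kappa>)" if "z \<in> ball p R" "w \<in> ball p R" for z w
    proof -
      have "dist (U p) (U z) < \<mu>" "dist (U p) (U w) < \<mu>" using that R(2) by auto
      then have "norm (U z - U w) \<le> 2 * \<mu>" using dist_triangle3[of "U z" "U w" "U p"] by (simp add: dist_norm)
      also have "\<dots> \<le> 2 * (1 / (46 * \<kappa>) / (2 * (1 + K)))" by (intro mult_left_mono) (auto simp: \<mu>_def)
      also have "\<dots> = (1 / (46 * \<kappa>)) / (1 + K)" by simp
      finally have "(1 + K) * norm (U z - U w) \<le> (1 + K) * ((1 / (46 * \<kappa>)) / (1 + K))"
        using K1 by (intro mult_left_mono) auto
      also have "\<dots> = 1 / (46 * \<kappa>)" using K1 by simp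
      finally show ?thesis .
    qed
  qed
  then obtain P where P: "continuous_on (ball p (R/12)) P"
     "\<And>z. z \<in> ball p (R/12) \<Longrightarrow> (U has_derivative (\<lambda>h. Re h *\<^sub>R P z + Im h *\<^sub>R JJ (U z) (P z))) (at z)" by blast
  have sub: "ball p (R/12) \<subseteq> ball p R" using R by auto
  have JP: "continuous_on (ball p (R/12)) (\<lambda>z. JJ (U z) (P z))"
  proof (rule continuous_on_J[OF _ _ P(1)])
    show "continuous_on (ball p (R/12)) U" using W(2) R(2) sub by (blast intro: continuous_on_subset)
    show "U z \<in> ball (U p) \<sigma>" if "z \<in> ball p (R/12)" for z using that R(2) sub by (force simp: \<mu>_def)
  qed
  show ?thesis
  proof (intro exI[of _ "R/12"] exI[of _ "\<lambda>z h. Re h *\<^sub>R P z + Im h *\<^sub>R JJ (U z) (P z)"] conjI ballI allI)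
    show "R/12 > 0" using R by simp
    show "ball p (R/12) \<subseteq> {z\<in>\<Omega>. u z \<in> fst c}" using sub R(2) by (auto simp: W_def)
    show "((\<lambda>z. snd c (u z)) has_derivative (\<lambda>h. Re h *\<^sub>R P z + Im h *\<^sub>R JJ (U z) (P z))) (at z)" if "z \<in> ball p (R/12)" for z
      using P(2)[OF that] by (simp add: U_def[abs_def])
    show "Re \<i> *\<^sub>R P z + Im \<i> *\<^sub>R JJ (U z) (P z) = coord_J J c (snd c (u z)) (Re 1 *\<^sub>R P z + Im 1 *\<^sub>R JJ (U z) (P z))" for z
      by (simp add: U_def JJ_def)
    show "continuous_on (ball p (R/12)) (\<lambda>z. Re h *\<^sub>R P z + Im h *\<^sub>R JJ (U z) (P z))" for h
      by (intro continuous_intros P(1) JP)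
  qed
qed

end

end

theorem theoremB:
  fixes \<Omega> E :: "complex set"
    and X :: "'m topology"
    and A :: "('m, 'e::euclidean_space) chart set"
    and J :: "'m \<Rightarrow> ('m, 'e) tangent_vec \<Rightarrow> ('m, 'e) tangent_vec"
    and u :: "complex \<Rightarrow> 'm"
  assumes "open \<Omega>"
    and "closedin (top_of_set \<Omega>) E"
    and "polar_in \<Omega> E"
    and "smooth_manifold X A"
    and "almost_complex_structure X A J"
    and "C1_structure A J"
    and "continuous_map (top_of_set \<Omega>) X u"
    and "J_holomorphic_on X A J (\<Omega> - E) u"
  shows "J_holomorphic_on X A J \<Omega> u"
proof -
  note in_chart = removable_polar_set_in_chart[OF assms(4,5,6,1,2,3,7,8)]
  have C1: "Ck_on 1 {z\<in>\<Omega>. u z \<in> fst c} (\<lambda>z. snd c (u z))" if c: "c \<in> A" for c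
    unfolding Ck_on_1_iff
  proof (intro exI[of _ "\<lambda>z. frechet_derivative (\<lambda>z. snd c (u z)) (at z)"] conjI ballI allI)
    fix z assume z: "z \<in> {z\<in>\<Omega>. u z \<in> fst c}"
    obtain r f' where "r > 0" "\<And>x. x \<in> ball z r \<Longrightarrow> ((\<lambda>z. snd c (u z)) has_derivative f' x) (at x)"
      using in_chart[OF c, of z] z by blast
    then have "(\<lambda>z. snd c (u z)) differentiable (at z)" unfolding differentiable_def by (metis centre_in_ball)
    then show "((\<lambda>z. snd c (u z)) has_derivative frechet_derivative (\<lambda>z. snd c (u z)) (at z)) (at z)"
      by (simp add: frechet_derivative_works)
  next
    fix h
    show "continuous_on {z\<in>\<Omega>. u z \<in> fst c} (\<lambda>z. frechet_derivative (\<lambda>z. snd c (u z)) (at z) h)"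
    proof (rule continuous_at_imp_continuous_on, rule ballI)
      fix z assume z: "z \<in> {z\<in>\<Omega>. u z \<in> fst c}"
      obtain r f' where r: "r > 0" "\<And>x. x \<in> ball z r \<Longrightarrow> ((\<lambda>z. snd c (u z)) has_derivative f' x) (at x)"
        and co: "\<And>h. continuous_on (ball z r) (\<lambda>z. f' z h)"
        using in_chart[OF c, of z] z by blast
      have "continuous_on (ball z r) (\<lambda>z. frechet_derivative (\<lambda>z. snd c (u z)) (at z) h)"
        by (rule continuous_on_eq[OF co[of h]]) (use frechet_derivative_at[OF r(2)] in metis)
      then show "isCont (\<lambda>z. frechet_derivative (\<lambda>z. snd c (u z)) (at z) h) z"
        using r(1) by (simp add: continuous_on_eq_continuous_at)
    qed
  qed
  have "partial_deriv A u \<i> z = J (u z) (partial_deriv A u 1 z)" if z: "z \<in> \<Omega>" for z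
  proof -
    have "u z \<in> topspace X" using assms(7) z by (auto simp: continuous_map_def)
    moreover have "(\<Union>c\<in>A. fst c) = topspace X" using assms(4) unfolding smooth_manifold_def by blast
    ultimately obtain c where c: "c \<in> A" "u z \<in> fst c" by blast
    obtain r f' where r: "r > 0" 
      and f': "\<And>x. x \<in> ball z r \<Longrightarrow> ((\<lambda>z. snd c (u z)) has_derivative f' x) (at x) \<and> f' x \<i> = coord_J A J c (snd c (u x)) (f' x 1)"
      using in_chart[OF c(1) z c(2)] by blast
    have "z \<in> ball z r" using r by simp
    then show ?thesis
      using f'[of z] holomorphic_in_chart[OF assms(4,5,6) c assms(1) z assms(7), of "f' z"] by blast
  qed
  then show ?thesis using assms(1,7) C1 unfolding J_holomorphic_on_def C1_map_on_def by blast
qed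

end
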